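(* Let $p$ be a prime number and let $s\in\mathbb{N}$. For arbitrary weights $\boldsymbol{\gamma}=\{\gamma_{\mathfrak{u}} : \emptyset \neq \mathfrak{u} \subseteq [s]\}$ (nonnegative real numbers) we have \begin{align*} D_{p,\boldsymbol{\gamma}}^{\ast}(\mathcal{P}_{p,s}) &\le \frac{2}{\sqrt{p}} \max_{\emptyset \neq \mathfrak{u} \subseteq [s]} \gamma_{\mathfrak{u}}\, (\max \mathfrak{u}) \left(4 \log p\right)^{|\mathfrak{u}|},\\ D_{p^2,\boldsymbol{\gamma}}^{\ast}(\mathcal{Q}_{p^2,s}) &\le \frac{3}{p} \max_{\emptyset \neq \mathfrak{u} \subseteq [s]} \gamma_{\mathfrak{u}}\, (\max \mathfrak{u}) \left(6 \log p\right)^{|\mathfrak{u}|},\\ D_{p^2,\boldsymbol{\gamma}}^{\ast}(\mathcal{R}_{p^2,s}) &\le \frac{2}{p} \max_{\emptyset \neq \mathfrak{u} \subseteq [s]} \gamma_{\mathfrak{u}}\, (\max \mathfrak{u}) \left(4 \log p\right)^{|\mathfrak{u}|}. \end{align*}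
   Context: Notation: $[s]=\{1,2,\ldots,s\}$; $|\mathfrak{u}|$ is the cardinality and $\max\mathfrak{u}$ the largest element of $\mathfrak{u}\subseteq[s]$; $\log$ is the natural logarithm; $\{x\}=x-\lfloor x\rfloor$ is the fractional part of a real number $x$. Weighted star discrepancy: for an $N$-element point set $\mathcal{P}=\{\boldsymbol{x}_0,\ldots,\boldsymbol{x}_{N-1}\}$ in $[0,1)^s$ (points counted with multiplicity), the discrepancy function is $$\Delta(\alpha_1,\ldots,\alpha_s)=\frac{A_N\left(\prod_{i=1}^s[0,\alpha_i)\right)}{N}-\alpha_1\cdots\alpha_s ,$$ where $A_N(E)$ is the number of indices $n\in\{0,\ldots,N-1\}$ with $\boldsymbol{x}_n\in E$. For $\boldsymbol{z}\in[0,1]^s$ and $\mathfrak{u}\subseteq[s]$, $(\boldsymbol{z}_{\mathfrak{u}},1)$ denotes the vector $\boldsymbol{z}$ with all components whose indices are not in $\mathfrak{u}$ replaced by $1$. Given weights $\boldsymbol{\gamma}=\{\gamma_{\mathfrak{u}}:\emptyset\neq\mathfrak{u}\subseteq[s]\}$ with $\gamma_{\mathfrak{u}}\ge 0$, the weighted star discrepancy is $$D_{N,\boldsymbol{\gamma}}^{\ast}(\mathcal{P})=\sup_{\boldsymbol{z}\in[0,1]^s}\max_{\emptyset\neq\mathfrak{u}\subseteq[s]}\gamma_{\mathfrak{u}}\,|\Delta(\boldsymbol{z}_{\mathfrak{u}},1)| .$$ The $p$-sets, for a prime $p$: - $\mathcal{P}_{p,s}$ consists of the $p$ points $\boldsymbol{x}_n=(\{n/p\},\{n^2/p\},\ldots,\{n^s/p\})$,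 $n=0,1,\ldots,p-1$. - $\mathcal{Q}_{p^2,s}$ consists of the $p^2$ points $\boldsymbol{x}_n=(\{n/p^2\},\{n^2/p^2\},\ldots,\{n^s/p^2\})$, $n=0,1,\ldots,p^2-1$. - $\mathcal{R}_{p^2,s}$ is the multiset of the $p^2$ points $\boldsymbol{x}_{a,k}=(\{k/p\},\{ak/p\},\ldots,\{a^{s-1}k/p\})$, $a,k\in\{0,1,\ldots,p-1\}$. *)

theory Defs
  imports Complex_Main "HOL-Library.FuncSet" "HOL-Computational_Algebra.Primes"
begin

text \<open>
  A point of dimension \<open>s\<close> is a function on \<open>nat\<close> of which only the coordinates in \<open>{1..s}\<close> matter.
  A point set counted with multiplicity is a family \<open>x\<close> of points over a finite index set \<open>I\<close>,
  so that \<open>N = card I\<close> and \<open>x n i\<close> is the \<open>i\<close>-th coordinate of the point with index \<open>n\<close>.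
\<close>

definition counting :: "nat \<Rightarrow> 'i set \<Rightarrow> ('i \<Rightarrow> nat \<Rightarrow> real) \<Rightarrow> (nat \<Rightarrow> real set) \<Rightarrow> nat" where
  "counting s I x E = card {n \<in> I. \<forall>i\<in>{1..s}. x n i \<in> E i}"

definition discrepancy_fun :: "nat \<Rightarrow> 'i set \<Rightarrow> ('i \<Rightarrow> nat \<Rightarrow> real) \<Rightarrow> (nat \<Rightarrow> real) \<Rightarrow> real" where
  "discrepancy_fun s I x \<alpha> =
     real (counting s I x (\<lambda>i. {0..<\<alpha> i})) / real (card I) - (\<Prod>i=1..s. \<alpha> i)"

definition fill_one :: "nat set \<Rightarrow> (nat \<Rightarrow> real) \<Rightarrow> nat \<Rightarrow> real" where
  "fill_one u z = (\<lambda>i. if i \<in> u then z i else 1)"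

definition nonempty_subsets :: "nat \<Rightarrow> nat set set" where
  "nonempty_subsets s = {u. u \<noteq> {} \<and> u \<subseteq> {1..s}}"

text \<open>
  For \<open>s \<ge> 1\<close> the maximum is over a finite nonempty set. The supremum is over a nonempty
  set of reals, bounded above since every value of the discrepancy function on the unit cube
  has absolute value at most 1.
\<close>

definition weighted_star_discrepancy ::
    "nat \<Rightarrow> (nat set \<Rightarrow> real) \<Rightarrow> 'i set \<Rightarrow> ('i \<Rightarrow> nat \<Rightarrow> real) \<Rightarrow> real" where
  "weighted_star_discrepancy s \<gamma> I x =
     (SUP z \<in> {1..s} \<rightarrow>\<^sub>E {0..1}.
        MAX u \<in> nonempty_subsets s. \<gamma> u * \<bar>discrepancy_fun s I x (fill_one u z)\<bar>)"

definition P_point :: "nat \<Rightarrow> nat \<Rightarrow> nat \<Rightarrow> real" where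
  "P_point p n i = frac (real n ^ i / real p)"

definition Q_point :: "nat \<Rightarrow> nat \<Rightarrow> nat \<Rightarrow> real" where
  "Q_point p n i = frac (real n ^ i / real p ^ 2)"

text \<open>Since \<open>0 ^ 0 = 1\<close>, the first coordinate is \<open>k / p\<close> also for \<open>a = 0\<close>.\<close>

definition R_point :: "nat \<Rightarrow> nat \<times> nat \<Rightarrow> nat \<Rightarrow> real" where
  "R_point p = (\<lambda>(a, k) i. frac (real a ^ (i - 1) * real k / real p))"

end

theory Submission
  imports Defs "HOL-Analysis.Analysis" "HOL-Algebra.Algebraic_Closure_Type" "HOL-Number_Theory.Cong"
begin

text \<open>
  Expanding the indicator functions of the intervals \<open>[0, k/M)\<close> into characters of the integers
  modulo \<open>M\<close> bounds the discrepancy by a weighted sum of normalised exponential sums of the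
  polynomials \<open>\<Sum> h\<^sub>i x\<^sup>i\<close>, the weights adding up to at most \<open>(2 + log M)\<^sup>|\<^sup>u\<^sup>|\<close>. For \<open>\<R>\<close> and \<open>\<Q>\<close> the
  exponential sums reduce to counting roots modulo \<open>p\<close>; for \<open>\<Q>\<close> the frequencies that are divisible
  by \<open>p\<close> are treated trivially, since their weights are smaller by a factor \<open>p\<close>. If \<open>max u \<ge> p\<close>,
  the bounds exceed 1.

  For \<open>\<P>\<close> one needs Weil's bound for additive character sums. The sums over the extensions of
  degree \<open>k\<close> are the power sums \<open>- \<Sum> \<omega>\<^sup>k\<close> of the inverse roots of an L-function, which is a
  polynomial of degree at most \<open>d - 1\<close> by Newton's identities. Stepanov's method, in Bombieri's
  version, on the curve \<open>y\<^sup>p = y + f(x)\<close> bounds the sum over the extension of degree \<open>2 a\<close> by a constant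
  times \<open>p\<^sup>a\<close>. Letting \<open>a\<close> grow gives \<open>|\<omega>| \<le> \<surd>p\<close>.
\<close>

hide_const (open) Divisibility.prime Polynomials.degree Polynomials.lead_coeff up_ring.coeff up_ring.monom Module.smult
  Divisibility.irreducible Congruence.partition Coset.order

section \<open>Power sums and Newton's identities\<close>

text \<open>A bound for a single sum, such as Stepanov's, carries a constant depending on
  \<open>p\<close> and the degree. Only a comparison of exponential growth rates removes it, which
  is why the sums over all extensions are needed. These all live inside one algebraically closed
  field: the field with \<open>p^k\<close> elements is the fixed set of the \<open>k\<close>-th
  Frobenius iterate, and a monic polynomial over the prime field is a multiset of roots stable under
  Frobenius, so that multiplicativity of the L-function becomes a double count of roots. Stepanov's
  method bounds the number of \<open>x\<close> with a prescribed trace from above only; since the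
  counts for all traces add up to the size of the field, a lower bound follows. Even degrees make
  the field size \<open>r * r\<close> with \<open>r = p^a\<close>: one factor \<open>r\<close> is an
  exponent inside the auxiliary function, the other comes from taking the \<open>r\<close>-th power.
  The \<open>omega^k\<close> could cancel each other; simultaneous Dirichlet approximation supplies
  exponents for which they do not. The bases \<open>4 log p\<close> and \<open>6 log p\<close> come
  from \<open>2 + log p\<close> and \<open>2 + log (p^2)\<close> by
  \<open>log p >= log 2 >= 2/3\<close>.\<close>

definition psum :: "'a::comm_ring_1 multiset \<Rightarrow> nat \<Rightarrow> 'a" where
  "psum A i = (\<Sum>a\<in>#A. a ^ i)"

definition root_poly :: "'a::comm_ring_1 multiset \<Rightarrow> 'a poly" where
  "root_poly A = (\<Prod>a\<in>#A. [:- a, 1:])"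

lemma root_poly_simps [simp]:
  "root_poly {#} = 1" "root_poly (add_mset a A) = [:- a, 1:] * root_poly A"
  "root_poly (A + B) = root_poly A * root_poly B"
  by (simp_all add: root_poly_def)

lemma psum_simps [simp]:
  "psum {#} i = 0" "psum (add_mset a A) i = a ^ i + psum A i"
  by (simp_all add: psum_def)

lemma root_poly_monic:
  fixes A :: "'a::idom multiset"
  shows "lead_coeff (root_poly A) = 1" "degree (root_poly A) = size A" "root_poly A \<noteq> 0"
proof -
  have "lead_coeff (root_poly A) = 1 \<and> degree (root_poly A) = size A \<and> root_poly A \<noteq> 0"
  proof (induction A)
    case (add a A)
    have "lead_coeff ([:- a, 1:] * root_poly A) = lead_coeff [:- a, 1:] * 1"
      unfolding lead_coeff_mult by (rule arg_cong[OF conjunct1[OF add]])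
    hence "lead_coeff ([:- a, 1:] * root_poly A) = 1" by simp
    moreover have "degree ([:- a, 1:] * root_poly A) = size (add_mset a A)"
      using add by (subst degree_mult_eq) auto
    moreover have "[:- a, 1:] * root_poly A \<noteq> 0" using add by (simp del: mult_pCons_left)
    ultimately show ?case
      unfolding root_poly_simps by blast
  qed auto
  thus "lead_coeff (root_poly A) = 1" "degree (root_poly A) = size A" "root_poly A \<noteq> 0"
    by auto
qed

lemma proots_root_poly:
  fixes A :: "'a::idom multiset"
  shows "proots (root_poly A) = A"
proof (induction A)
  case (add a A)
  then show ?case
    by (subst root_poly_simps, subst proots_mult) (auto simp: root_poly_monic simp del: mult_pCons_left)
qed auto

lemma root_poly_proots:
  fixes g :: "'a::alg_closed_field poly"
  assumes "lead_coeff g = 1"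
  shows "root_poly (proots g) = g"
proof -
  have "g \<noteq> 0" using assms by auto
  then obtain A where "g = smult (lead_coeff g) (\<Prod>x\<in>#A. [:-x, 1:])"
    using alg_closed_imp_factorization by blast
  hence "g = root_poly A" by (simp add: assms root_poly_def)
  thus ?thesis by (simp add: proots_root_poly)
qed

lemma fps_of_reflect_root_poly:
  fixes A :: "'a::idom multiset"
  shows "fps_of_poly (reflect_poly (root_poly A)) = (\<Prod>a\<in>#A. 1 - fps_const a * fps_X)"
proof (induction A)
  case (add a A)
  have "reflect_poly [:-a, 1:] = [:1, -a:]"
    by (simp add: reflect_poly_def)
  hence "fps_of_poly (reflect_poly [:-a, 1:]) = 1 - fps_const a * fps_X"
    by (simp add: fps_of_poly_pCons flip: fps_const_neg)
  then show ?case using add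
    by (simp only: root_poly_simps reflect_poly_mult fps_of_poly_mult) simp
qed simp

text \<open>Logarithmic derivative: a factor \<open>1 - a X\<close> contributes
  \<open>a X / (1 - a X)\<close>, the series of the \<open>a^i\<close> with \<open>i >= 1\<close>,
  and contributions add under multiplication. The constant term is set to 0 because
  \<open>psum A 0\<close> would be the size of \<open>A\<close>.\<close>

lemma newton_fps:
  fixes A :: "'a::comm_ring_1 multiset"
  defines "G \<equiv> (\<Prod>a\<in>#A. 1 - fps_const a * fps_X)"
  shows "- (fps_X * fps_deriv G) = G * Abs_fps (\<lambda>i. if i = 0 then 0 else psum A i)"
  unfolding G_def
proof (induction A)
  case empty
  have "Abs_fps (\<lambda>i. 0) = (0::'a fps)" by (rule fps_ext) simp
  thus ?case by (simp add: fps_eq_iff)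
next
  case (add a A)
  let ?S = "\<lambda>A. Abs_fps (\<lambda>i. if i = 0 then 0 else psum A i)"
  let ?G = "\<Prod>a\<in>#A. 1 - fps_const a * fps_X"
  let ?L = "1 - fps_const a * fps_X"
  let ?s = "Abs_fps (\<lambda>i. if i = 0 then 0 else a ^ i)"
  have s: "?L * ?s = fps_const a * fps_X"
  proof (rule fps_ext)
    fix n
    show "(?L * ?s) $ n = (fps_const a * fps_X) $ n"
    proof -
      have "(?L * ?s) $ n = ?s $ n - a * (fps_X * ?s) $ n"
        by (simp add: left_diff_distrib mult.assoc)
      also have "\<dots> = (fps_const a * fps_X) $ n"
        by (cases n; cases "n - 1") (simp_all add: fps_X_mult_nth)
      finally show ?thesis .
    qed
  qed
  have S: "?S (add_mset a A) = ?s + ?S A" by (rule fps_ext) simp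
  have dL: "fps_deriv ?L = - fps_const a" by simp
  have "- (fps_X * fps_deriv (?L * ?G)) = ?L * (- (fps_X * fps_deriv ?G)) + (fps_const a * fps_X) * ?G"
    by (simp add: dL algebra_simps)
  also have "\<dots> = ?L * (?G * ?S A) + (?L * ?s) * ?G"
    using add by (simp only: s)
  also have "\<dots> = (?L * ?G) * (?s + ?S A)"
    by (simp only: algebra_simps)
  finally show ?case unfolding S by simp
qed

text \<open>Comparison of the coefficients of \<open>X^i\<close> in \<open>newton_fps\<close>; up to
  sign \<open>c i\<close> is the \<open>i\<close>-th elementary symmetric function. No division by
  \<open>i\<close> occurs, so the identity serves both in characteristic \<open>p\<close> and over
  the complex numbers.\<close>

lemma newton_identity:
  fixes A :: "'a::idom multiset"
  defines "c \<equiv> coeff (reflect_poly (root_poly A))"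
  shows "of_nat i * c i = - (\<Sum>j=1..i. psum A j * c (i - j))"
proof -
  let ?G = "fps_of_poly (reflect_poly (root_poly A))"
  have "- (fps_X * fps_deriv ?G) = ?G * Abs_fps (\<lambda>i. if i = 0 then 0 else psum A i)"
    unfolding fps_of_reflect_root_poly by (rule newton_fps)
  hence "(- (fps_X * fps_deriv ?G)) $ i = (?G * Abs_fps (\<lambda>i. if i = 0 then 0 else psum A i)) $ i"
    by simp
  also have "(- (fps_X * fps_deriv ?G)) $ i = - (of_nat i * c i)"
    by (cases i) (auto simp: c_def fps_X_mult_nth)
  also have "(?G * Abs_fps (\<lambda>i. if i = 0 then 0 else psum A i)) $ i
      = (Abs_fps (\<lambda>i. if i = 0 then 0 else psum A i) * ?G) $ i" by (simp add: mult.commute)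
  also have "\<dots> = (\<Sum>j=0..i. (if j = 0 then 0 else psum A j) * c (i - j))"
    by (simp add: fps_mult_nth c_def)
  also have "\<dots> = (\<Sum>j=1..i. psum A j * c (i - j))"
    by (intro sum.mono_neutral_cong_right) auto
  finally have "- (of_nat i * c i) = (\<Sum>j=1..i. psum A j * c (i - j))" .
  thus ?thesis by (metis minus_minus)
qed

text \<open>Reflection turns the coefficient of \<open>x^(m - d)\<close> into the
  \<open>d\<close>-th one, so the perturbation alters only \<open>c d\<close>. By Newton's
  identities the power sums below \<open>d\<close> do not notice it, and the \<open>d\<close>-th one
  is shifted by \<open>- d * t\<close>. Such translations later make the L-coefficients
  vanish.\<close>

lemma psum_perturb:
  fixes g :: "'a::alg_closed_field poly" and t :: 'a
  assumes "lead_coeff g = 1" "degree g = m" "1 \<le> d" "d \<le> m"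
  defines "g' \<equiv> g + monom t (m - d)"
  shows "lead_coeff g' = 1" "degree g' = m"
    "i < d \<Longrightarrow> psum (proots g') i = psum (proots g) i"
    "psum (proots g') d = psum (proots g) d - of_nat d * t"
proof -
  have cm: "coeff g' m = 1" using assms by auto
  have le: "degree g' \<le> m" unfolding g'_def using assms
    by (intro degree_add_le) (auto intro: order.trans[OF degree_monom_le])
  show deg: "degree g' = m" using le_degree[of g' m] cm le by simp
  show lc: "lead_coeff g' = 1" using cm deg by simp
  have s: "size (proots g) = m" "size (proots g') = m"
    using root_poly_monic(2)[of "proots g"] root_poly_monic(2)[of "proots g'"]
    unfolding root_poly_proots[OF assms(1)] root_poly_proots[OF lc] deg assms(2) by simp_all
  define c where "c = coeff (reflect_poly g)"
  define c' where "c' = coeff (reflect_poly g')"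
  have c: "c' i = (if i = d then c i + t else c i)" for i
  proof -
    have g': "coeff g' j = coeff g j + (if j = m - d then t else 0)" for j
      by (simp add: g'_def)
    show ?thesis
      unfolding c_def c'_def coeff_reflect_poly deg assms(2) g' using assms(3,4) by auto
  qed
  have c0: "c 0 = 1" unfolding c_def coeff_0_reflect_poly by (rule assms(1))
  have c0': "c' 0 = 1" using c0 c[of 0] assms by auto
  have n: "of_nat i * c i = - (\<Sum>j=1..i. psum (proots g) j * c (i - j))" for i
    using newton_identity[of i "proots g"] unfolding root_poly_proots[OF assms(1)] c_def .
  have n': "of_nat i * c' i = - (\<Sum>j=1..i. psum (proots g') j * c' (i - j))" for i
    using newton_identity[of i "proots g'"] unfolding root_poly_proots[OF lc] c'_def .
  have sp: "(\<Sum>j=1..i. f j * h (i - j)) = f i * h 0 + (\<Sum>j=1..<i. f j * h (i - j))" if "i \<ge> 1"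
    for f h :: "nat \<Rightarrow> 'a" and i
    using that by (subst sum.last_plus) auto
  have eq: "psum (proots g') i = psum (proots g) i" if "i < d" for i
    using that
  proof (induction i rule: less_induct)
    case (less i)
    show ?case
    proof (cases "i = 0")
      \<comment> \<open>Newton's identity is empty at 0; there the power sum is the number of
        roots.\<close>
      case True thus ?thesis by (simp add: psum_def s)
    next
      case False
      hence i: "i \<ge> 1" by simp
      have "psum (proots g') i = - of_nat i * c' i - (\<Sum>j=1..<i. psum (proots g') j * c' (i - j))"
        unfolding mult_minus_left n' sp[OF i] c0' by simp
      also have "\<dots> = - of_nat i * c i - (\<Sum>j=1..<i. psum (proots g) j * c (i - j))"
        using less by (intro arg_cong2[of _ _ _ _ "(-)"] sum.cong) (auto simp: c)
      also have "\<dots> = psum (proots g) i"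
        unfolding mult_minus_left n sp[OF i] c0 by simp
      finally show ?thesis .
    qed
  qed
  show "i < d \<Longrightarrow> psum (proots g') i = psum (proots g) i" by (rule eq)
  have i: "d \<ge> 1" by fact
  have "psum (proots g') d = - of_nat d * c' d - (\<Sum>j=1..<d. psum (proots g') j * c' (d - j))"
    unfolding mult_minus_left n' sp[OF i] c0' by simp
  also have "\<dots> = - of_nat d * (c d + t) - (\<Sum>j=1..<d. psum (proots g) j * c (d - j))"
    using eq assms by (intro arg_cong2[of _ _ _ _ "(-)"] sum.cong) (auto simp: c)
  also have "\<dots> = (- of_nat d * c d - (\<Sum>j=1..<d. psum (proots g) j * c (d - j))) - of_nat d * t"
    by (simp add: algebra_simps)
  also have "- of_nat d * c d - (\<Sum>j=1..<d. psum (proots g) j * c (d - j)) = psum (proots g) d"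
    unfolding mult_minus_left n sp[OF i] c0 by simp
  finally show "psum (proots g') d = psum (proots g) d - of_nat d * t" .
qed

section \<open>The Frobenius map\<close>

class alg_closed_prime_char = alg_closed_field + field_prime_char

text \<open>For \<open>k > 0\<close> this is the subfield with \<open>p^k\<close> elements; for
  \<open>k = 0\<close> it is the whole field. Subsets of one type replace a tower of field
  types.\<close>

definition frob_fixed :: "nat \<Rightarrow> 'a::alg_closed_prime_char set" where
  "frob_fixed k = {x. x ^ (CHAR('a) ^ k) = x}"

abbreviation prime_field :: "'a::alg_closed_prime_char set" where
  "prime_field \<equiv> frob_fixed 1"

lemma frob_add:
  fixes x y :: "'a::alg_closed_prime_char"
  shows "(x + y) ^ (CHAR('a) ^ k) = x ^ (CHAR('a) ^ k) + y ^ (CHAR('a) ^ k)"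
  by (rule freshmans_dream') auto

lemma frob_sum:
  fixes f :: "'b \<Rightarrow> 'a::alg_closed_prime_char"
  shows "(\<Sum>i\<in>I. f i) ^ (CHAR('a) ^ k) = (\<Sum>i\<in>I. f i ^ (CHAR('a) ^ k))"
  by (rule freshmans_dream_sum') auto

lemma frob_diff:
  fixes x y :: "'a::alg_closed_prime_char"
  shows "(x - y) ^ (CHAR('a) ^ k) = x ^ (CHAR('a) ^ k) - y ^ (CHAR('a) ^ k)"
  using frob_add[of "x - y" y k] by (simp add: eq_diff_eq)

lemma frob_inj:
  fixes x y :: "'a::alg_closed_prime_char"
  assumes "x ^ (CHAR('a) ^ k) = y ^ (CHAR('a) ^ k)"
  shows "x = y"
  using frob_diff[of x y k] assms by simp

lemma frob_surj: "\<exists>y. y ^ (CHAR('a) ^ k) = (x::'a::alg_closed_prime_char)"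
  by (rule nth_root_exists) simp

lemma frob_fixed_add: "x \<in> frob_fixed k \<Longrightarrow> y \<in> frob_fixed k \<Longrightarrow> x + y \<in> frob_fixed k"
  and frob_fixed_diff: "x \<in> frob_fixed k \<Longrightarrow> y \<in> frob_fixed k \<Longrightarrow> x - y \<in> frob_fixed k"
  and frob_fixed_mult: "x \<in> frob_fixed k \<Longrightarrow> y \<in> frob_fixed k \<Longrightarrow> x * y \<in> frob_fixed k"
  and frob_fixed_divide: "x \<in> frob_fixed k \<Longrightarrow> y \<in> frob_fixed k \<Longrightarrow> x / y \<in> frob_fixed k"
  and frob_fixed_0: "0 \<in> frob_fixed k" and frob_fixed_1: "1 \<in> frob_fixed k"
  by (auto simp: frob_fixed_def frob_add frob_diff power_mult_distrib power_divide)

lemma frob_fixed_power: "x \<in> frob_fixed k \<Longrightarrow> x ^ n \<in> frob_fixed k"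
  by (induction n) (auto simp: frob_fixed_1 frob_fixed_mult)

lemma frob_fixed_of_nat: "of_nat n \<in> frob_fixed k"
  by (induction n) (auto simp: frob_fixed_0 frob_fixed_1 frob_fixed_add)

lemma prime_field_frob: "x \<in> prime_field \<Longrightarrow> x ^ (CHAR('a) ^ k) = (x :: 'a::alg_closed_prime_char)"
  by (induction k) (auto simp: frob_fixed_def power_mult mult.commute)

lemma frob_fixed_finite: "k > 0 \<Longrightarrow> finite (frob_fixed k :: 'a::alg_closed_prime_char set)"
  and card_frob_fixed: "k > 0 \<Longrightarrow> card (frob_fixed k :: 'a set) = CHAR('a) ^ k"
proof -
  assume k: "k > 0"
  define q where "q = CHAR('a) ^ k"
  have p1: "CHAR('a) > 1" using prime_gt_1_nat CHAR_prime by blast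
  have q1: "q > 1" unfolding q_def by (rule one_less_power[OF p1 k])
  have q0: "of_nat q = (0::'a)" using k by (simp add: q_def)
  define h :: "'a poly" where "h = monom 1 q - monom 1 1"
  have deg: "degree h = q"
    using q1 by (intro antisym degree_le le_degree) (auto simp: h_def)
  have lc: "lead_coeff h = 1" unfolding deg using q1 by (simp add: h_def)
  hence h0: "h \<noteq> 0" by auto
  have roots: "set_mset (proots h) = frob_fixed k"
    using h0 by (simp add: frob_fixed_def q_def[symmetric] h_def poly_monom)
  \<comment> \<open>The derivative of \<open>X^q - X\<close> is the constant -1 because
    \<open>q\<close> vanishes in the field, so no root is double and the \<open>q\<close> roots
    counted with multiplicity are distinct.\<close>
  have dh: "pderiv h = - 1"
    using q0 by (simp add: h_def pderiv_diff pderiv_monom)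
  have "count (proots h) x \<le> 1" for x
  proof (rule ccontr)
    assume "\<not> count (proots h) x \<le> 1"
    hence "order x h \<ge> 2" using h0 by simp
    hence "[:-x, 1:] ^ 2 dvd h" by (subst order_divides) auto
    then obtain g where "h = [:-x, 1:] ^ 2 * g" by (rule dvdE)
    hence g: "h = [:-x, 1:] * ([:-x, 1:] * g)" by (simp only: power2_eq_square mult.assoc)
    have "poly (pderiv h) x = 0"
      unfolding g by (subst pderiv_mult) simp
    thus False by (simp add: dh)
  qed
  hence "proots h = mset_set (set_mset (proots h))"
    by (intro multiset_eqI) (metis (no_types, lifting) count_mset_set(1) count_mset_set(3) finite_set_mset less_one linorder_not_le not_in_iff order_antisym nle_le)
  hence "size (proots h) = card (frob_fixed k :: 'a set)"
    unfolding roots by (metis size_mset_set)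
  moreover have "size (proots h) = q"
    using root_poly_monic(2)[of "proots h"] unfolding root_poly_proots[OF lc] deg by simp
  ultimately show "card (frob_fixed k :: 'a set) = CHAR('a) ^ k" unfolding q_def by simp
  show "finite (frob_fixed k :: 'a set)" using roots by (metis finite_set_mset)
qed

lemma prime_field_eq: "(prime_field :: 'a::alg_closed_prime_char set) = of_nat ` {..<CHAR('a)}"
proof (rule sym, rule card_subset_eq)
  have "inj_on (of_nat :: nat \<Rightarrow> 'a) {..<CHAR('a)}"
  proof (rule linorder_inj_onI')
    fix i j :: nat assume ij: "i \<in> {..<CHAR('a)}" "j \<in> {..<CHAR('a)}" "i < j"
    hence "\<not> CHAR('a) dvd (j - i)" by (auto dest: dvd_imp_le)
    hence "of_nat (j - i) \<noteq> (0::'a)" by (simp add: of_nat_eq_0_iff_char_dvd)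
    thus "of_nat i \<noteq> (of_nat j :: 'a)" using ij by (simp add: of_nat_diff)
  qed
  thus "card (of_nat ` {..<CHAR('a)} :: 'a set) = card (prime_field :: 'a set)"
    by (simp add: card_image card_frob_fixed)
qed (auto simp: frob_fixed_finite frob_fixed_of_nat simp del: One_nat_def)

text \<open>A field with \<open>n\<close> elements would contain \<open>frob_fixed n\<close>, which
  has \<open>p^n > n\<close> elements. Infinity lets polynomials be compared through their
  values.\<close>

lemma infinite_UNIV_alg_closed_prime_char: "infinite (UNIV :: 'a::alg_closed_prime_char set)"
proof
  assume fin: "finite (UNIV :: 'a set)"
  let ?n = "card (UNIV :: 'a set)"
  have p1: "CHAR('a) > 1" using prime_gt_1_nat CHAR_prime by blast
  have n0: "?n > 0" using fin by (simp add: card_gt_0_iff)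
  have "CHAR('a) ^ ?n = card (frob_fixed ?n :: 'a set)" using card_frob_fixed n0 by metis
  also have "\<dots> \<le> ?n" using fin by (intro card_mono) auto
  also have "?n < 2 ^ ?n" by simp
  also have "(2::nat) ^ ?n \<le> CHAR('a) ^ ?n" using p1 by (intro power_mono) auto
  finally show False by simp
qed

lemma poly_eqI_alg_closed_prime_char:
  fixes g h :: "'a::alg_closed_prime_char poly"
  assumes "\<And>x. poly g x = poly h x"
  shows "g = h"
proof (rule ccontr)
  assume "g \<noteq> h"
  hence "finite {x. poly (g - h) x = 0}" by (intro poly_roots_finite) auto
  with assms show False using infinite_UNIV_alg_closed_prime_char[where 'a='a] by simp
qed

section \<open>Frobenius on polynomials and on their root multisets\<close>

definition frob_poly :: "'a::alg_closed_prime_char poly \<Rightarrow> 'a poly" where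
  "frob_poly = map_poly (\<lambda>c. c ^ CHAR('a))"

definition over_prime_field :: "'a::alg_closed_prime_char poly \<Rightarrow> bool" where
  "over_prime_field f \<longleftrightarrow> (\<forall>i. coeff f i \<in> prime_field)"

lemma coeff_frob_poly:
  fixes f :: "'a::alg_closed_prime_char poly"
  shows "coeff (frob_poly f) i = coeff f i ^ CHAR('a)"
  unfolding frob_poly_def by (subst coeff_map_poly) auto

lemma over_prime_field_iff_frob: "over_prime_field f \<longleftrightarrow> frob_poly f = f"
  by (auto simp: over_prime_field_def poly_eq_iff coeff_frob_poly frob_fixed_def)

lemma poly_frob_poly:
  fixes f :: "'a::alg_closed_prime_char poly"
  shows "poly f x ^ CHAR('a) = poly (frob_poly f) (x ^ CHAR('a))"
proof -
  have deg: "degree (frob_poly f) = degree f"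
    by (simp add: degree_def coeff_frob_poly)
  have "poly f x ^ CHAR('a) = (\<Sum>i\<le>degree f. (coeff f i * x ^ i) ^ CHAR('a))"
    unfolding poly_altdef using frob_sum[of _ _ 1] by simp
  also have "\<dots> = poly (frob_poly f) (x ^ CHAR('a))"
    unfolding poly_altdef deg
    by (simp add: coeff_frob_poly power_mult_distrib flip: power_mult) (simp add: mult.commute)
  finally show ?thesis .
qed

lemma poly_frob_over_prime_field:
  fixes f :: "'a::alg_closed_prime_char poly"
  assumes "over_prime_field f"
  shows "poly f x ^ (CHAR('a) ^ k) = poly f (x ^ (CHAR('a) ^ k))"
proof (induction k)
  case (Suc k)
  have "poly f x ^ (CHAR('a) ^ Suc k) = (poly f x ^ (CHAR('a) ^ k)) ^ CHAR('a)"
    by (simp add: mult.commute flip: power_mult)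
  also have "\<dots> = poly f ((x ^ (CHAR('a) ^ k)) ^ CHAR('a))"
    using assms by (simp add: Suc poly_frob_poly over_prime_field_iff_frob)
  finally show ?case by (simp add: mult.commute flip: power_mult)
qed simp

lemma poly_root_poly: "poly (root_poly A) x = (\<Prod>a\<in>#A. x - a)"
  by (induction A) (auto simp: algebra_simps)

lemma prod_mset_power: "(\<Prod>a\<in>#A. f a :: 'a::comm_monoid_mult) ^ n = (\<Prod>a\<in>#A. f a ^ n)"
  by (induction A) (auto simp: power_mult_distrib)

text \<open>Values are compared at \<open>y = x^p\<close>. Every element is such a power, and there
  both sides are the product of \<open>(x - a)^p\<close> over the roots \<open>a\<close>.\<close>

lemma frob_poly_root_poly:
  fixes A :: "'a::alg_closed_prime_char multiset"
  shows "frob_poly (root_poly A) = root_poly (image_mset (\<lambda>x. x ^ CHAR('a)) A)"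
proof (rule poly_eqI_alg_closed_prime_char)
  fix y :: 'a
  obtain x where y: "y = x ^ CHAR('a)" using frob_surj[of 1 y] by auto
  have "poly (frob_poly (root_poly A)) y = (\<Prod>a\<in>#A. (x - a) ^ CHAR('a))"
    unfolding y poly_frob_poly[symmetric] poly_root_poly prod_mset_power ..
  also have "\<dots> = (\<Prod>a\<in>#A. y - a ^ CHAR('a))"
    using frob_diff[of x _ 1] by (simp add: y)
  also have "\<dots> = poly (root_poly (image_mset (\<lambda>x. x ^ CHAR('a)) A)) y"
    by (simp add: poly_root_poly image_mset.compositionality o_def)
  finally show "poly (frob_poly (root_poly A)) y = poly (root_poly (image_mset (\<lambda>x. x ^ CHAR('a)) A)) y" .
qed

text \<open>The root multisets of the monic polynomials of degree \<open>m\<close> over the prime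
  field, see \<open>bij_betw_frob_inv\<close>. On multisets, multiplication and divisibility become
  addition and inclusion.\<close>

definition frob_inv :: "nat \<Rightarrow> 'a::alg_closed_prime_char multiset set" where
  "frob_inv m = {A. size A = m \<and> image_mset (\<lambda>x. x ^ CHAR('a)) A = A}"

lemma over_prime_field_root_poly_iff:
  "over_prime_field (root_poly A) \<longleftrightarrow> image_mset (\<lambda>x. x ^ CHAR('a)) A = (A :: 'a::alg_closed_prime_char multiset)"
  unfolding over_prime_field_iff_frob frob_poly_root_poly by (metis proots_root_poly)

lemma bij_betw_frob_inv:
  "bij_betw proots {g. lead_coeff g = 1 \<and> degree g = m \<and> over_prime_field g}
     (frob_inv m :: 'a::alg_closed_prime_char multiset set)"
proof (rule bij_betwI[where g = root_poly])
  show "proots \<in> {g :: 'a poly. lead_coeff g = 1 \<and> degree g = m \<and> over_prime_field g} \<rightarrow> frob_inv m"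
  proof (rule funcsetI, clarify)
    fix g :: "'a poly" assume g: "lead_coeff g = 1" "over_prime_field g"
    show "proots g \<in> frob_inv (degree g)"
      using root_poly_monic(2)[of "proots g"] over_prime_field_root_poly_iff[of "proots g"] g
      unfolding root_poly_proots[OF g(1)] by (simp add: frob_inv_def)
  qed
qed (auto simp: root_poly_proots proots_root_poly frob_inv_def root_poly_monic(2)
    root_poly_monic(1)[unfolded root_poly_monic(2)] over_prime_field_root_poly_iff)

lemma finite_frob_inv: "finite (frob_inv m :: 'a::alg_closed_prime_char multiset set)"
proof -
  let ?P = "PiE {..m} (\<lambda>_. prime_field :: 'a set)"
  let ?M = "{g :: 'a poly. lead_coeff g = 1 \<and> degree g = m \<and> over_prime_field g}"
  have "?M \<subseteq> (\<lambda>c. \<Sum>i\<le>m. monom (c i) i) ` ?P"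
  proof
    fix g assume "g \<in> ?M"
    hence "g = (\<Sum>i\<le>m. monom (restrict (coeff g) {..m} i) i)" "restrict (coeff g) {..m} \<in> ?P"
      using poly_as_sum_of_monoms[of g] by (auto simp: over_prime_field_def)
    thus "g \<in> (\<lambda>c. \<Sum>i\<le>m. monom (c i) i) ` ?P" by blast
  qed
  hence "finite ?M"
    by (rule finite_subset) (intro finite_imageI finite_PiE; simp add: frob_fixed_finite)
  thus ?thesis using bij_betw_finite[OF bij_betw_frob_inv] by blast
qed

section \<open>Traces and Frobenius orbits\<close>

definition frob_trace :: "nat \<Rightarrow> 'a::alg_closed_prime_char \<Rightarrow> 'a" where
  "frob_trace k y = (\<Sum>i<k. y ^ (CHAR('a) ^ i))"

text \<open>For \<open>x\<close> in \<open>frob_fixed k\<close> these are the roots of the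
  characteristic polynomial of \<open>x\<close> over the prime field. If \<open>x\<close> lies in a
  smaller field its conjugates are repeated, hence a multiset.\<close>

definition frob_orbit :: "nat \<Rightarrow> 'a::alg_closed_prime_char \<Rightarrow> 'a multiset" where
  "frob_orbit k x = (\<Sum>i<k. {#x ^ (CHAR('a) ^ i)#})"

lemma size_frob_orbit [simp]: "size (frob_orbit k x) = k"
  by (induction k) (auto simp: frob_orbit_def)

lemma sum_mset_frob_orbit: "(\<Sum>y\<in>#frob_orbit k x. h y) = (\<Sum>i<k. h (x ^ (CHAR('a) ^ i)))"
  for x :: "'a::alg_closed_prime_char"
  by (induction k) (auto simp: frob_orbit_def add.commute)

text \<open>Frobenius moves each entry to the next one; the entry that leaves the range is
  \<open>x^(p^k) = x\<close>, the first one.\<close>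

lemma frob_orbit_inv:
  fixes x :: "'a::alg_closed_prime_char"
  assumes "x \<in> frob_fixed k"
  shows "frob_orbit k x \<in> frob_inv k"
proof -
  have "image_mset (\<lambda>x. x ^ CHAR('a)) (frob_orbit k x) = (\<Sum>i<k. {#x ^ (CHAR('a) ^ Suc i)#})"
    by (induction k) (auto simp: frob_orbit_def mult.commute simp flip: power_mult)
  also have "\<dots> + {#x#} = frob_orbit (Suc k) x"
    unfolding frob_orbit_def by (subst sum.lessThan_Suc_shift) simp
  also have "\<dots> = frob_orbit k x + {#x#}"
    using assms by (simp add: frob_orbit_def frob_fixed_def)
  finally show ?thesis by (simp add: frob_inv_def)
qed

lemma count_image_mset_inj: "inj f \<Longrightarrow> count (image_mset f A) (f x) = count A x"
  by (induction A) (simp_all add: inj_eq)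

lemma frob_inv_count:
  fixes A :: "'a::alg_closed_prime_char multiset"
  assumes "A \<in> frob_inv m"
  shows "count A (x ^ (CHAR('a) ^ i)) = count A x"
proof (induction i)
  case (Suc i)
  have inj: "inj (\<lambda>x::'a. x ^ CHAR('a))"
    using frob_inj[of _ 1] by (auto intro: injI)
  have "count A (x ^ (CHAR('a) ^ Suc i)) = count (image_mset (\<lambda>x. x ^ CHAR('a)) A) ((x ^ (CHAR('a) ^ i)) ^ CHAR('a))"
    using assms by (simp add: frob_inv_def mult.commute flip: power_mult)
  also have "\<dots> = count A (x ^ (CHAR('a) ^ i))"
    using count_image_mset_inj[OF inj] by simp
  finally show ?case using Suc by simp
qed simp

lemma frob_fixed_add_iff:
  fixes x :: "'a::alg_closed_prime_char"
  assumes "x \<in> frob_fixed e"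
  shows "x \<in> frob_fixed (e + k) \<longleftrightarrow> x \<in> frob_fixed k"
  using assms by (simp add: frob_fixed_def power_add power_mult)

lemma frob_fixed_mult_add_iff:
  fixes x :: "'a::alg_closed_prime_char"
  assumes "x \<in> frob_fixed e"
  shows "x \<in> frob_fixed (j * e + k) \<longleftrightarrow> x \<in> frob_fixed k"
  by (induction j) (auto simp: add.assoc frob_fixed_add_iff[OF assms])

lemma count_frob_orbit: "count (frob_orbit k x) y = card {i. i < k \<and> x ^ (CHAR('a) ^ i) = y}"
  for x :: "'a::alg_closed_prime_char"
proof (induction k)
  case (Suc k)
  have "{i. i < Suc k \<and> x ^ (CHAR('a) ^ i) = y} =
     {i. i < k \<and> x ^ (CHAR('a) ^ i) = y} \<union> (if x ^ (CHAR('a) ^ k) = y then {k} else {})"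
    by (auto simp: less_Suc_eq)
  thus ?case using Suc by (auto simp: frob_orbit_def)
qed (simp add: frob_orbit_def)

lemma frob_orbit_mult:
  fixes x :: "'a::alg_closed_prime_char"
  assumes "x \<in> frob_fixed e"
  shows "frob_orbit (j * e) x = repeat_mset j (frob_orbit e x)"
proof (induction j)
  case (Suc j)
  have "frob_orbit (Suc j * e) x = (\<Sum>i<e + j * e. {#x ^ (CHAR('a) ^ i)#})"
    by (simp add: frob_orbit_def)
  also have "\<dots> = frob_orbit e x + (\<Sum>i<j * e. {#x ^ (CHAR('a) ^ (e + i))#})"
    unfolding frob_orbit_def lessThan_atLeast0 by (subst sum.atLeastLessThan_concat[of 0 e, symmetric]) (auto simp: sum.atLeastLessThan_shift_0[of _ e] add.commute)
  also have "(\<Sum>i<j * e. {#x ^ (CHAR('a) ^ (e + i))#}) = frob_orbit (j * e) x"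
    using assms unfolding frob_orbit_def by (simp add: power_add power_mult frob_fixed_def)
  finally show ?case using Suc by simp
qed (simp add: frob_orbit_def)

text \<open>This is where the Euler product of the L-function enters: a root \<open>x\<close> of a polynomial over the
  prime field is counted once for each power of its minimal polynomial dividing that polynomial.\<close>

lemma card_frob_orbit_subset:
  fixes A :: "'a::alg_closed_prime_char multiset"
  assumes A: "A \<in> frob_inv m"
  shows "card {k. k \<ge> 1 \<and> x \<in> frob_fixed k \<and> frob_orbit k x \<subseteq># A} = count A x"
proof (cases "x \<in># A")
  case False
  have "\<not> frob_orbit k x \<subseteq># A" if "k \<ge> 1" for k
  proof
    assume "frob_orbit k x \<subseteq># A"
    moreover have "x \<in># frob_orbit k x"
    proof -
      have "0 \<in> {i. i < k \<and> x ^ (CHAR('a) ^ i) = x}" using that by auto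
      hence "card {i. i < k \<and> x ^ (CHAR('a) ^ i) = x} > 0" by (subst card_gt_0_iff) auto
      thus ?thesis using count_frob_orbit[of k x x] by (simp flip: count_greater_zero_iff)
    qed
    ultimately show False using False by (meson mset_subset_eqD)
  qed
  hence "{k. k \<ge> 1 \<and> x \<in> frob_fixed k \<and> frob_orbit k x \<subseteq># A} = {}" by auto
  thus ?thesis using False by (simp only: not_in_iff card.empty)
next
  case True
  \<comment> \<open>The conjugates of \<open>x\<close> stay in the finite support of
    \<open>A\<close>, so two of them coincide, and injectivity of Frobenius cancels the common
    power.\<close>
  have "\<exists>e\<ge>1. x \<in> frob_fixed e"
  proof -
    have "(\<lambda>i. x ^ (CHAR('a) ^ i)) ` UNIV \<subseteq> set_mset A"
      using True frob_inv_count[OF A, of x] by (auto simp flip: count_greater_zero_iff)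
    hence "finite ((\<lambda>i. x ^ (CHAR('a) ^ i)) ` UNIV)" using finite_subset by blast
    then obtain i0 j0 where "i0 < j0" "x ^ (CHAR('a) ^ i0) = x ^ (CHAR('a) ^ j0)"
      using finite_imageD[of "\<lambda>i. x ^ (CHAR('a) ^ i)" "UNIV :: nat set"] infinite_UNIV_nat
      by (metis injI linorder_neq_iff)
    moreover from this have "x ^ (CHAR('a) ^ j0) = (x ^ (CHAR('a) ^ (j0 - i0))) ^ (CHAR('a) ^ i0)"
      by (simp flip: power_mult power_add)
    ultimately have "x = x ^ (CHAR('a) ^ (j0 - i0))" by (metis frob_inj)
    thus ?thesis using \<open>i0 < j0\<close> by (intro exI[of _ "j0 - i0"]) (auto simp: frob_fixed_def)
  qed
  \<comment> \<open>\<open>e\<close> is the degree of \<open>x\<close> over the prime field; below,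
    \<open>x\<close> lies in \<open>frob_fixed k\<close> exactly when \<open>e\<close> divides
    \<open>k\<close>, including \<open>k = 0\<close>.\<close>
  define e where "e = (LEAST e. e \<ge> 1 \<and> x \<in> frob_fixed e)"
  have e: "e \<ge> 1" "x \<in> frob_fixed e"
    using LeastI_ex[OF \<open>\<exists>e\<ge>1. x \<in> frob_fixed e\<close>] by (auto simp: e_def)
  have least: "e \<le> k" if "k \<ge> 1" "x \<in> frob_fixed k" for k
    unfolding e_def using that by (intro Least_le) auto
  have fixed_iff: "x \<in> frob_fixed k \<longleftrightarrow> e dvd k" for k
  proof -
    have "x \<in> frob_fixed k \<longleftrightarrow> x \<in> frob_fixed (k mod e)"
      using frob_fixed_mult_add_iff[OF e(2), of "k div e" "k mod e"] by (simp add: mult.commute)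
    also have "\<dots> \<longleftrightarrow> k mod e = 0"
      using least[of "k mod e"] e(1) mod_less_divisor[of e k]
      by (cases "k mod e") (auto simp: frob_fixed_def)
    finally show ?thesis by auto
  qed
  have count_le: "count (frob_orbit e x) y \<le> 1" for y
  proof -
    have "i = j" if "i < e" "j < e" "x ^ (CHAR('a) ^ i) = x ^ (CHAR('a) ^ j)" for i j
      using that
    proof (induction i j rule: linorder_wlog)
      case (le i j)
      have "x ^ (CHAR('a) ^ j) = (x ^ (CHAR('a) ^ (j - i))) ^ (CHAR('a) ^ i)"
        using le by (simp flip: power_mult power_add)
      hence "x = x ^ (CHAR('a) ^ (j - i))" using le by (metis frob_inj)
      hence "x \<in> frob_fixed (j - i)" by (simp add: frob_fixed_def)
      hence "e dvd j - i" by (simp add: fixed_iff)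
      thus ?case using le by (auto dest: dvd_imp_le)
    qed auto
    thus ?thesis unfolding count_frob_orbit One_nat_def
      by (subst card_le_Suc0_iff_eq) auto
  qed
  have count_x: "count (frob_orbit e x) x = 1"
  proof -
    have "0 \<in> {i. i < e \<and> x ^ (CHAR('a) ^ i) = x}" using e by auto
    hence "card {i. i < e \<and> x ^ (CHAR('a) ^ i) = x} > 0" by (subst card_gt_0_iff) auto
    thus ?thesis using count_frob_orbit[of e x x] count_le[of x] by linarith
  qed
  have subset_iff: "frob_orbit (j * e) x \<subseteq># A \<longleftrightarrow> j \<le> count A x" for j
  proof
    assume "frob_orbit (j * e) x \<subseteq># A"
    hence "count (frob_orbit (j * e) x) x \<le> count A x" by (simp add: subseteq_mset_def)
    thus "j \<le> count A x" by (simp add: frob_orbit_mult[OF e(2)] count_x)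
  next
    assume j: "j \<le> count A x"
    show "frob_orbit (j * e) x \<subseteq># A"
    proof (rule mset_subset_eqI)
      fix y
      show "count (frob_orbit (j * e) x) y \<le> count A y"
      proof (cases "y \<in># frob_orbit e x")
        case True
        then obtain i where "y = x ^ (CHAR('a) ^ i)"
          by (auto simp: frob_orbit_def set_mset_sum)
        hence *: "count A y = count A x" using frob_inv_count[OF A] by simp
        have "j * count (frob_orbit e x) y \<le> j * 1" by (rule mult_le_mono2[OF count_le])
        also have "\<dots> \<le> count A y" using j * by simp
        finally show ?thesis by (simp add: frob_orbit_mult[OF e(2)])
      qed (simp add: frob_orbit_mult[OF e(2)] not_in_iff)
    qed
  qed
  \<comment> \<open>Only \<open>k = j * e\<close> occurs. The orbit is then \<open>j\<close> times
    the simple orbit, on which \<open>A\<close> has constant multiplicity, so it fits exactly for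
    \<open>j <= count A x\<close>.\<close>
  have "{k. k \<ge> 1 \<and> x \<in> frob_fixed k \<and> frob_orbit k x \<subseteq># A} = (\<lambda>j. j * e) ` {1..count A x}"
  proof (intro equalityI subsetI)
    fix k assume "k \<in> {k. k \<ge> 1 \<and> x \<in> frob_fixed k \<and> frob_orbit k x \<subseteq># A}"
    hence k: "k \<ge> 1" "e dvd k" "frob_orbit k x \<subseteq># A" by (simp_all add: fixed_iff)
    obtain j where j: "k = j * e" using k(2) by (metis dvd_div_mult_self)
    have "j \<in> {1..count A x}" using k(1,3) unfolding j subset_iff by (cases j) simp_all
    thus "k \<in> (\<lambda>j. j * e) ` {1..count A x}" unfolding j by (rule imageI)
  next
    fix k assume "k \<in> (\<lambda>j. j * e) ` {1..count A x}"
    then obtain j where "k = j * e" "j \<in> {1..count A x}" by (rule imageE)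
    hence j: "k = j * e" "1 \<le> j" "j \<le> count A x" by simp_all
    have "1 * 1 \<le> j * e" using j(2) e(1) by (rule mult_le_mono)
    moreover have "frob_orbit (j * e) x \<subseteq># A" unfolding subset_iff by (rule j(3))
    moreover have "x \<in> frob_fixed (j * e)" unfolding fixed_iff by (rule dvd_triv_right)
    ultimately show "k \<in> {k. k \<ge> 1 \<and> x \<in> frob_fixed k \<and> frob_orbit k x \<subseteq># A}"
      unfolding j(1) by simp
  qed
  also have "card \<dots> = count A x"
    using e by (subst card_image) (auto intro: inj_onI)
  finally show ?thesis .
qed

section \<open>The L-function of an additive character sum\<close>

text \<open>The recurrence says that \<open>T L'(T) / L(T)\<close> is the series of the
  \<open>S k T^k\<close>, where \<open>L\<close> is the generating polynomial of \<open>a\<close>,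
  of degree below \<open>d\<close>. The roots of the reversed polynomial are the inverse roots of
  \<open>L\<close>. Newton's identities give the same recurrence with \<open>- psum\<close> in place
  of \<open>S\<close>, and \<open>a 0 = 1\<close> makes its solution unique.\<close>

lemma exists_roots_of_recurrence:
  fixes a S :: "nat \<Rightarrow> complex"
  assumes "a 0 = 1" and a: "\<And>m. m \<ge> d \<Longrightarrow> a m = 0" and "d \<ge> 1"
    and rec: "\<And>m. of_nat m * a m = (\<Sum>k=1..m. S k * a (m - k))"
  shows "\<exists>\<Omega>. size \<Omega> \<le> d - 1 \<and> (\<forall>k\<ge>1. S k = - psum \<Omega> k)"
proof -
  define L where "L = (\<Sum>i\<le>d-1. monom (a i) i)"
  have cL: "coeff L i = a i" for i
    using a[of i] assms(3) by (auto simp: L_def coeff_sum sum.delta')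
  have L0: "coeff L 0 \<noteq> 0" using assms by (simp add: cL)
  have degL: "degree L \<le> d - 1" by (rule degree_le) (use a in \<open>auto simp: cL\<close>)
  define \<Omega> where "\<Omega> = proots (reflect_poly L)"
  have "coeff (reflect_poly L) (degree (reflect_poly L)) = coeff L 0"
    using L0 by (simp add: coeff_reflect_poly)
  hence lc: "lead_coeff (reflect_poly L) = 1" using assms by (simp add: cL)
  have root: "root_poly \<Omega> = reflect_poly L" unfolding \<Omega>_def by (rule root_poly_proots[OF lc])
  have refl: "reflect_poly (root_poly \<Omega>) = L" unfolding root using L0 by simp
  have newton: "of_nat i * a i = - (\<Sum>j=1..i. psum \<Omega> j * a (i - j))" for i
    using newton_identity[of i \<Omega>] unfolding refl cL .
  have "size \<Omega> \<le> d - 1"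
    using root_poly_monic(2)[of \<Omega>] L0 degL unfolding root by simp
  moreover have "S k = - psum \<Omega> k" if "k \<ge> 1" for k
    using that
  proof (induction k rule: less_induct)
    case (less k)
    have "(\<Sum>j=1..k. S j * a (k - j)) = S k + (\<Sum>j=1..<k. S j * a (k - j))"
      using less.prems \<open>a 0 = 1\<close> by (subst sum.last_plus) auto
    moreover have "(\<Sum>j=1..k. psum \<Omega> j * a (k - j)) = psum \<Omega> k + (\<Sum>j=1..<k. psum \<Omega> j * a (k - j))"
      using less.prems \<open>a 0 = 1\<close> by (subst sum.last_plus) auto
    moreover have "(\<Sum>j=1..<k. S j * a (k - j)) = - (\<Sum>j=1..<k. psum \<Omega> j * a (k - j))"
      unfolding sum_negf[symmetric] using less.IH by (intro sum.cong) auto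
    ultimately show ?case using rec[of k] newton[of k] by (simp add: algebra_simps)
  qed
  ultimately show ?thesis by blast
qed

text \<open>Only values on the prime field are constrained: for \<open>f\<close> over the prime
  field the arguments that occur are traces or Frobenius-invariant sums, which lie there.\<close>

locale additive_character =
  fixes \<psi> :: "'a::alg_closed_prime_char \<Rightarrow> complex"
  assumes psi_add: "x \<in> prime_field \<Longrightarrow> y \<in> prime_field \<Longrightarrow> \<psi> (x + y) = \<psi> x * \<psi> y"
    and norm_psi: "x \<in> prime_field \<Longrightarrow> norm (\<psi> x) = 1"
    and psi_nontrivial: "\<exists>x\<in>prime_field. \<psi> x \<noteq> 1"
begin

lemma psi_0: "\<psi> 0 = 1"
  using psi_add[of 0 0] norm_psi[of 0] by (auto simp: frob_fixed_0)

definition char_sum :: "'a poly \<Rightarrow> nat \<Rightarrow> complex" where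
  "char_sum f k = (\<Sum>x\<in>frob_fixed k. \<psi> (frob_trace k (poly f x)))"

text \<open>The coefficient of \<open>T^m\<close> in the L-function: a monic polynomial of degree
  \<open>m\<close> contributes the character of the sum of \<open>f\<close> over its roots, which is
  multiplicative in the polynomial.\<close>

definition L_coeff :: "'a poly \<Rightarrow> nat \<Rightarrow> complex" where
  "L_coeff f m = (\<Sum>A\<in>frob_inv m. \<psi> (\<Sum>x\<in>#A. poly f x))"

end

lemma sum_mset_power_CHAR:
  fixes h :: "'b \<Rightarrow> 'a::alg_closed_prime_char"
  shows "(\<Sum>x\<in>#A. h x) ^ CHAR('a) = (\<Sum>x\<in>#A. h x ^ CHAR('a))"
  using frob_add[where 'a = 'a and k = 1] by (induction A) auto

lemma sum_frob_inv_in_prime_field: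
  fixes f :: "'a::alg_closed_prime_char poly"
  assumes f: "over_prime_field f" and A: "A \<in> frob_inv m"
  shows "(\<Sum>x\<in>#A. poly f x) \<in> prime_field"
proof -
  have "(\<Sum>x\<in>#A. poly f x) ^ CHAR('a) = (\<Sum>x\<in>#A. poly f (x ^ CHAR('a)))"
    using poly_frob_over_prime_field[OF f, of _ 1] by (simp add: sum_mset_power_CHAR)
  also have "\<dots> = (\<Sum>x\<in>#image_mset (\<lambda>x. x ^ CHAR('a)) A. poly f x)"
    by (simp add: image_mset.compositionality o_def)
  also have "\<dots> = (\<Sum>x\<in>#A. poly f x)" using A by (simp add: frob_inv_def)
  finally show ?thesis by (simp add: frob_fixed_def)
qed

context additive_character
begin

lemma L_coeff_0: "L_coeff f 0 = 1"
proof -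
  have "frob_inv 0 = {{#} :: 'a multiset}" by (auto simp: frob_inv_def)
  thus ?thesis by (simp add: L_coeff_def psi_0)
qed

lemma sum_poly_eq_psum: "(\<Sum>x\<in>#A. poly f x) = (\<Sum>i\<le>degree f. coeff f i * psum A i)"
  for f :: "'b::comm_ring_1 poly"
  by (induction A) (auto simp: poly_altdef sum.distrib algebra_simps)

text \<open>Adding \<open>t x^(m - d)\<close> permutes the monic polynomials of degree
  \<open>m\<close> and, as \<open>f\<close> has degree \<open>d\<close>, shifts the sum of
  \<open>f\<close> over the roots by a constant. The coefficient is unchanged and yet multiplied by
  a character value different from 1.\<close>

lemma L_coeff_eq_0:
  assumes f: "over_prime_field f" and d: "\<not> CHAR('a) dvd degree f" and m: "m \<ge> degree f"
  shows "L_coeff f m = 0"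
proof -
  define d where "d = degree f"
  have d1: "1 \<le> d" using d by (cases d) (auto simp: d_def)
  have lf: "lead_coeff f \<noteq> 0" "lead_coeff f \<in> prime_field"
    using d1 f by (auto simp: d_def over_prime_field_def)
  have od: "of_nat d \<noteq> (0::'a)" using d by (simp add: of_nat_eq_0_iff_char_dvd d_def)
  obtain x0 where x0: "x0 \<in> prime_field" "\<psi> x0 \<noteq> 1" using psi_nontrivial by blast
  \<comment> \<open>The shift is \<open>- lead_coeff f * d * t\<close>; this \<open>t\<close> makes
    it equal to \<open>x0\<close>, which needs \<open>d\<close> to be invertible in the
    field.\<close>
  define t where "t = - x0 / (lead_coeff f * of_nat d)"
  have t: "t \<in> prime_field" unfolding t_def using x0 lf
    by (intro frob_fixed_divide frob_fixed_mult frob_fixed_of_nat)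
       (use frob_fixed_diff[OF frob_fixed_0 x0(1)] in auto)
  define M where "M = {g :: 'a poly. lead_coeff g = 1 \<and> degree g = m \<and> over_prime_field g}"
  define lam where "lam g = \<psi> (\<Sum>x\<in>#proots g. poly f x)" for g
  have L: "L_coeff f m = (\<Sum>g\<in>M. lam g)"
    unfolding L_coeff_def M_def lam_def by (rule sum.reindex_bij_betw[OF bij_betw_frob_inv, symmetric])
  have step: "g + monom u (m - d) \<in> M" if "g \<in> M" "u \<in> prime_field" for g u
    using psum_perturb(1,2)[of g m d u] that d1 m
    by (auto simp: M_def d_def over_prime_field_def frob_fixed_add frob_fixed_0)
  have tneg: "- t \<in> prime_field" using frob_fixed_diff[OF frob_fixed_0 t] by simp
  have bij: "bij_betw (\<lambda>g. g + monom t (m - d)) M M"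
    by (rule bij_betwI[where g = "\<lambda>g. g + monom (- t) (m - d)"])
       (use step t tneg in \<open>auto simp: add.assoc add_monom\<close>)
  have lam_step: "lam (g + monom t (m - d)) = \<psi> x0 * lam g" if "g \<in> M" for g
  proof -
    have g: "lead_coeff g = 1" "degree g = m" using that by (auto simp: M_def)
    let ?g = "g + monom t (m - d)"
    have split: "(\<Sum>i\<le>degree f. coeff f i * h i) = (\<Sum>i<d. coeff f i * h i) + lead_coeff f * h d" for h
      by (simp add: d_def flip: lessThan_Suc_atMost)
    have "(\<Sum>x\<in>#proots ?g. poly f x) = (\<Sum>i<d. coeff f i * psum (proots g) i)
        + lead_coeff f * (psum (proots g) d - of_nat d * t)"
      unfolding sum_poly_eq_psum split using psum_perturb(3)[OF g d1, where t = t] psum_perturb(4)[OF g d1, where t = t] m by (simp add: d_def)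
    also have "\<dots> = (\<Sum>x\<in>#proots g. poly f x) - lead_coeff f * of_nat d * t"
      unfolding sum_poly_eq_psum split by (simp add: algebra_simps)
    also have "lead_coeff f * of_nat d * t = - x0"
      using lf od by (simp add: t_def field_simps)
    finally have eq: "(\<Sum>x\<in>#proots ?g. poly f x) = x0 + (\<Sum>x\<in>#proots g. poly f x)" by simp
    have "proots g \<in> frob_inv m" using bij_betwE[OF bij_betw_frob_inv] that unfolding M_def by blast
    hence "(\<Sum>x\<in>#proots g. poly f x) \<in> prime_field" by (rule sum_frob_inv_in_prime_field[OF f])
    thus ?thesis unfolding lam_def eq using x0 by (simp add: psi_add)
  qed
  have "L_coeff f m = (\<Sum>g\<in>M. lam (g + monom t (m - d)))"
    unfolding L using sum.reindex_bij_betw[OF bij, of lam] by simp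
  also have "\<dots> = \<psi> x0 * L_coeff f m"
    unfolding L sum_distrib_left by (intro sum.cong) (auto simp: lam_step)
  finally show ?thesis using x0 by auto
qed

text \<open>Both sides sum \<open>lam A\<close> over the triples \<open>(k, x, A)\<close> with
  \<open>frob_orbit k x\<close> contained in \<open>A\<close>. For fixed \<open>k\<close> and
  \<open>x\<close> the complement of the orbit is an arbitrary invariant multiset of size
  \<open>m - k\<close>; for fixed \<open>A\<close> the number of pairs \<open>(k, x)\<close> is the
  sum of all multiplicities, that is \<open>m\<close>.\<close>

lemma L_coeff_recurrence:
  assumes f: "over_prime_field f"
  shows "of_nat m * L_coeff f m = (\<Sum>k=1..m. char_sum f k * L_coeff f (m - k))"
proof -
  define lam where "lam A = \<psi> (\<Sum>x\<in>#A. poly f x)" for A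
  have fin: "finite (frob_inv n :: 'a multiset set)" for n by (rule finite_frob_inv)
  have finF: "finite (frob_fixed k :: 'a set)" if "k \<ge> 1" for k using that by (intro frob_fixed_finite) auto
  have inner: "char_sum f k * L_coeff f (m - k) =
     (\<Sum>A\<in>frob_inv m. \<Sum>x\<in>frob_fixed k. if frob_orbit k x \<subseteq># A then lam A else 0)"
    if k: "k \<in> {1..m}" for k
  proof -
    have "char_sum f k * L_coeff f (m - k) = (\<Sum>x\<in>frob_fixed k. \<Sum>h\<in>frob_inv (m - k).
        \<psi> (frob_trace k (poly f x)) * lam h)"
      by (simp add: char_sum_def L_coeff_def lam_def sum_product)
    also have "\<dots> = (\<Sum>x\<in>frob_fixed k. \<Sum>A\<in>{A\<in>frob_inv m. frob_orbit k x \<subseteq># A}. lam A)"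
    proof (rule sum.cong[OF refl])
      fix x :: 'a assume x: "x \<in> frob_fixed k"
      note orb = frob_orbit_inv[OF x]
      have "(\<Sum>y\<in>#frob_orbit k x. poly f y) = frob_trace k (poly f x)"
        unfolding sum_mset_frob_orbit frob_trace_def by (simp add: poly_frob_over_prime_field[OF f])
      hence tr: "\<psi> (frob_trace k (poly f x)) * lam h = lam (frob_orbit k x + h)" if "h \<in> frob_inv (m - k)" for h
        unfolding lam_def using sum_frob_inv_in_prime_field[OF f orb] sum_frob_inv_in_prime_field[OF f that]
        by (simp add: psi_add)
      have bij: "bij_betw (\<lambda>h. frob_orbit k x + h) (frob_inv (m - k)) {A\<in>frob_inv m. frob_orbit k x \<subseteq># A}"
      proof (rule bij_betwI[where g = "\<lambda>A. A - frob_orbit k x"])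
        show "(\<lambda>A. A - frob_orbit k x) \<in> {A\<in>frob_inv m. frob_orbit k x \<subseteq># A} \<rightarrow> frob_inv (m - k)"
          using orb by (auto simp: frob_inv_def size_Diff_submset image_mset_Diff)
      qed (use orb k in \<open>auto simp: frob_inv_def\<close>)
      have "(\<Sum>A\<in>{A\<in>frob_inv m. frob_orbit k x \<subseteq># A}. lam A) = (\<Sum>h\<in>frob_inv (m - k). lam (frob_orbit k x + h))"
        by (rule sum.reindex_bij_betw[OF bij, symmetric])
      also have "\<dots> = (\<Sum>h\<in>frob_inv (m - k). \<psi> (frob_trace k (poly f x)) * lam h)"
        by (intro sum.cong) (auto simp: tr)
      finally show "(\<Sum>h\<in>frob_inv (m - k). \<psi> (frob_trace k (poly f x)) * lam h) =
          (\<Sum>A\<in>{A\<in>frob_inv m. frob_orbit k x \<subseteq># A}. lam A)" by simp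
    qed
    also have "\<dots> = (\<Sum>x\<in>frob_fixed k. \<Sum>A\<in>frob_inv m. if frob_orbit k x \<subseteq># A then lam A else 0)"
      by (intro sum.cong refl sum.inter_filter fin)
    finally show ?thesis by (subst sum.swap)
  qed
  have "(\<Sum>k=1..m. char_sum f k * L_coeff f (m - k)) =
     (\<Sum>A\<in>frob_inv m. \<Sum>k=1..m. \<Sum>x\<in>frob_fixed k. if frob_orbit k x \<subseteq># A then lam A else 0)"
    by (subst sum.swap) (intro sum.cong inner refl; assumption)
  also have "\<dots> = (\<Sum>A\<in>frob_inv m. of_nat m * lam A)"
  proof (rule sum.cong[OF refl])
    fix A :: "'a multiset" assume A: "A \<in> frob_inv m"
    have sz: "size A = m" using A by (simp add: frob_inv_def)
    have mem: "x \<in># A" if "k \<ge> 1" "frob_orbit k x \<subseteq># A" for k x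
    proof -
      have "x ^ (CHAR('a) ^ 0) \<in># frob_orbit k x"
        using that unfolding frob_orbit_def by (subst set_mset_sum) (auto intro!: bexI[of _ 0])
      thus ?thesis using that by (simp add: mset_subset_eqD)
    qed
    \<comment> \<open>Every \<open>x\<close> involved belongs to its own orbit and hence to
      \<open>A\<close>, so the range of \<open>x\<close> becomes independent of \<open>k\<close> and
      the sums can be swapped.\<close>
    have "(\<Sum>k=1..m. \<Sum>x\<in>frob_fixed k. if frob_orbit k x \<subseteq># A then lam A else 0)
      = (\<Sum>k=1..m. \<Sum>x\<in>set_mset A. if x \<in> frob_fixed k \<and> frob_orbit k x \<subseteq># A then lam A else 0)"
    proof (rule sum.cong[OF refl])
      fix k assume k: "k \<in> {1..m}"
      have "(\<Sum>x\<in>frob_fixed k. if frob_orbit k x \<subseteq># A then lam A else 0) =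
         (\<Sum>x\<in>{x\<in>frob_fixed k. frob_orbit k x \<subseteq># A}. lam A)"
        using finF k by (subst sum.inter_filter) auto
      also have "{x\<in>frob_fixed k. frob_orbit k x \<subseteq># A} = {x\<in>set_mset A. x \<in> frob_fixed k \<and> frob_orbit k x \<subseteq># A}"
        using mem k by auto
      also have "(\<Sum>x\<in>\<dots>. lam A) = (\<Sum>x\<in>set_mset A. if x \<in> frob_fixed k \<and> frob_orbit k x \<subseteq># A then lam A else 0)"
        by (subst sum.inter_filter) auto
      finally show "(\<Sum>x\<in>frob_fixed k. if frob_orbit k x \<subseteq># A then lam A else 0) = \<dots>" .
    qed
    also have "\<dots> = (\<Sum>x\<in>set_mset A. \<Sum>k=1..m. if x \<in> frob_fixed k \<and> frob_orbit k x \<subseteq># A then lam A else 0)"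
      by (rule sum.swap)
    also have "\<dots> = (\<Sum>x\<in>set_mset A. of_nat (count A x) * lam A)"
    proof (rule sum.cong[OF refl])
      fix x
      have "(\<Sum>k=1..m. if x \<in> frob_fixed k \<and> frob_orbit k x \<subseteq># A then lam A else 0) =
         (\<Sum>k\<in>{k\<in>{1..m}. x \<in> frob_fixed k \<and> frob_orbit k x \<subseteq># A}. lam A)"
        by (subst sum.inter_filter) auto
      \<comment> \<open>The bound \<open>k <= m\<close> is automatic, the orbit having
        \<open>k\<close> elements.\<close>
      also have "{k\<in>{1..m}. x \<in> frob_fixed k \<and> frob_orbit k x \<subseteq># A} =
          {k. k \<ge> 1 \<and> x \<in> frob_fixed k \<and> frob_orbit k x \<subseteq># A}"
        using size_mset_mono[of "frob_orbit _ x" A] sz by fastforce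
      finally show "(\<Sum>k=1..m. if x \<in> frob_fixed k \<and> frob_orbit k x \<subseteq># A then lam A else 0) = of_nat (count A x) * lam A"
        using card_frob_orbit_subset[OF A, of x] by simp
    qed
    also have "\<dots> = of_nat m * lam A"
      by (simp add: sz[symmetric] size_multiset_overloaded_eq sum_distrib_right)
    finally show "(\<Sum>k=1..m. \<Sum>x\<in>frob_fixed k. if frob_orbit k x \<subseteq># A then lam A else 0) = of_nat m * lam A" .
  qed
  also have "\<dots> = of_nat m * L_coeff f m" by (simp add: L_coeff_def lam_def sum_distrib_left)
  finally show ?thesis ..
qed

lemma char_sum_eq_psum:
  assumes f: "over_prime_field f" and d: "\<not> CHAR('a) dvd degree f"
  obtains \<Omega> where "size \<Omega> \<le> degree f - 1" "\<And>k. k \<ge> 1 \<Longrightarrow> char_sum f k = - psum \<Omega> k"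
proof -
  have "degree f \<ge> 1" using d by (cases "degree f") auto
  thus thesis
    using exists_roots_of_recurrence[of "L_coeff f" "degree f" "char_sum f"] that
      L_coeff_0 L_coeff_eq_0[OF f d] L_coeff_recurrence[OF f] by blast
qed

end

section \<open>Stepanov's method on Artin-Schreier curves\<close>

locale artin_schreier =
  fixes f :: "'a::alg_closed_prime_char poly"
  assumes f: "over_prime_field f" and not_dvd_degree: "\<not> CHAR('a) dvd degree f"
begin

abbreviation "d \<equiv> degree f"

text \<open>\<open>V n\<close> consists of the functions on the affine curve over the prime field whose pole order at
  infinity is less than \<open>n\<close>, \<open>wt (i, j)\<close> being the pole order of \<open>x ^ i * y ^ j\<close>.\<close>

definition wt :: "nat \<times> nat \<Rightarrow> nat" where "wt = (\<lambda>(i, j). i * CHAR('a) + j * d)"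

definition curve :: "('a \<times> 'a) set" where "curve = {(x, y). y ^ CHAR('a) = y + poly f x}"

definition xy_mono :: "nat \<times> nat \<Rightarrow> 'a \<times> 'a \<Rightarrow> 'a" where "xy_mono = (\<lambda>(i, j) (x, y). x ^ i * y ^ j)"

text \<open>Exponents of \<open>y\<close> below \<open>p\<close> suffice on the curve and make the
  weights pairwise distinct, so that a combination has a unique leading term.\<close>

definition low :: "nat \<Rightarrow> (nat \<times> nat) set" where "low n = {s. snd s < CHAR('a) \<and> wt s < n}"

definition V :: "nat \<Rightarrow> ('a \<times> 'a \<Rightarrow> 'a) set" where
  "V n = {h. \<exists>c. range c \<subseteq> prime_field \<and> (\<forall>P\<in>curve. h P = (\<Sum>s\<in>low n. c s * xy_mono s P))}"

section \<open>Normal forms of functions on the curve\<close>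

lemma xy_mono_apply: "xy_mono (i, j) (x, y) = x ^ i * y ^ j"
  by (simp add: xy_mono_def)

lemma V_E:
  assumes "h \<in> V n"
  obtains c where "range c \<subseteq> prime_field" "\<And>P. P \<in> curve \<Longrightarrow> h P = (\<Sum>s\<in>low n. c s * xy_mono s P)"
  using assms unfolding V_def by blast

lemma p_gt_1: "CHAR('a) > 1" using prime_gt_1_nat CHAR_prime by blast

lemma d_pos: "d > 0" using not_dvd_degree by (cases d) auto

text \<open>Equal weights make \<open>(j' - j) * d\<close> divisible by \<open>p\<close>; since
  \<open>p\<close> does not divide \<open>d\<close>, they determine \<open>j\<close> modulo
  \<open>p\<close>.\<close>

lemma wt_inj: "inj_on wt {s. snd s < CHAR('a)}"
proof -
  have *: "j = j'" if "i * CHAR('a) + j * d = i' * CHAR('a) + j' * d" "j \<le> j'" "j' < CHAR('a)" for i j i' j'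
  proof -
    have "(j' - j) * d = (i - i') * CHAR('a)"
      using that by (simp add: diff_mult_distrib)
    hence "CHAR('a) dvd (j' - j) * d" by simp
    hence "CHAR('a) dvd j' - j" using not_dvd_degree CHAR_prime[where 'a = 'a] prime_dvd_mult_iff by blast
    thus "j = j'" using that by (auto dest: dvd_imp_le)
  qed
  show ?thesis
  proof (rule inj_onI)
    fix s s' assume s: "s \<in> {s. snd s < CHAR('a)}" "s' \<in> {s. snd s < CHAR('a)}" "wt s = wt s'"
    obtain i j i' j' where ij: "s = (i, j)" "s' = (i', j')" by fastforce
    have "j = j'" using s ij *[of i j i' j'] *[of i' j' i j] by (cases "j \<le> j'") (auto simp: wt_def)
    thus "s = s'" using s ij p_gt_1 by (simp add: wt_def)
  qed
qed

lemma low_inj: "inj_on wt (low n)"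
  by (rule inj_on_subset[OF wt_inj]) (auto simp: low_def)

lemma finite_low [simp]: "finite (low n)"
  by (rule inj_on_finite[OF low_inj, of _ "{..<n}"]) (auto simp: low_def)

lemma card_low_le: "card (low n) \<le> n"
  using card_inj_on_le[OF low_inj, of n "{..<n}"] by (auto simp: low_def)

text \<open>Each \<open>v >= p * d\<close> is a weight: for \<open>j < p\<close> with
  \<open>j * d\<close> congruent to \<open>v\<close> modulo \<open>p\<close>, the difference
  \<open>v - j * d\<close> is a nonnegative multiple of \<open>p\<close>. The gaps below
  \<open>p * d\<close> are estimated crudely.\<close>

lemma card_low_ge: "n \<le> card (low n) + CHAR('a) * d"
proof -
  have "{CHAR('a) * d..<n} \<subseteq> wt ` low n"
  proof
    fix v assume v: "v \<in> {CHAR('a) * d..<n}"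
    have "coprime d CHAR('a)" using not_dvd_degree CHAR_prime[where 'a = 'a] prime_imp_coprime coprime_commute by blast
    then obtain x y where xy: "d * x = CHAR('a) * y + 1"
      using coprime_bezout_strong[of d "CHAR('a)"] p_gt_1 by auto
    define j where "j = (v * x) mod CHAR('a)"
    have jp: "j < CHAR('a)" using p_gt_1 by (simp add: j_def)
    have "j * d \<le> CHAR('a) * d" using jp by (intro mult_le_mono1 less_imp_le)
    also have "\<dots> \<le> v" using v by simp
    finally have jd: "j * d \<le> v" .
    have "(j * d) mod CHAR('a) = (v * (d * x)) mod CHAR('a)"
      unfolding j_def mod_mult_left_eq by (simp add: mult_ac)
    also have "\<dots> = v mod CHAR('a)" unfolding xy
      by (metis add.commute distrib_left mod_mult_self2 mult.left_commute mult.right_neutral)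
    finally have "CHAR('a) dvd v - j * d" using jd by (metis mod_eq_dvd_iff_nat)
    then obtain i where "v - j * d = i * CHAR('a)" by (metis dvd_div_mult_self)
    hence "v = wt (i, j)" using jd by (simp add: wt_def)
    moreover have "(i, j) \<in> low n" using v jp calculation by (simp add: low_def)
    ultimately show "v \<in> wt ` low n" by blast
  qed
  hence "card {CHAR('a) * d..<n} \<le> card (low n)" by (rule surj_card_le[OF finite_low])
  thus ?thesis by simp
qed

lemma low_mono: "m \<le> n \<Longrightarrow> low m \<subseteq> low n" by (auto simp: low_def)

lemma V_mono: "h \<in> V m" if V: "h \<in> V n" "n \<le> m" for h
proof -
  obtain c where c: "range c \<subseteq> prime_field" "\<And>P. P \<in> curve \<Longrightarrow> h P = (\<Sum>s\<in>low n. c s * xy_mono s P)"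
    by (rule V_E[OF V(1)]) blast
  let ?c = "\<lambda>s. if s \<in> low n then c s else 0"
  have "h P = (\<Sum>s\<in>low m. ?c s * xy_mono s P)" if "P \<in> curve" for P
    unfolding c(2)[OF that] using low_mono[OF \<open>n \<le> m\<close>]
    by (intro sum.mono_neutral_cong_left) auto
  moreover have "range ?c \<subseteq> prime_field" using c by (auto simp: frob_fixed_0)
  ultimately show ?thesis unfolding V_def by blast
qed

lemma V_zero: "(\<lambda>P. 0) \<in> V n"
  unfolding V_def by (auto intro!: exI[of _ "\<lambda>_. 0"] simp: frob_fixed_0)

lemma V_add: "(\<lambda>P. g P + h P) \<in> V n" if V: "g \<in> V n" "h \<in> V n" for g h
proof -
  obtain c where c: "range c \<subseteq> prime_field" "\<And>P. P \<in> curve \<Longrightarrow> g P = (\<Sum>s\<in>low n. c s * xy_mono s P)"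
    by (rule V_E[OF V(1)]) blast
  obtain c' where c': "range c' \<subseteq> prime_field" "\<And>P. P \<in> curve \<Longrightarrow> h P = (\<Sum>s\<in>low n. c' s * xy_mono s P)"
    by (rule V_E[OF V(2)]) blast
  have "range (\<lambda>s. c s + c' s) \<subseteq> prime_field" using c c' by (auto intro!: frob_fixed_add)
  moreover have "\<forall>P\<in>curve. g P + h P = (\<Sum>s\<in>low n. (c s + c' s) * xy_mono s P)"
    using c c' by (simp add: sum.distrib distrib_right)
  ultimately show ?thesis unfolding V_def by blast
qed

lemma V_scale: "(\<lambda>P. u * h P) \<in> V n" if V: "h \<in> V n" "u \<in> prime_field" for h u
proof -
  obtain c where c: "range c \<subseteq> prime_field" "\<And>P. P \<in> curve \<Longrightarrow> h P = (\<Sum>s\<in>low n. c s * xy_mono s P)"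
    by (rule V_E[OF V(1)]) blast
  have "range (\<lambda>s. u * c s) \<subseteq> prime_field" using c V by (auto intro!: frob_fixed_mult)
  moreover have "\<forall>P\<in>curve. u * h P = (\<Sum>s\<in>low n. (u * c s) * xy_mono s P)"
    using c by (simp add: sum_distrib_left mult.assoc)
  ultimately show ?thesis unfolding V_def by blast
qed

lemma V_sum: "(\<And>t. t \<in> T \<Longrightarrow> h t \<in> V n) \<Longrightarrow> (\<lambda>P. \<Sum>t\<in>T. h t P) \<in> V n"
  by (induction T rule: infinite_finite_induct) (auto simp: V_zero intro!: V_add)

lemma V_cong: "h \<in> V n \<Longrightarrow> (\<And>P. P \<in> curve \<Longrightarrow> g P = h P) \<Longrightarrow> g \<in> V n"
  unfolding V_def by auto

lemma mono_in_V: "s \<in> low n \<Longrightarrow> xy_mono s \<in> V n"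
  unfolding V_def
  by (auto intro!: exI[of _ "\<lambda>t. if t = s then 1 else 0"] simp: frob_fixed_0 frob_fixed_1 if_distrib[of "\<lambda>c. c * _"] cong: if_cong)

text \<open>Reducing by \<open>y ^ p = y + f(x)\<close> preserves the weight of the leading term, because \<open>y ^ p\<close> and \<open>x ^ d\<close> have the same weight.\<close>

lemma mono_leading:
  obtains s c where "snd s < CHAR('a)" "wt s = wt (i, j)" "c \<in> prime_field" "c \<noteq> 0"
    "(\<lambda>P. xy_mono (i, j) P - c * xy_mono s P) \<in> V (wt (i, j))"
proof -
  have "\<exists>s c. snd s < CHAR('a) \<and> wt s = wt (i, j) \<and> c \<in> prime_field \<and> c \<noteq> 0 \<and>
    (\<lambda>P. xy_mono (i, j) P - c * xy_mono s P) \<in> V (wt (i, j))"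
  proof (induction j arbitrary: i rule: less_induct)
    case (less j)
    show ?case
    proof (cases "j < CHAR('a)")
      case True
      thus ?thesis
        by (intro exI[of _ "(i, j)"] exI[of _ 1]) (auto simp: frob_fixed_1 V_zero)
    next
      case False
      define k where "k = j - CHAR('a)"
      have j: "j = CHAR('a) + k" using False by (simp add: k_def)
      have kj: "k < j" "Suc k < j" using p_gt_1 by (auto simp: j)
      have below: "xy_mono (i', j') \<in> V n" if less': "j' < j" "wt (i', j') < n" for i' j' n
      proof -
        obtain s c where s: "snd s < CHAR('a)" "wt s = wt (i', j')" "c \<in> prime_field"
          "(\<lambda>P. xy_mono (i', j') P - c * xy_mono s P) \<in> V (wt (i', j'))"
          using less[OF less'(1)] by blast
        have "(\<lambda>P. (xy_mono (i', j') P - c * xy_mono s P) + c * xy_mono s P) \<in> V n"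
          using s less' by (intro V_add V_scale mono_in_V V_mono[OF s(4)]) (auto simp: low_def)
        thus ?thesis by simp
      qed
      obtain s c where s: "snd s < CHAR('a)" "wt s = wt (i + d, k)" "c \<in> prime_field" "c \<noteq> 0"
          "(\<lambda>P. xy_mono (i + d, k) P - c * xy_mono s P) \<in> V (wt (i + d, k))"
        using less[OF kj(1)] by blast
      have w: "wt (i + d, k) = wt (i, j)" by (simp add: wt_def j algebra_simps)
      have w1: "wt (i, Suc k) < wt (i, j)" using p_gt_1 d_pos by (simp add: wt_def j add_mult_distrib)
      have we: "wt (i + e, k) < wt (i, j)" if "e < d" for e
        unfolding w[symmetric] using that p_gt_1 by (simp add: wt_def)
      let ?l = "lead_coeff f"
      have l: "?l \<noteq> 0" "?l \<in> prime_field" using d_pos f by (auto simp: over_prime_field_def)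
      have "(\<lambda>P. xy_mono (i, Suc k) P + (\<Sum>e<d. coeff f e * xy_mono (i + e, k) P)
          + ?l * (xy_mono (i + d, k) P - c * xy_mono s P)) \<in> V (wt (i, j))"
        using f l s(5) kj w w1 we
        by (intro V_add V_sum V_scale below) (auto simp: over_prime_field_def)
      moreover have "xy_mono (i, j) P - (?l * c) * xy_mono s P = xy_mono (i, Suc k) P + (\<Sum>e<d. coeff f e * xy_mono (i + e, k) P)
          + ?l * (xy_mono (i + d, k) P - c * xy_mono s P)" if "P \<in> curve" for P
      proof -
        obtain x y where P: "P = (x, y)" by fastforce
        have "y ^ CHAR('a) = y + ((\<Sum>e<d. coeff f e * x ^ e) + ?l * x ^ d)"
          using that unfolding curve_def P poly_altdef by (simp flip: lessThan_Suc_atMost)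
        hence "x ^ i * y ^ j = x ^ i * (y + ((\<Sum>e<d. coeff f e * x ^ e) + ?l * x ^ d)) * y ^ k"
          by (simp add: j power_add mult_ac)
        also have "\<dots> = x ^ i * y ^ Suc k + (\<Sum>e<d. coeff f e * (x ^ (i + e) * y ^ k)) + ?l * (x ^ (i + d) * y ^ k)"
          by (simp add: algebra_simps sum_distrib_left power_add)
        finally show ?thesis unfolding P xy_mono_apply by (simp add: right_diff_distrib mult.assoc)
      qed
      ultimately have "(\<lambda>P. xy_mono (i, j) P - (?l * c) * xy_mono s P) \<in> V (wt (i, j))"
        by (rule V_cong)
      thus ?thesis using s l w
        by (intro exI[of _ s] exI[of _ "?l * c"]) (auto simp: frob_fixed_mult)
    qed
  qed
  thus thesis using that by blast
qed

lemma mono_in_V': "wt (i, j) < n \<Longrightarrow> xy_mono (i, j) \<in> V n"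
proof -
  assume n: "wt (i, j) < n"
  obtain s c where s: "snd s < CHAR('a)" "wt s = wt (i, j)" "c \<in> prime_field"
    "(\<lambda>P. xy_mono (i, j) P - c * xy_mono s P) \<in> V (wt (i, j))"
    using mono_leading by blast
  have "(\<lambda>P. (xy_mono (i, j) P - c * xy_mono s P) + c * xy_mono s P) \<in> V n"
    using s n by (intro V_add V_scale mono_in_V V_mono[OF s(4)]) (auto simp: low_def)
  thus ?thesis by simp
qed

section \<open>The auxiliary function\<close>

lemma power_frob_xy_mono:
  assumes "x ^ (CHAR('a) ^ k) = x" "y ^ (CHAR('a) ^ k) = y + c"
  shows "xy_mono (i, j) (x, y) ^ (CHAR('a) ^ k) = x ^ i * (y + c) ^ j"
proof -
  have "xy_mono (i, j) (x, y) ^ (CHAR('a) ^ k) = (x ^ (CHAR('a) ^ k)) ^ i * (y ^ (CHAR('a) ^ k)) ^ j"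
    by (simp add: xy_mono_apply power_mult_distrib mult.commute flip: power_mult)
  thus ?thesis by (simp add: assms)
qed

text \<open>Expanding \<open>(y + c)^j\<close> only lowers the exponent of \<open>y\<close>, hence
  the weight, and \<open>c\<close> in the prime field keeps the coefficients there.\<close>

lemma mult_shifted_mono_in_V:
  assumes "wt (i, j) + wt (i', j') < n" "c \<in> prime_field"
  shows "(\<lambda>(x, y). xy_mono (i', j') (x, y) * (x ^ i * (y + c) ^ j)) \<in> V n"
proof (rule V_cong)
  show "(\<lambda>P. \<Sum>k\<le>j. (of_nat (j choose k) * c ^ (j - k)) * xy_mono (i' + i, j' + k) P) \<in> V n"
  proof (intro V_sum V_scale mono_in_V')
    fix k assume "k \<in> {..j}"
    hence "k * d \<le> j * d" by simp
    hence "wt (i' + i, j' + k) \<le> wt (i, j) + wt (i', j')" by (simp add: wt_def algebra_simps)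
    thus "wt (i' + i, j' + k) < n" using assms by simp
  qed (use assms in \<open>auto intro!: frob_fixed_mult frob_fixed_of_nat frob_fixed_power\<close>)
next
  fix P :: "'a \<times> 'a"
  obtain x y where P: "P = (x, y)" by fastforce
  show "(case P of (x, y) \<Rightarrow> xy_mono (i', j') (x, y) * (x ^ i * (y + c) ^ j)) =
    (\<Sum>k\<le>j. (of_nat (j choose k) * c ^ (j - k)) * xy_mono (i' + i, j' + k) P)"
    by (simp add: P xy_mono_apply binomial_ring sum_distrib_left power_add mult_ac)
qed

text \<open>Bombieri's form of Stepanov's method: the auxiliary function is
  \<open>\<Sum> a\<^sub>s\<^sub>t s t\<^sup>r\<close>. Its \<open>r\<close>-th power agrees with \<open>\<Sum> a\<^sub>s\<^sub>t s\<^sup>r t(x, y + c)\<close> at the points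
  to be counted, and the coefficients are chosen to make the latter vanish identically.\<close>

lemma exists_vanishing_combination:
  fixes r m N :: nat
  assumes c: "c \<in> prime_field" and r: "r = CHAR('a) ^ a" "a \<ge> 1"
    and N: "r * (r - 1) + m < N" and big: "card (low r) * card (low (Suc m)) > N"
  shows "\<exists>e. range e \<subseteq> prime_field \<and> (\<exists>t\<in>low r \<times> low (Suc m). e t \<noteq> 0) \<and>
    (\<forall>(x, y)\<in>curve. (\<Sum>((i', j'), (i, j))\<in>low r \<times> low (Suc m).
        e ((i', j'), (i, j)) * (xy_mono (i' * r, j' * r) (x, y) * (x ^ i * (y + c) ^ j))) = 0)"
proof -
  define T where "T = low r \<times> low (Suc m)"
  define M where "M = (\<lambda>t P. case (t, P) of (((i', j'), (i, j)), (x, y)) \<Rightarrow>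
      xy_mono (i' * r, j' * r) (x, y) * (x ^ i * (y + c) ^ j))"
  have MV: "M t \<in> V N" if "t \<in> T" for t
  proof -
    obtain i' j' i j where t: "t = ((i', j'), (i, j))" by (metis prod.collapse)
    have "wt (i' * r, j' * r) = r * wt (i', j')" by (simp add: wt_def algebra_simps)
    also have "\<dots> \<le> r * (r - 1)" using that by (intro mult_le_mono2) (auto simp: T_def t low_def)
    finally have "wt (i, j) + wt (i' * r, j' * r) < N"
      using that N by (auto simp: T_def t low_def)
    from mult_shifted_mono_in_V[OF this c] show ?thesis by (simp add: M_def t)
  qed
  let ?A = "PiE T (\<lambda>_. prime_field :: 'a set)"
  let ?B = "PiE (low N) (\<lambda>_. prime_field :: 'a set)"
  have pf: "finite (prime_field :: 'a set)" "card (prime_field :: 'a set) = CHAR('a)"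
    using card_frob_fixed[of 1, where 'a = 'a] by (auto intro: frob_fixed_finite)
  have "\<exists>b\<in>?B. \<forall>P\<in>curve. (\<Sum>t\<in>T. e t * M t P) = (\<Sum>s\<in>low N. b s * xy_mono s P)" if "e \<in> ?A" for e
  proof -
    have "(\<lambda>P. \<Sum>t\<in>T. e t * M t P) \<in> V N"
      using that MV by (intro V_sum V_scale) auto
    then obtain b where b: "range b \<subseteq> prime_field"
      "\<And>P. P \<in> curve \<Longrightarrow> (\<Sum>t\<in>T. e t * M t P) = (\<Sum>s\<in>low N. b s * xy_mono s P)"
      by (rule V_E) blast
    show ?thesis
      by (rule bexI[of _ "restrict b (low N)"]) (use b in auto)
  qed
  hence "\<forall>e\<in>?A. \<exists>b. b \<in> ?B \<and> (\<forall>P\<in>curve. (\<Sum>t\<in>T. e t * M t P) = (\<Sum>s\<in>low N. b s * xy_mono s P))"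
    by blast
  \<comment> \<open>\<open>C e\<close> is some choice of normal-form coefficients, not known to be
    linear in \<open>e\<close>; this is harmless because only the functions on the curve are
    compared.\<close>
  from bchoice[OF this] obtain C where C0: "\<forall>e\<in>?A. C e \<in> ?B \<and>
      (\<forall>P\<in>curve. (\<Sum>t\<in>T. e t * M t P) = (\<Sum>s\<in>low N. C e s * xy_mono s P))" ..
  have C: "C e \<in> ?B" "P \<in> curve \<Longrightarrow> (\<Sum>t\<in>T. e t * M t P) = (\<Sum>s\<in>low N. C e s * xy_mono s P)"
    if "e \<in> ?A" for e P
    using C0[rule_format, OF that] by blast+
  \<comment> \<open>Coefficients in the finite prime field allow counting in place of linear
    algebra: the difference of two families with the same normal form represents the zero
    function.\<close>
  have "\<not> inj_on C ?A"
  proof (rule pigeonhole)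
    have "card (C ` ?A) \<le> card ?B" by (intro card_mono finite_PiE image_subsetI C(1) pf(1) finite_low)
    also have "\<dots> = CHAR('a) ^ card (low N)" by (simp add: card_PiE pf[simplified])
    also have "\<dots> < CHAR('a) ^ card T"
      using big card_low_le[of N] p_gt_1
      by (intro power_strict_increasing) (auto simp: T_def card_cartesian_product)
    also have "\<dots> = card ?A" by (simp add: card_PiE pf[simplified] T_def)
    finally show "card (C ` ?A) < card ?A" .
  qed
  then obtain e1 e2 where e: "e1 \<in> ?A" "e2 \<in> ?A" "C e1 = C e2" "e1 \<noteq> e2" by (auto simp: inj_on_def)
  define e where "e t = (if t \<in> T then e1 t - e2 t else 0)" for t
  have "\<exists>t\<in>T. e1 t \<noteq> e2 t" using e(4) PiE_ext[OF e(1,2)] by blast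
  hence "\<exists>t\<in>T. e t \<noteq> 0" by (auto simp: e_def)
  moreover have "range e \<subseteq> prime_field"
    using e by (auto simp: e_def intro!: frob_fixed_diff frob_fixed_0)
  moreover have "(\<Sum>t\<in>T. e t * M t P) = 0" if "P \<in> curve" for P
  proof -
    have "(\<Sum>t\<in>T. e t * M t P) = (\<Sum>t\<in>T. e1 t * M t P) - (\<Sum>t\<in>T. e2 t * M t P)"
      unfolding sum_subtractf[symmetric] by (intro sum.cong) (auto simp: e_def left_diff_distrib)
    thus ?thesis using C(2)[OF e(1) that] C(2)[OF e(2) that] e(3) by simp
  qed
  hence "\<forall>(x, y)\<in>curve. (\<Sum>((i', j'), (i, j))\<in>T.
        e ((i', j'), (i, j)) * (xy_mono (i' * r, j' * r) (x, y) * (x ^ i * (y + c) ^ j))) = 0"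
    unfolding M_def by (simp add: case_prod_unfold split_beta)
  ultimately show ?thesis unfolding T_def by blast
qed

text \<open>Iterating \<open>y^p = y + f(x)\<close> adds one further conjugate of
  \<open>f(x)\<close> at each step. Hence, above an \<open>x\<close> of trace \<open>c\<close>, the
  \<open>p^k\<close>-th power map sends \<open>y\<close> to \<open>y + c\<close>.\<close>

lemma power_frob_artin_schreier:
  assumes "(x, y) \<in> curve"
  shows "y ^ (CHAR('a) ^ k) = y + frob_trace k (poly f x)"
proof (induction k)
  case (Suc k)
  have "y ^ (CHAR('a) ^ Suc k) = (y ^ CHAR('a)) ^ (CHAR('a) ^ k)" by (simp flip: power_mult)
  also have "\<dots> = y ^ (CHAR('a) ^ k) + poly f x ^ (CHAR('a) ^ k)"
    using assms by (simp add: curve_def frob_add)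
  finally show ?case using Suc by (simp add: frob_trace_def)
qed (simp add: frob_trace_def)

lemma exists_curve_point: "\<exists>y. (x, y) \<in> curve"
proof -
  let ?h = "monom 1 (CHAR('a)) - [:poly f x, 1:]"
  have "coeff ?h (CHAR('a)) \<noteq> 0" using p_gt_1 by (auto simp: coeff_pCons split: nat.splits)
  hence "degree ?h > 0" using le_degree[of ?h "CHAR('a)"] p_gt_1 by linarith
  then obtain y where "poly ?h y = 0" using alg_closed_imp_poly_has_root by blast
  thus ?thesis by (auto simp: curve_def poly_monom algebra_simps)
qed

text \<open>At a point \<open>x\<close> to be counted all \<open>p\<close> points of the curve above \<open>x\<close> are zeros,
  so every coefficient with respect to \<open>y\<close> vanishes at \<open>x\<close>.\<close>

lemma card_le_of_vanishing:
  assumes g: "g s0 \<noteq> 0" "\<And>s. g s \<noteq> 0 \<Longrightarrow> snd s < CHAR('a) \<and> wt s \<le> wt s0"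
    and Z: "\<And>x y. x \<in> Z \<Longrightarrow> (x, y) \<in> curve \<Longrightarrow> (\<Sum>s\<in>low (Suc (wt s0)). g s * xy_mono s (x, y)) = 0"
  shows "CHAR('a) * card Z \<le> wt s0"
proof -
  obtain i0 j0 where s0: "s0 = (i0, j0)" by fastforce
  have j0: "j0 < CHAR('a)" using g(2)[OF g(1)] by (simp add: s0)
  let ?W = "wt s0"
  define H where "H j = (\<Sum>i\<le>?W. monom (g (i, j)) i)" for j
  have i_le: "i \<le> wt (i, j)" for i j
  proof -
    have "i * 1 \<le> i * CHAR('a)" by (rule mult_le_mono2) (use p_gt_1 in simp)
    thus ?thesis by (simp add: wt_def trans_le_add1)
  qed
  have cH: "coeff (H j) i = g (i, j)" for i j
  proof (cases "i \<le> ?W")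
    case False
    hence "g (i, j) = 0" using g(2)[of "(i, j)"] i_le[of i j] by fastforce
    thus ?thesis by (simp add: H_def coeff_sum sum.delta')
  qed (simp add: H_def coeff_sum sum.delta')
  have H0: "H j0 \<noteq> 0" using g(1) cH[of j0 i0] s0 by auto
  \<comment> \<open>\<open>s0\<close> has maximal weight among the terms that occur, so no power of
    \<open>x\<close> above \<open>i0\<close> accompanies \<open>y^j0\<close>.\<close>
  have degH: "degree (H j0) \<le> i0"
  proof (rule degree_le, intro allI impI)
    fix i assume "i0 < i"
    hence "wt s0 < wt (i, j0)" using p_gt_1 by (simp add: wt_def s0)
    thus "coeff (H j0) i = 0" using g(2)[of "(i, j0)"] unfolding cH by fastforce
  qed
  have root: "poly (H j0) x = 0" if x: "x \<in> Z" for x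
  proof -
    \<comment> \<open>The combination at \<open>x\<close> as a polynomial in \<open>y\<close>: its
      degree is below \<open>p\<close>, yet it has the \<open>p\<close> roots \<open>y0 + b\<close>
      with \<open>b\<close> in the prime field.\<close>
    define Q where "Q = (\<Sum>j<CHAR('a). monom (poly (H j) x) j)"
    have cQ: "coeff Q j = (if j < CHAR('a) then poly (H j) x else 0)" for j
      by (simp add: Q_def coeff_sum sum.delta')
    have evQ: "poly Q y = 0" if "(x, y) \<in> curve" for y
    proof -
      have "0 = (\<Sum>s\<in>low (Suc ?W). g s * xy_mono s (x, y))" using Z[OF x that] by simp
      also have "\<dots> = (\<Sum>s\<in>{..?W} \<times> {..<CHAR('a)}. g s * xy_mono s (x, y))"
      proof (rule sum.mono_neutral_left)
        show "low (Suc ?W) \<subseteq> {..?W} \<times> {..<CHAR('a)}"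
        proof
          fix s assume s: "s \<in> low (Suc ?W)"
          obtain i j where ij: "s = (i, j)" by fastforce
          show "s \<in> {..?W} \<times> {..<CHAR('a)}"
            using s i_le[of i j] unfolding ij by (simp add: low_def)
        qed
        show "\<forall>s\<in>{..?W} \<times> {..<CHAR('a)} - low (Suc ?W). g s * xy_mono s (x, y) = 0"
        proof
          fix s assume "s \<in> {..?W} \<times> {..<CHAR('a)} - low (Suc ?W)"
          hence "\<not> (snd s < CHAR('a) \<and> wt s \<le> ?W)" by (simp add: low_def less_Suc_eq_le)
          hence "g s = 0" using g(2) by blast
          thus "g s * xy_mono s (x, y) = 0" by simp
        qed
      qed auto
      also have "\<dots> = (\<Sum>j<CHAR('a). \<Sum>i\<le>?W. g (i, j) * (x ^ i * y ^ j))"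
        by (subst sum.swap, subst sum.cartesian_product) (auto intro!: sum.cong simp: xy_mono_apply)
      also have "\<dots> = poly Q y"
        by (simp add: Q_def poly_sum poly_monom H_def sum_distrib_right mult.assoc)
      finally show ?thesis ..
    qed
    obtain y0 where y0: "(x, y0) \<in> curve" using exists_curve_point by blast
    have "(\<lambda>b. y0 + b) ` prime_field \<subseteq> {y. poly Q y = 0}"
      using y0 by (auto intro!: evQ simp: curve_def frob_fixed_def frob_add[of _ _ 1, simplified])
    moreover have "card ((\<lambda>b. y0 + b) ` prime_field) = CHAR('a)"
      by (subst card_image) (auto simp: card_frob_fixed simp del: One_nat_def)
    moreover have "degree Q < CHAR('a)"
      using p_gt_1 degree_le[of "CHAR('a) - 1" Q] by (fastforce simp: cQ)
    ultimately have "Q = 0"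
      using card_poly_roots_bound[of Q] card_mono[of "{y. poly Q y = 0}" "(\<lambda>b. y0 + b) ` prime_field"]
        poly_roots_finite[of Q] by fastforce
    thus ?thesis using cQ[of j0] j0 by simp
  qed
  have "card Z \<le> card {x. poly (H j0) x = 0}"
    using root H0 by (intro card_mono poly_roots_finite) auto
  also have "\<dots> \<le> i0" using card_poly_roots_bound[OF H0] degH by linarith
  finally have "CHAR('a) * card Z \<le> CHAR('a) * i0" by (rule mult_le_mono2)
  also have "\<dots> \<le> wt s0" by (simp add: wt_def s0 mult.commute)
  finally show ?thesis .
qed

text \<open>The function \<open>G\<close> has a unique leading term, pole order at most
  \<open>r - 1 + r * m\<close>, and zeros at all points above the \<open>x\<close> to be counted.
  With \<open>m = r + 2 * B\<close> this order is \<open>r * r\<close> up to a multiple of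
  \<open>r\<close>: square-root accuracy in a field of \<open>r * r\<close> elements.\<close>

lemma card_trace_fibre_le:
  fixes a :: nat
  defines "B \<equiv> CHAR('a) * d" and "r \<equiv> CHAR('a) ^ a"
  assumes a: "a \<ge> 1" and big: "r > B * B + 3 * B + 1" and c: "c \<in> prime_field"
  shows "CHAR('a) * card {x \<in> frob_fixed (2 * a). frob_trace (2 * a) (poly f x) = c} \<le> r * r + (2 * B + 1) * r"
proof -
  \<comment> \<open>By \<open>card_low_ge\<close> there are at least
    \<open>(r - B) * (r + B + 1)\<close> unknowns, while \<open>N = r * r + 2 * B + 1\<close>. The
    former is larger exactly when \<open>r > B * B + 3 * B + 1\<close>, which is the origin of
    \<open>big\<close>.\<close>
  define m where "m = r + 2 * B"
  define T where "T = low r \<times> low (Suc m)"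
  define N where "N = r * (r - 1) + m + 1"
  have r1: "r \<ge> 2" using big by simp
  have "N < card (low r) * card (low (Suc m))"
  proof -
    obtain k where k: "r = B * B + 3 * B + 2 + k"
      using big less_iff_Suc_add[of "B * B + 3 * B + 1" r] by auto
    have "N < (B * B + 2 * B + 2 + k) * (B * B + 4 * B + 3 + k)"
      unfolding N_def m_def k by (simp add: algebra_simps)
    also have "\<dots> \<le> card (low r) * card (low (Suc m))"
      using card_low_ge[of r] card_low_ge[of "Suc m"]
      by (intro mult_le_mono) (simp_all add: m_def k flip: B_def)
    finally show ?thesis .
  qed
  then obtain e where e: "range e \<subseteq> prime_field" "\<exists>t\<in>T. e t \<noteq> 0"
    and vanish: "\<And>x y. (x, y) \<in> curve \<Longrightarrow> (\<Sum>((i', j'), (i, j))\<in>T.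
        e ((i', j'), (i, j)) * (xy_mono (i' * r, j' * r) (x, y) * (x ^ i * (y + c) ^ j))) = 0"
    using exists_vanishing_combination[OF c meta_eq_to_obj_eq[OF r_def] a, of m N] unfolding T_def N_def by fastforce
  define K where "K = (\<lambda>((i', j'), (i, j)). (i' + i * r, j' + j * r))"
  define W where "W t = wt (fst t) + r * wt (snd t)" for t :: "(nat \<times> nat) \<times> (nat \<times> nat)"
  have WK: "wt (K t) = W t" for t
    by (auto simp: K_def W_def wt_def algebra_simps split: prod.splits)
  have finT: "finite T" by (simp add: T_def)
  \<comment> \<open>As \<open>wt (fst t) < r\<close>, division of \<open>W t\<close> by
    \<open>r\<close> recovers both weights. Distinct terms of \<open>G\<close> thus have distinct
    pole orders, and the largest cannot cancel.\<close>
  have Winj: "inj_on W T"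
  proof (rule inj_onI)
    fix t t' assume t: "t \<in> T" "t' \<in> T" "W t = W t'"
    have lt: "wt (fst t) < r" "wt (fst t') < r" using t by (auto simp: T_def low_def)
    have "wt (fst t) = wt (fst t')"
      using arg_cong[OF t(3), of "\<lambda>w. w mod r"] lt by (simp add: W_def)
    moreover have "wt (snd t) = wt (snd t')"
      using arg_cong[OF t(3), of "\<lambda>w. w div r"] lt by (simp add: W_def)
    ultimately show "t = t'"
      using t low_inj[of r] low_inj[of "Suc m"] unfolding T_def inj_on_def by (metis mem_Times_iff prod_eq_iff)
  qed
  define S where "S = {t \<in> T. e t \<noteq> 0}"
  have S: "finite S" "S \<noteq> {}" using finT e by (auto simp: S_def)
  have "Max (W ` S) \<in> W ` S" using S by (intro Max_in) auto
  then obtain t0 where t0: "t0 \<in> S" "W t0 = Max (W ` S)" by (metis imageE)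
  have less: "W t < W t0" if "t \<in> S" "t \<noteq> t0" for t
  proof -
    have "W t \<le> W t0" unfolding t0(2) using S that by (intro Max_ge) auto
    moreover have "W t \<noteq> W t0" using Winj that t0 by (auto simp: S_def inj_on_def)
    ultimately show ?thesis by simp
  qed
  have t0T: "t0 \<in> T" "e t0 \<noteq> 0" using t0 by (auto simp: S_def)
  define G where "G P = (\<Sum>t\<in>T. e t * xy_mono (K t) P)" for P
  \<comment> \<open>In normal form the top term of \<open>G\<close> becomes a nonzero multiple of
    \<open>s0\<close> plus smaller weights; all other terms lie below.\<close>
  obtain s0 c0 where s0: "snd s0 < CHAR('a)" "wt s0 = W t0" "c0 \<in> prime_field" "c0 \<noteq> 0"
    "(\<lambda>P. xy_mono (K t0) P - c0 * xy_mono s0 P) \<in> V (W t0)"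
    using mono_leading[of "fst (K t0)" "snd (K t0)"] by (auto simp: WK)
  have "(\<lambda>P. e t0 * (xy_mono (K t0) P - c0 * xy_mono s0 P) + (\<Sum>t\<in>T - {t0}. e t * xy_mono (K t) P)) \<in> V (W t0)"
  proof (intro V_add V_sum)
    show "(\<lambda>P. e t0 * (xy_mono (K t0) P - c0 * xy_mono s0 P)) \<in> V (W t0)"
      using e s0 by (intro V_scale) auto
    fix t assume t: "t \<in> T - {t0}"
    show "(\<lambda>P. e t * xy_mono (K t) P) \<in> V (W t0)"
    proof (cases "e t = 0")
      case True thus ?thesis by (simp add: V_zero)
    next
      case False
      hence "W t < W t0" using t by (intro less) (auto simp: S_def)
      hence "xy_mono (K t) \<in> V (W t0)" using mono_in_V'[of "fst (K t)" "snd (K t)"] by (simp add: WK)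
      thus ?thesis using e by (intro V_scale) auto
    qed
  qed
  then obtain b where b: "\<And>P. P \<in> curve \<Longrightarrow> e t0 * (xy_mono (K t0) P - c0 * xy_mono s0 P)
      + (\<Sum>t\<in>T - {t0}. e t * xy_mono (K t) P) = (\<Sum>s\<in>low (W t0). b s * xy_mono s P)"
    by (rule V_E) blast
  define g where "g s = (if s = s0 then e t0 * c0 else if s \<in> low (W t0) then b s else 0)" for s
  have s0_notin: "s0 \<notin> low (W t0)" using s0 by (simp add: low_def)
  have lowSuc: "insert s0 (low (W t0)) \<subseteq> low (Suc (wt s0))" using s0 by (auto simp: low_def)
  have G_eq: "G P = (\<Sum>s\<in>low (Suc (wt s0)). g s * xy_mono s P)" if "P \<in> curve" for P
  proof -
    have "G P = e t0 * xy_mono (K t0) P + (\<Sum>t\<in>T - {t0}. e t * xy_mono (K t) P)"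
      unfolding G_def using finT t0T by (intro sum.remove) auto
    also have "\<dots> = e t0 * c0 * xy_mono s0 P + (\<Sum>s\<in>low (W t0). b s * xy_mono s P)"
      using b[OF that] by (simp add: algebra_simps)
    also have "(\<Sum>s\<in>low (W t0). b s * xy_mono s P) = (\<Sum>s\<in>low (W t0). g s * xy_mono s P)"
      using s0_notin by (intro sum.cong) (auto simp: g_def)
    also have "e t0 * c0 * xy_mono s0 P + \<dots> = (\<Sum>s\<in>insert s0 (low (W t0)). g s * xy_mono s P)"
      using s0_notin by (simp add: g_def)
    also have "\<dots> = (\<Sum>s\<in>low (Suc (wt s0)). g s * xy_mono s P)"
      using lowSuc by (intro sum.mono_neutral_left) (auto simp: g_def)
    finally show ?thesis .
  qed
  have G_0: "G (x, y) = 0" if xy: "x \<in> frob_fixed (2 * a)" "frob_trace (2 * a) (poly f x) = c" "(x, y) \<in> curve" for x y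
  proof -
    have x: "x ^ (CHAR('a) ^ (2 * a)) = x" using xy by (simp add: frob_fixed_def)
    have y: "y ^ (CHAR('a) ^ (2 * a)) = y + c" using power_frob_artin_schreier[OF xy(3)] xy(2) by simp
    have rr: "CHAR('a) ^ (2 * a) = r * r" by (simp add: r_def mult_2 power_add)
    \<comment> \<open>The \<open>r\<close>-th power fixes the coefficients and gives the second
      factor the exponent \<open>r * r\<close>, the field size, where it becomes
      \<open>x^i * (y + c)^j\<close>. The result is the combination that was made to vanish.\<close>
    have "G (x, y) ^ r = (\<Sum>t\<in>T. (e t * xy_mono (K t) (x, y)) ^ r)"
      unfolding G_def r_def by (rule frob_sum)
    also have "\<dots> = (\<Sum>((i', j'), (i, j))\<in>T.
        e ((i', j'), (i, j)) * (xy_mono (i' * r, j' * r) (x, y) * (x ^ i * (y + c) ^ j)))"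
    proof (intro sum.cong refl)
      fix t assume "t \<in> T"
      obtain i' j' i j where t: "t = ((i', j'), (i, j))" by (metis prod.collapse)
      have "e t ^ r = e t" unfolding r_def using e by (intro prime_field_frob) auto
      moreover have "xy_mono (K t) (x, y) ^ r = xy_mono (i' * r, j' * r) (x, y) * xy_mono (i, j) (x, y) ^ (r * r)"
        by (simp add: t K_def xy_mono_apply power_mult_distrib power_add mult_ac flip: power_mult)
      moreover have "xy_mono (i, j) (x, y) ^ (r * r) = x ^ i * (y + c) ^ j"
        unfolding rr[symmetric] by (rule power_frob_xy_mono[OF x y])
      ultimately show "(e t * xy_mono (K t) (x, y)) ^ r = (\<lambda>((i', j'), (i, j)).
         e ((i', j'), (i, j)) * (xy_mono (i' * r, j' * r) (x, y) * (x ^ i * (y + c) ^ j))) t"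
        by (simp add: t power_mult_distrib)
    qed
    also have "\<dots> = 0" by (rule vanish[OF xy(3)])
    finally show ?thesis by simp
  qed
  have "CHAR('a) * card {x \<in> frob_fixed (2 * a). frob_trace (2 * a) (poly f x) = c} \<le> wt s0"
  proof (rule card_le_of_vanishing[where g = g])
    show "g s0 \<noteq> 0" using t0T s0 by (simp add: g_def)
    show "snd s < CHAR('a) \<and> wt s \<le> wt s0" if "g s \<noteq> 0" for s
      using that s0 by (auto simp: g_def low_def split: if_splits)
    show "(\<Sum>s\<in>low (Suc (wt s0)). g s * xy_mono s (x, y)) = 0"
      if "x \<in> {x \<in> frob_fixed (2 * a). frob_trace (2 * a) (poly f x) = c}" "(x, y) \<in> curve" for x y
      using that G_eq[OF that(2)] G_0[of x y] by simp
  qed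
  also have "wt s0 \<le> (r - 1) + r * m"
    unfolding s0(2) W_def using t0T by (intro add_mono mult_le_mono2) (auto simp: T_def low_def)
  also have "\<dots> \<le> r * r + (2 * B + 1) * r" by (simp add: m_def algebra_simps)
  finally show ?thesis .
qed

end

section \<open>Weil's bound\<close>

lemma cos_ge_half_near_multiple_2pi:
  fixes t :: real and k :: int
  assumes "\<bar>t - of_int k\<bar> < 1 / 6"
  shows "cos (2 * pi * t) \<ge> 1 / 2"
proof -
  define u where "u = \<bar>2 * pi * (t - of_int k)\<bar>"
  have "cos (2 * pi * t) = cos (2 * pi * (t - of_int k) + 2 * pi * of_int k)"
    by (simp add: algebra_simps)
  also have "\<dots> = cos (2 * pi * (t - of_int k))"
    unfolding cos_add by simp
  also have "\<dots> = cos u" by (simp add: u_def)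
  also have "cos u \<ge> cos (pi / 3)"
  proof (rule cos_monotone_0_pi_le)
    show "u \<le> pi / 3" using assms by (simp add: u_def abs_mult)
  qed (simp_all add: u_def)
  finally show ?thesis by (simp add: cos_60)
qed

text \<open>For suitable large \<open>a\<close>, all \<open>z^(2 * a)\<close> with \<open>z\<close>
  in \<open>\<Omega>\<close> lie within a sixth of a turn of the positive real axis. Their real
  parts add without cancellation, and a root with \<open>(norm w)^2 > R\<close> would outgrow
  \<open>C * R^a\<close>.\<close>

lemma psum_growth_bound:
  fixes \<Omega> :: "complex multiset"
  assumes bd: "\<And>a. a \<ge> a0 \<Longrightarrow> norm (psum \<Omega> (2 * a)) \<le> C * R ^ a" and R: "R > 0" and w: "w \<in># \<Omega>"
  shows "(norm w)\<^sup>2 \<le> R"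
proof (rule ccontr)
  assume "\<not> (norm w)\<^sup>2 \<le> R"
  define \<rho> where "\<rho> = (norm w)\<^sup>2 / R"
  have \<rho>: "\<rho> > 1" using R \<open>\<not> (norm w)\<^sup>2 \<le> R\<close> by (simp add: \<rho>_def)
  obtain L0 where L0: "\<rho> ^ L0 > 2 * C" using real_arch_pow[OF \<rho>] by blast
  \<comment> \<open>The approximation yields only some multiplier \<open>q' > 0\<close>, perhaps 1.
    Putting the factor \<open>2 * L\<close> into \<open>\<theta>\<close> makes the exponent
    \<open>2 * a\<close> with \<open>a = q * L\<close>, beyond both \<open>a0\<close> and
    \<open>L0\<close>.\<close>
  define L where "L = max (max L0 a0) 1"
  obtain ws where ws: "mset ws = \<Omega>" using ex_mset by blast
  define \<theta> where "\<theta> i = real (2 * L) * (Arg (ws ! i) / (2 * pi))" for i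
  obtain q' k where q': "0 < q'" and k: "\<And>i. i < length ws \<Longrightarrow> \<bar>of_int q' * \<theta> i - of_int (k i)\<bar> < 1 / real 6"
    by (rule Dirichlet_approx_simult[of 6 "length ws" \<theta>, OF zero_less_numeral]) blast
  define q where "q = nat q'"
  have q: "q > 0" "of_int q' = real q" using q' by (simp_all add: q_def)
  define a where "a = q * L"
  have aL: "a \<ge> L" using q by (simp add: a_def)
  have re: "Re (z ^ (2 * a)) \<ge> norm z ^ (2 * a) / 2" if z: "z \<in># \<Omega>" for z
  proof -
    obtain i where i: "i < length ws" "z = ws ! i" using z ws by (metis in_set_conv_nth set_mset_mset)
    have "z = rcis (norm z) (Arg z)" by (simp add: rcis_cmod_Arg)
    hence "z ^ (2 * a) = rcis (norm z ^ (2 * a)) (real (2 * a) * Arg z)" by (metis DeMoivre2)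
    hence "Re (z ^ (2 * a)) = norm z ^ (2 * a) * cos (real (2 * a) * Arg z)" by simp
    also have "real (2 * a) * Arg z = 2 * pi * (of_int q' * \<theta> i)"
      using i by (simp add: \<theta>_def a_def q(2) field_simps)
    also have "norm z ^ (2 * a) * cos \<dots> \<ge> norm z ^ (2 * a) * (1 / 2)"
      using cos_ge_half_near_multiple_2pi[of "of_int q' * \<theta> i" "k i"] k[OF i(1)]
      by (intro mult_left_mono) auto
    finally show ?thesis by simp
  qed
  obtain \<Omega>' where \<Omega>': "\<Omega> = add_mset w \<Omega>'" using w by (metis multi_member_split)
  have "(\<Sum>z\<in>#A. Re (z ^ (2 * a))) \<ge> 0" if "A \<subseteq># \<Omega>" for A
  proof -
    have "\<forall>z\<in>#A. Re (z ^ (2 * a)) \<ge> 0"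
      using re that mset_subset_eqD zero_le_power[OF norm_ge_zero]
      by (meson divide_nonneg_pos order_trans zero_less_numeral)
    thus ?thesis by (induction A) auto
  qed
  hence "(\<Sum>z\<in>#\<Omega>'. Re (z ^ (2 * a))) \<ge> 0" by (simp add: \<Omega>')
  moreover have "Re (psum A n) = (\<Sum>z\<in>#A. Re (z ^ n))" for A n by (induction A) auto
  ultimately have "Re (psum \<Omega> (2 * a)) \<ge> norm w ^ (2 * a) / 2"
    using re[OF w] by (simp add: \<Omega>')
  hence "norm w ^ (2 * a) / 2 \<le> norm (psum \<Omega> (2 * a))" using complex_Re_le_cmod order.trans by blast
  also have "\<dots> \<le> C * R ^ a" using aL by (intro bd) (simp add: L_def)
  finally have "((norm w)\<^sup>2) ^ a \<le> 2 * C * R ^ a" unfolding power_mult by simp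
  hence "((norm w)\<^sup>2) ^ a / R ^ a \<le> 2 * C" using R by (simp add: pos_divide_le_eq)
  hence "\<rho> ^ a \<le> 2 * C" by (simp add: \<rho>_def power_divide)
  moreover have "\<rho> ^ L0 \<le> \<rho> ^ a" using \<rho> aL by (intro power_increasing) (auto simp: L_def)
  ultimately show False using L0 by linarith
qed

lemma frob_trace_in_prime_field:
  fixes y :: "'a::alg_closed_prime_char"
  assumes "y \<in> frob_fixed k"
  shows "frob_trace k y \<in> prime_field"
proof -
  have "frob_trace k y ^ (CHAR('a) ^ 1) = (\<Sum>i<k. y ^ (CHAR('a) ^ Suc i))"
    unfolding frob_trace_def by (subst frob_sum) (simp add: mult.commute flip: power_mult)
  also have "\<dots> + y = (\<Sum>i<Suc k. y ^ (CHAR('a) ^ i))"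
    by (subst sum.lessThan_Suc_shift) simp
  also have "\<dots> = frob_trace k y + y" using assms by (simp add: frob_trace_def frob_fixed_def)
  finally show ?thesis by (simp add: frob_fixed_def)
qed

lemma poly_in_frob_fixed:
  fixes f :: "'a::alg_closed_prime_char poly"
  assumes "over_prime_field f" "x \<in> frob_fixed k"
  shows "poly f x \<in> frob_fixed k"
  using assms poly_frob_over_prime_field[OF assms(1), of x k] by (simp add: frob_fixed_def)

context additive_character
begin

lemma sum_psi: "(\<Sum>c\<in>prime_field. \<psi> c) = 0"
proof -
  obtain x0 where x0: "x0 \<in> prime_field" "\<psi> x0 \<noteq> 1" using psi_nontrivial by blast
  have "bij_betw (\<lambda>c. x0 + c) prime_field prime_field"
    by (rule bij_betwI[where g = "\<lambda>c. c - x0"]) (use x0 in \<open>auto intro: frob_fixed_add frob_fixed_diff\<close>)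
  hence "(\<Sum>c\<in>prime_field. \<psi> c) = (\<Sum>c\<in>prime_field. \<psi> (x0 + c))"
    by (rule sum.reindex_bij_betw[symmetric])
  also have "\<dots> = \<psi> x0 * (\<Sum>c\<in>prime_field. \<psi> c)"
    unfolding sum_distrib_left using x0 by (intro sum.cong) (auto simp: psi_add)
  finally show ?thesis using x0 by simp
qed

text \<open>The deviations \<open>u c\<close> from equidistribution sum to 0, so each is minus the
  sum of the others, and upper bounds for all trace fibres imply lower bounds. The mean drops out
  because \<open>\<psi>\<close> sums to 0 over the prime field.\<close>

lemma norm_char_sum_le:
  assumes f: "over_prime_field f" "\<not> CHAR('a) dvd degree f"
  defines "B \<equiv> CHAR('a) * degree f"
  assumes a: "a \<ge> 1" and big: "CHAR('a) ^ a > B * B + 3 * B + 1"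
  shows "norm (char_sum f (2 * a)) \<le> real (CHAR('a) * (2 * B + 1)) * real (CHAR('a)) ^ a"
proof -
  interpret artin_schreier f by standard (use f in auto)
  let ?F = "frob_fixed (2 * a) :: 'a set" and ?P = "prime_field :: 'a set"
  define r where "r = CHAR('a) ^ a"
  have finF: "finite ?F" using a by (intro frob_fixed_finite) auto
  have P: "finite ?P" "card ?P = CHAR('a)"
    using card_frob_fixed[of 1, where 'a = 'a] by (auto intro: frob_fixed_finite)
  have cF: "card ?F = r * r"
    using card_frob_fixed[of "2 * a", where 'a = 'a] a by (simp add: r_def power_add mult_2)
  define t where "t x = frob_trace (2 * a) (poly f x)" for x
  have t: "t x \<in> ?P" if "x \<in> ?F" for x
    unfolding t_def using that f by (intro frob_trace_in_prime_field poly_in_frob_fixed)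
  define n where "n c = card {x \<in> ?F. t x = c}" for c
  have n_le: "CHAR('a) * n c \<le> r * r + (2 * B + 1) * r" if "c \<in> ?P" for c
    using card_trace_fibre_le[OF a _ that] big unfolding n_def t_def r_def B_def by simp
  define D where "D = real (2 * B + 1) * real r"
  define u where "u c = real (CHAR('a)) * real (n c) - real r * real r" for c
  have u_le: "u c \<le> D" if "c \<in> ?P" for c
  proof -
    have "real (CHAR('a) * n c) \<le> real (r * r + (2 * B + 1) * r)"
      using n_le[OF that] by (rule of_nat_mono)
    thus ?thesis by (simp add: u_def D_def algebra_simps)
  qed
  have "(\<Sum>c\<in>?P. n c) = card ?F"
    using sum.group[OF finF P(1), of t "\<lambda>_. 1 :: nat"] t by (auto simp: n_def)
  hence "(\<Sum>c\<in>?P. real (n c)) = real r * real r" unfolding cF by (metis of_nat_mult of_nat_sum)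
  hence sum_u: "(\<Sum>c\<in>?P. u c) = 0"
    by (simp add: u_def sum_subtractf P(2)[simplified] flip: sum_distrib_left)
  have D0: "D \<ge> 0" by (simp add: D_def)
  have abs_u: "\<bar>u c\<bar> \<le> real (CHAR('a)) * D" if c: "c \<in> ?P" for c
  proof -
    have "- u c = (\<Sum>c'\<in>?P - {c}. u c')" using sum.remove[OF P(1) c, of u] sum_u by simp
    also have "\<dots> \<le> (\<Sum>c'\<in>?P - {c}. D)" using u_le by (intro sum_mono) auto
    also have "\<dots> = real (card (?P - {c})) * D" by simp
    also have "\<dots> \<le> real (CHAR('a)) * D"
      using P D0 card_mono[of ?P "?P - {c}"] by (intro mult_right_mono) auto
    finally have "- u c \<le> real (CHAR('a)) * D" .
    moreover have "D \<le> real (CHAR('a)) * D" using D0 p_gt_1 by (simp add: mult_le_cancel_right1)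
    ultimately show ?thesis using u_le[OF c] by linarith
  qed
  have "char_sum f (2 * a) = (\<Sum>x\<in>?F. \<psi> (t x))" by (simp add: char_sum_def t_def)
  also have "\<dots> = (\<Sum>c\<in>?P. \<Sum>x\<in>{x\<in>?F. t x = c}. \<psi> (t x))"
    using finF P t by (intro sum.group[symmetric]) auto
  also have "\<dots> = (\<Sum>c\<in>?P. of_nat (n c) * \<psi> c)"
    by (intro sum.cong) (auto simp: n_def)
  finally have "of_nat (CHAR('a)) * char_sum f (2 * a) = (\<Sum>c\<in>?P. of_real (u c) * \<psi> c) + of_real (real r * real r) * (\<Sum>c\<in>?P. \<psi> c)"
    by (simp add: u_def sum_distrib_left algebra_simps flip: sum.distrib)
  also have "\<dots> = (\<Sum>c\<in>?P. of_real (u c) * \<psi> c)" using sum_psi by simp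
  finally have "real (CHAR('a)) * norm (char_sum f (2 * a)) = norm (\<Sum>c\<in>?P. of_real (u c) * \<psi> c)"
    by (metis norm_mult norm_of_nat)
  also have "\<dots> \<le> (\<Sum>c\<in>?P. norm (of_real (u c) * \<psi> c))" by (rule norm_sum)
  also have "\<dots> \<le> (\<Sum>c\<in>?P. real (CHAR('a)) * D)"
    using abs_u by (intro sum_mono) (auto simp: norm_mult norm_psi)
  also have "\<dots> = real (CHAR('a)) * (real (CHAR('a)) * D)" using P by simp
  finally have "norm (char_sum f (2 * a)) \<le> real (CHAR('a)) * D" using p_gt_1 by simp
  thus ?thesis by (simp add: D_def r_def algebra_simps)
qed

theorem weil_bound:
  assumes f: "over_prime_field f" "\<not> CHAR('a) dvd degree f"
  shows "norm (\<Sum>x\<in>prime_field. \<psi> (poly f x)) \<le> real (degree f - 1) * sqrt (real (CHAR('a)))"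
proof -
  obtain \<Omega> where \<Omega>: "size \<Omega> \<le> degree f - 1" "\<And>k. k \<ge> 1 \<Longrightarrow> char_sum f k = - psum \<Omega> k"
    using char_sum_eq_psum[OF f] by blast
  have p1: "CHAR('a) > 1" using prime_gt_1_nat CHAR_prime by blast
  define B where "B = CHAR('a) * degree f"
  \<comment> \<open>For \<open>a >= a0\<close>, \<open>p^a >= 2^a > a >= B * B + 3 * B + 1\<close>,
    the threshold of \<open>norm_char_sum_le\<close>. The growth rate depends on large
    \<open>a\<close> only.\<close>
  define a0 where "a0 = B * B + 3 * B + 1"
  have bd: "norm (psum \<Omega> (2 * a)) \<le> real (CHAR('a) * (2 * B + 1)) * real (CHAR('a)) ^ a" if "a \<ge> a0" for a
  proof -
    have "a < 2 ^ a" by simp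
    also have "(2::nat) ^ a \<le> CHAR('a) ^ a" using p1 by (intro power_mono) auto
    finally have "CHAR('a) ^ a > B * B + 3 * B + 1" using that by (simp add: a0_def)
    moreover have "a \<ge> 1" using that by (simp add: a0_def)
    ultimately show ?thesis using norm_char_sum_le[OF f, of a] \<Omega>(2)[of "2 * a"] by (simp add: B_def)
  qed
  have w: "norm w \<le> sqrt (real (CHAR('a)))" if "w \<in># \<Omega>" for w
    using psum_growth_bound[OF bd _ that] p1 by (intro real_le_rsqrt) auto
  have "norm (psum A 1) \<le> real (size A) * s" if "\<forall>w\<in>#A. norm w \<le> s" for A :: "complex multiset" and s
    using that
  proof (induction A)
    case (add x A)
    thus ?case using norm_triangle_ineq[of x "psum A 1"] by (simp add: algebra_simps)
  qed simp
  hence "norm (psum \<Omega> 1) \<le> real (size \<Omega>) * sqrt (real (CHAR('a)))" using w by blast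
  also have "\<dots> \<le> real (degree f - 1) * sqrt (real (CHAR('a)))"
    using \<Omega>(1) by (intro mult_right_mono) auto
  finally have "norm (char_sum f 1) \<le> real (degree f - 1) * sqrt (real (CHAR('a)))"
    using \<Omega>(2)[of 1] by simp
  thus ?thesis by (simp add: char_sum_def frob_trace_def)
qed

end

section \<open>Transfer to integer polynomials modulo a prime\<close>

text \<open>Formulated with integer polynomials so that \<open>p\<close> is an ordinary variable and
  no field type occurs. Degrees from 1 to \<open>p - 1\<close> are never divisible by
  \<open>p\<close>.\<close>

definition weil_bound_at :: "nat \<Rightarrow> bool" where
  "weil_bound_at p \<longleftrightarrow> (\<forall>f :: int poly. 1 \<le> degree f \<longrightarrow> degree f < p \<longrightarrow> \<not> int p dvd lead_coeff f \<longrightarrow>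
     norm (\<Sum>n<p. cis (2 * pi * of_int (poly f (int n)) / real p)) \<le> real (degree f - 1) * sqrt (real p))"

lemma cis_2pi_eqI:
  assumes "[a = b] (mod int p)" "p > 0"
  shows "cis (2 * pi * of_int a / real p) = cis (2 * pi * of_int b / real p)"
proof -
  obtain k where k: "b = a + int p * k" using assms(1) by (metis cong_iff_lin)
  have "2 * pi * of_int b / real p = 2 * pi * of_int a / real p + 2 * pi * of_int k"
    using assms(2) by (simp add: k field_simps)
  hence "cis (2 * pi * of_int b / real p) = cis (2 * pi * of_int a / real p) * cis (2 * pi * of_int k)"
    by (simp only: cis_mult)
  thus ?thesis by simp
qed

lemma cis_2pi_div_eq_1_iff:
  assumes "p > 0"
  shows "cis (2 * pi * of_int a / real p) = 1 \<longleftrightarrow> int p dvd a"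
proof
  assume "cis (2 * pi * of_int a / real p) = 1"
  hence "cos (2 * pi * of_int a / real p) = 1" by (simp add: complex_eq_iff)
  then obtain n :: int where "2 * pi * of_int a / real p = of_int n * 2 * pi"
    by (auto simp: cos_one_2pi_int)
  hence "real_of_int a = of_int (n * int p)" using assms by (simp add: field_simps)
  hence "a = n * int p" by (simp only: of_int_eq_iff)
  thus "int p dvd a" by simp
next
  assume "int p dvd a"
  thus "cis (2 * pi * of_int a / real p) = 1"
    using cis_2pi_eqI[of a 0 p] assms by (simp add: cong_0_iff)
qed

lemma frob_fixed_of_int: "of_int z \<in> frob_fixed k"
  by (cases z rule: int_cases2)
     (use frob_fixed_diff[OF frob_fixed_0 frob_fixed_of_nat] in \<open>auto simp: frob_fixed_of_nat\<close>)

lemma weil_bound_at_CHAR: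
  assumes "p = CHAR('a::alg_closed_prime_char)"
  shows "weil_bound_at p"
  unfolding weil_bound_at_def
proof (intro allI impI)
  fix g :: "int poly" assume g: "1 \<le> degree g" "degree g < p" "\<not> int p dvd lead_coeff g"
  have p0: "p > 0" by (simp add: assms)
  have p1: "p > 1" unfolding assms using prime_gt_1_nat CHAR_prime by blast
  define F :: "'a poly" where "F = map_poly of_int g"
  have of_int_eq_iff': "of_int z = (of_int w :: 'a) \<longleftrightarrow> [z = w] (mod int p)" for z w
    unfolding assms by (rule of_int_eq_iff_cong_CHAR)
  have cF: "coeff F i = of_int (coeff g i)" for i by (simp add: F_def coeff_map_poly)
  have "coeff F (degree g) \<noteq> 0"
    unfolding cF using g(3) of_int_eq_iff'[of "lead_coeff g" 0] by (simp add: cong_0_iff)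
  hence "degree g \<le> degree F" by (rule le_degree)
  moreover have "degree F \<le> degree g" by (rule degree_le) (simp add: cF coeff_eq_0)
  ultimately have degF: "degree F = degree g" by simp
  have F: "over_prime_field F" "\<not> CHAR('a) dvd degree F"
    unfolding over_prime_field_def cF degF using g
    by (auto simp: assms frob_fixed_of_int dest: dvd_imp_le)
  \<comment> \<open>Any integer representative serves, because the exponential depends only on the
    residue modulo \<open>p\<close>.\<close>
  define \<psi> :: "'a \<Rightarrow> complex" where
    "\<psi> x = cis (2 * pi * of_int (SOME z. of_int z = x) / real p)" for x
  have psi: "\<psi> (of_int z) = cis (2 * pi * of_int z / real p)" for z
  proof -
    have "of_int (SOME w. of_int w = (of_int z :: 'a)) = (of_int z :: 'a)"
      by (rule someI[of "\<lambda>w. of_int w = (of_int z :: 'a)"]) simp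
    thus ?thesis unfolding \<psi>_def of_int_eq_iff' by (rule cis_2pi_eqI[OF _ p0])
  qed
  have pf: "\<exists>z. x = of_int z" if "x \<in> prime_field" for x :: 'a
    using that unfolding prime_field_eq by (metis imageE of_int_of_nat_eq)
  interpret additive_character \<psi>
  proof
    fix x y :: 'a assume "x \<in> prime_field" "y \<in> prime_field"
    then obtain z w where "x = of_int z" "y = of_int w" using pf by metis
    thus "\<psi> (x + y) = \<psi> x * \<psi> y"
      using psi[of "z + w"] by (simp add: psi cis_mult add_divide_distrib distrib_left)
  next
    show "\<exists>x\<in>prime_field. \<psi> x \<noteq> 1"
      using psi[of 1] cis_2pi_div_eq_1_iff[OF p0, of 1] p1 frob_fixed_1 by (intro bexI[of _ 1]) auto
  qed (simp add: \<psi>_def)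
  have inj: "inj_on (of_nat :: nat \<Rightarrow> 'a) {..<p}"
    using card_frob_fixed[of 1, where 'a = 'a] unfolding prime_field_eq assms
    by (intro eq_card_imp_inj_on) simp_all
  have "(\<Sum>x\<in>prime_field. \<psi> (poly F x)) = (\<Sum>n<p. \<psi> (poly F (of_nat n)))"
    unfolding prime_field_eq assms[symmetric] by (subst sum.reindex[OF inj]) simp
  also have "\<dots> = (\<Sum>n<p. cis (2 * pi * of_int (poly g (int n)) / real p))"
  proof (intro sum.cong refl)
    fix n
    have "poly F (of_nat n) = of_int (poly g (int n))"
      by (simp add: poly_altdef degF cF)
    thus "\<psi> (poly F (of_nat n)) = cis (2 * pi * of_int (poly g (int n)) / real p)" by (simp add: psi)
  qed
  finally show "norm (\<Sum>n<p. cis (2 * pi * of_int (poly g (int n)) / real p)) \<le> real (degree g - 1) * sqrt (real p)"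
    using weil_bound[OF F] by (simp add: degF assms)
qed

text \<open>Types cannot depend on the variable \<open>p\<close>. The field with \<open>p\<close> elements is therefore only
  constructed for one closed term \<open>p\<close>, chosen to be a counterexample if there is any.\<close>

definition bad_prime :: nat where
  "bad_prime = (if \<exists>p. prime p \<and> \<not> weil_bound_at p then SOME p. prime p \<and> \<not> weil_bound_at p else 2)"

lemma prime_bad_prime: "prime bad_prime"
  unfolding bad_prime_def using someI_ex[of "\<lambda>p. prime p \<and> \<not> weil_bound_at p"] by auto

lemma bad_prime_gt_1: "int bad_prime > 1"
  using prime_gt_1_nat[OF prime_bad_prime] by simp

section \<open>The prime field as a type\<close>

typedef bad_field = "{0..<int bad_prime}"
  using bad_prime_gt_1 by (intro exI[of _ 0]) auto

setup_lifting type_definition_bad_field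

instantiation bad_field :: comm_ring_1
begin

lift_definition zero_bad_field :: bad_field is 0 using bad_prime_gt_1 by simp
lift_definition one_bad_field :: bad_field is 1 using bad_prime_gt_1 by simp
lift_definition plus_bad_field :: "bad_field \<Rightarrow> bad_field \<Rightarrow> bad_field" is "\<lambda>x y. (x + y) mod int bad_prime"
  using bad_prime_gt_1 by simp
lift_definition minus_bad_field :: "bad_field \<Rightarrow> bad_field \<Rightarrow> bad_field" is "\<lambda>x y. (x - y) mod int bad_prime"
  using bad_prime_gt_1 by simp
lift_definition uminus_bad_field :: "bad_field \<Rightarrow> bad_field" is "\<lambda>x. (- x) mod int bad_prime"
  using bad_prime_gt_1 by simp
lift_definition times_bad_field :: "bad_field \<Rightarrow> bad_field \<Rightarrow> bad_field" is "\<lambda>x y. (x * y) mod int bad_prime"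
  using bad_prime_gt_1 by simp

instance
  by standard (transfer; use bad_prime_gt_1 in \<open>simp add: mod_simps algebra_simps\<close>)+

end

lemma bad_field_inverse_exists:
  assumes "x \<noteq> (0 :: bad_field)"
  shows "\<exists>y. y * x = 1"
proof -
  define z where "z = Rep_bad_field x"
  have "z \<noteq> 0" using assms by (metis z_def Rep_bad_field_inject zero_bad_field.rep_eq)
  hence "\<not> int bad_prime dvd z" using Rep_bad_field[of x] by (auto simp: z_def dest: zdvd_imp_le)
  hence "coprime z (int bad_prime)"
    using prime_bad_prime by (metis coprime_commute prime_imp_coprime prime_nat_int_transfer)
  then obtain w where w: "[z * w = 1] (mod int bad_prime)" using cong_solve_coprime_int by blast
  define y where "y = Abs_bad_field (w mod int bad_prime)"
  have "Rep_bad_field y = w mod int bad_prime"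
    unfolding y_def using bad_prime_gt_1 by (intro Abs_bad_field_inverse) simp
  hence "Rep_bad_field (y * x) = Rep_bad_field 1"
    using w bad_prime_gt_1
    by (simp add: times_bad_field.rep_eq one_bad_field.rep_eq cong_def mod_simps mult.commute flip: z_def)
  thus ?thesis by (metis Rep_bad_field_inject)
qed

instantiation bad_field :: field
begin

definition inverse_bad_field :: "bad_field \<Rightarrow> bad_field" where
  "inverse_bad_field x = (if x = 0 then 0 else SOME y. y * x = 1)"

definition divide_bad_field :: "bad_field \<Rightarrow> bad_field \<Rightarrow> bad_field" where
  "divide_bad_field x y = x * inverse y"

instance
proof
  fix x :: bad_field assume "x \<noteq> 0"
  thus "inverse x * x = 1"
    using someI_ex[OF bad_field_inverse_exists] by (simp add: inverse_bad_field_def)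
qed (simp_all add: inverse_bad_field_def divide_bad_field_def)

end

lemma Rep_bad_field_of_nat: "Rep_bad_field (of_nat n) = int n mod int bad_prime"
proof (induction n)
  case (Suc n)
  thus ?case using bad_prime_gt_1
    by (simp add: plus_bad_field.rep_eq one_bad_field.rep_eq mod_simps)
qed (simp add: zero_bad_field.rep_eq)

lemma CHAR_bad_field: "CHAR(bad_field) = bad_prime"
proof (rule CHAR_eqI)
  have *: "of_nat n = (0 :: bad_field) \<longleftrightarrow> int n mod int bad_prime = 0" for n
    by (metis Rep_bad_field_inject Rep_bad_field_of_nat zero_bad_field.rep_eq)
  show "of_nat bad_prime = (0 :: bad_field)" by (simp add: *)
  show "bad_prime dvd n" if "of_nat n = (0 :: bad_field)" for n
    using that unfolding * by (metis int_dvd_int_iff mod_0_imp_dvd)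
qed

instance bad_field :: field_prime_char
  by (rule field_prime_charI') (use bad_prime_gt_1 in \<open>simp add: CHAR_bad_field\<close>)

instance alg_closure :: (field_prime_char) alg_closed_prime_char
proof
  show "\<exists>n>0. of_nat n = (0 :: 'a alg_closure)"
  proof (intro exI conjI)
    show "of_nat CHAR('a alg_closure) = (0 :: 'a alg_closure)" by (rule of_nat_CHAR)
  qed simp
qed

theorem weil_bound_prime:
  assumes "prime p"
  shows "weil_bound_at p"
proof (rule ccontr)
  assume "\<not> weil_bound_at p"
  hence "\<exists>p. prime p \<and> \<not> weil_bound_at p" using assms by blast
  hence "\<not> weil_bound_at bad_prime"
    unfolding bad_prime_def using someI_ex[of "\<lambda>p. prime p \<and> \<not> weil_bound_at p"] by simp
  moreover have "weil_bound_at bad_prime"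
    by (rule weil_bound_at_CHAR[where 'a = "bad_field alg_closure"]) (simp add: CHAR_bad_field)
  ultimately show False by simp
qed

section \<open>Discrepancy and exponential sums\<close>

definition unit_char :: "nat \<Rightarrow> int \<Rightarrow> complex" where
  "unit_char M a = cis (2 * pi * of_int a / real M)"

lemma norm_unit_char [simp]: "norm (unit_char M a) = 1"
  by (simp add: unit_char_def)

lemma unit_char_0 [simp]: "unit_char M 0 = 1"
  by (simp add: unit_char_def)

lemma unit_char_add: "unit_char M (a + b) = unit_char M a * unit_char M b"
  by (simp add: unit_char_def cis_mult add_divide_distrib distrib_left)

lemma unit_char_mult_of_nat: "unit_char M (a * int n) = unit_char M a ^ n"
  by (induction n) (simp_all add: distrib_left unit_char_add)

lemma unit_char_sum: "unit_char M (\<Sum>i\<in>A. f i) = (\<Prod>i\<in>A. unit_char M (f i))"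
  by (induction A rule: infinite_finite_induct) (simp_all add: unit_char_add)

lemma unit_char_eq_1_iff: "M > 0 \<Longrightarrow> unit_char M a = 1 \<longleftrightarrow> int M dvd a"
  unfolding unit_char_def by (rule cis_2pi_div_eq_1_iff)

lemma sum_unit_char:
  assumes "M > 0"
  shows "(\<Sum>n<M. unit_char M (a * int n)) = (if int M dvd a then of_nat M else 0)"
proof -
  let ?w = "unit_char M a"
  have "(\<Sum>n<M. unit_char M (a * int n)) = (\<Sum>n<M. ?w ^ n)" by (simp only: unit_char_mult_of_nat)
  moreover have "?w ^ M = 1"
    unfolding unit_char_mult_of_nat[symmetric] unit_char_eq_1_iff[OF assms] by simp
  moreover have "?w = 1 \<longleftrightarrow> int M dvd a" by (rule unit_char_eq_1_iff[OF assms])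
  ultimately show ?thesis by (cases "?w = 1") (simp_all add: geometric_sum)
qed

text \<open>Concavity gives \<open>sin (pi * x) >= 2 * x\<close> on the first half of the interval.
  The factor \<open>1 - x\<close> makes the bound symmetric, and its reciprocal splits into partial
  fractions, whence the shape of \<open>fourier_weight\<close>.\<close>

lemma sin_pi_ge:
  fixes x :: real
  assumes "0 \<le> x" "x \<le> 1"
  shows "sin (pi * x) \<ge> 2 * x * (1 - x)"
proof -
  have conc: "concave_on {0..pi/2} (sin :: real \<Rightarrow> real)"
  proof (rule f''_le0_imp_concave)
    show "(sin has_real_derivative cos x) (at x)" "(cos has_real_derivative - sin x) (at x)" for x :: real
      by (auto intro!: derivative_eq_intros)
    show "- sin x \<le> 0" if "x \<in> {0..pi/2}" for x :: real
      using that by (auto intro!: sin_ge_zero)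
  qed auto
  have half: "sin (pi * x) \<ge> 2 * x" if "0 \<le> x" "x \<le> 1 / 2" for x :: real
    using concave_onD[OF conc, of "2 * x" 0 "pi / 2"] that by (simp add: mult.commute)
  show ?thesis
  proof (cases "x \<le> 1 / 2")
    case True
    have "2 * x * (1 - x) \<le> 2 * x * 1" using assms by (intro mult_left_mono) auto
    thus ?thesis using half[of x] True assms by linarith
  next
    case False
    have "sin (pi * (1 - x)) = sin (pi * x)" by (simp add: right_diff_distrib)
    moreover have "2 * (1 - x) * x \<le> 2 * (1 - x) * 1" using assms by (intro mult_left_mono) auto
    ultimately show ?thesis using half[of "1 - x"] False assms by (simp add: mult_ac)
  qed
qed

lemma norm_one_minus_cis: "norm (1 - cis (2 * a)) = 2 * \<bar>sin a\<bar>"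
proof -
  have "1 - cis (2 * a) = - (2 * \<i> * of_real (sin a)) * cis a"
    by (simp add: complex_eq_iff cos_double_sin sin_double power2_eq_square)
  thus ?thesis by (simp add: norm_mult)
qed

definition fourier_weight :: "nat \<Rightarrow> nat \<Rightarrow> real" where
  "fourier_weight M h = (if h = 0 then 1 else (1 / real h + 1 / real (M - h)) / 2)"

text \<open>For \<open>k <= M\<close>, the Fourier coefficients of the indicator of the residues
  \<open>{0..<k}\<close> modulo \<open>M\<close>.\<close>

definition interval_coeff :: "nat \<Rightarrow> nat \<Rightarrow> nat \<Rightarrow> complex" where
  "interval_coeff M k h = (\<Sum>b<k. unit_char M (- int h * int b)) / of_nat M"

lemma fourier_weight_nonneg: "fourier_weight M h \<ge> 0"
  by (simp add: fourier_weight_def)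

lemma norm_interval_coeff_le:
  assumes "h < M" "k \<le> M"
  shows "norm (interval_coeff M k h) \<le> fourier_weight M h"
proof (cases "h = 0")
  case True
  thus ?thesis using assms by (simp add: interval_coeff_def fourier_weight_def norm_divide)
next
  case False
  let ?w = "unit_char M (- int h)"
  define x where "x = real h / real M"
  have x: "0 < x" "x < 1" using assms False by (simp_all add: x_def)
  have M0: "M > 0" using assms by simp
  have "?w \<noteq> 1" using unit_char_eq_1_iff[OF M0, of "- int h"] assms False by (auto dest: dvd_imp_le)
  hence "(\<Sum>b<k. ?w ^ b) = (?w ^ k - 1) / (?w - 1)" by (rule geometric_sum)
  hence "norm (\<Sum>b<k. ?w ^ b) = norm (?w ^ k - 1) / norm (1 - ?w)"
    by (simp add: norm_divide norm_minus_commute)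
  also have "norm (?w ^ k - 1) \<le> 2"
    using norm_triangle_ineq4[of "?w ^ k" 1] by (simp add: norm_power)
  also have "norm (1 - ?w) = 2 * sin (pi * x)"
  proof -
    have eq: "2 * pi * of_int (- int h) / real M = 2 * (- (pi * x))" by (simp add: x_def)
    have "norm (1 - ?w) = 2 * \<bar>sin (- (pi * x))\<bar>"
      unfolding unit_char_def eq by (rule norm_one_minus_cis)
    thus ?thesis using x by (simp add: sin_ge_zero)
  qed
  finally have "norm (\<Sum>b<k. ?w ^ b) \<le> 2 / (2 * sin (pi * x))"
    using x by (simp add: divide_right_mono sin_ge_zero)
  also have "\<dots> \<le> 2 / (2 * (2 * x * (1 - x)))"
    using sin_pi_ge[of x] x by (intro divide_left_mono mult_pos_pos mult_left_mono) (auto intro: less_le_trans[of _ "2 * x * (1 - x)"])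
  also have "\<dots> = real M * fourier_weight M h"
  proof -
    have "1 - x = real (M - h) / real M" using assms M0 by (simp add: x_def field_simps of_nat_diff)
    moreover have "real h > 0" "real (M - h) > 0" "real (M - h) + real h = real M" using assms False by auto
    ultimately show ?thesis
      using False M0 unfolding fourier_weight_def x_def
      by (simp add: divide_simps)
  qed
  finally have *: "norm (\<Sum>b<k. ?w ^ b) \<le> real M * fourier_weight M h" .
  have "interval_coeff M k h = (\<Sum>b<k. ?w ^ b) / of_nat M"
    unfolding interval_coeff_def unit_char_mult_of_nat ..
  hence "norm (interval_coeff M k h) = norm (\<Sum>b<k. ?w ^ b) / real M" by (simp add: norm_divide)
  thus ?thesis using * M0 by (simp add: pos_divide_le_eq mult.commute)
qed

lemma indicator_fourier:
  assumes "k \<le> M" "M > 0"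
  shows "(\<Sum>h<M. interval_coeff M k h * unit_char M (int h * v)) = of_bool (v mod int M < int k)"
proof -
  have "(\<Sum>h<M. interval_coeff M k h * unit_char M (int h * v)) =
      (\<Sum>h<M. \<Sum>b<k. unit_char M ((v - int b) * int h) / of_nat M)"
  proof (intro sum.cong refl)
    fix h
    have "unit_char M (- int h * int b) * unit_char M (int h * v) = unit_char M ((v - int b) * int h)" for b
      unfolding unit_char_add[symmetric] by (rule arg_cong) (simp add: algebra_simps)
    thus "interval_coeff M k h * unit_char M (int h * v) = (\<Sum>b<k. unit_char M ((v - int b) * int h) / of_nat M)"
      unfolding interval_coeff_def by (simp add: sum_distrib_right flip: sum_divide_distrib)
  qed
  also have "\<dots> = (\<Sum>b<k. (\<Sum>h<M. unit_char M ((v - int b) * int h)) / of_nat M)"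
    by (subst sum.swap) (simp add: sum_divide_distrib)
  also have "\<dots> = (\<Sum>b<k. of_bool (v mod int M = int b))"
  proof (intro sum.cong refl)
    fix b assume b: "b \<in> {..<k}"
    have "int M dvd v - int b \<longleftrightarrow> v mod int M = int b"
      using b assms by (simp add: mod_eq_dvd_iff[symmetric])
    thus "(\<Sum>h<M. unit_char M ((v - int b) * int h)) / of_nat M = of_bool (v mod int M = int b)"
      unfolding sum_unit_char[OF assms(2)] using assms by simp
  qed
  also have "\<dots> = of_bool (v mod int M < int k)"
  proof (cases "v mod int M < int k")
    case True
    have "v mod int M \<ge> 0" using assms by simp
    then obtain b0 where b0: "v mod int M = int b0" by (metis nonneg_int_cases)
    thus ?thesis using True by (simp add: sum.delta' of_bool_def eq_commute[of b0])
  qed (auto intro!: sum.neutral)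
  finally show ?thesis .
qed

lemma frac_of_int_div:
  assumes "M > 0"
  shows "frac (of_int a / real M) = of_int (a mod int M) / real M"
proof -
  have "\<lfloor>of_int a / real M\<rfloor> = a div int M" by (metis floor_divide_of_int_eq of_int_of_nat_eq)
  hence "frac (of_int a / real M) = (of_int a - real M * of_int (a div int M)) / real M"
    using assms by (simp add: frac_def field_simps)
  also have "of_int a - real M * of_int (a div int M) = of_int (a - int M * (a div int M))" by simp
  also have "a - int M * (a div int M) = a mod int M" by (simp add: minus_mult_div_eq_mod)
  finally show ?thesis .
qed

text \<open>All coordinates are multiples of \<open>1 / M\<close>, so rounding \<open>z i\<close> up
  to such a multiple leaves the count unchanged; only the volume moves, by at most
  \<open>1 / M\<close> per coordinate. The zero frequency yields the volume of the rounded box, the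
  others the error sum.\<close>

lemma discrepancy_fun_le_fourier:
  fixes y :: "'i \<Rightarrow> nat \<Rightarrow> int" and M s :: nat
  assumes M: "M > 0" and I: "finite I" "I \<noteq> {}" and u: "u \<subseteq> {1..s}"
    and z: "\<And>i. i \<in> u \<Longrightarrow> 0 \<le> z i \<and> z i \<le> 1"
    and x: "\<And>n i. n \<in> I \<Longrightarrow> i \<in> {1..s} \<Longrightarrow> x n i = frac (of_int (y n i) / real M)"
  shows "\<bar>discrepancy_fun s I x (fill_one u z)\<bar> \<le> real (card u) / real M +
    (\<Sum>g\<in>PiE u (\<lambda>_. {..<M}) - {\<lambda>i\<in>u. 0}. (\<Prod>i\<in>u. fourier_weight M (g i)) *
       (norm (\<Sum>n\<in>I. unit_char M (\<Sum>i\<in>u. int (g i) * y n i)) / real (card I)))"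
proof -
  have finu: "finite u" using u finite_subset by blast
  define k where "k i = nat \<lceil>real M * z i\<rceil>" for i
  have k: "k i \<le> M" "\<bar>real (k i) / real M - z i\<bar> \<le> 1 / real M" if "i \<in> u" for i
  proof -
    have "real M * z i \<le> real M * 1" using z[OF that] by (intro mult_left_mono) auto
    thus "k i \<le> M" by (simp add: k_def nat_le_iff ceiling_le_iff)
    have "real (k i) = of_int \<lceil>real M * z i\<rceil>" using z[OF that] by (simp add: k_def)
    hence "real M * z i \<le> real (k i)" "real (k i) < real M * z i + 1" by linarith+
    thus "\<bar>real (k i) / real M - z i\<bar> \<le> 1 / real M" using M by (simp add: abs_le_iff field_simps)
  qed
  let ?S = "\<lambda>g. \<Sum>n\<in>I. unit_char M (\<Sum>i\<in>u. int (g i) * y n i)"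
  let ?c = "\<lambda>g. \<Prod>i\<in>u. interval_coeff M (k i) (g i)"
  let ?P = "PiE u (\<lambda>_. {..<M})"
  let ?z = "\<lambda>i\<in>u. 0 :: nat"
  define R where "R = (\<Sum>g\<in>?P - {?z}. ?c g * ?S g)"
  have finP: "finite ?P" using finu by (intro finite_PiE) auto
  have z0: "?z \<in> ?P" using M by auto
  have mem_iff: "x n i \<in> {0..<fill_one u z i} \<longleftrightarrow> (i \<in> u \<longrightarrow> y n i mod int M < int (k i))"
    if "n \<in> I" "i \<in> {1..s}" for n i
  proof (cases "i \<in> u")
    case True
    have xi: "x n i = of_int (y n i mod int M) / real M" using x[OF that] frac_of_int_div[OF M] by simp
    have "x n i \<in> {0..<fill_one u z i} \<longleftrightarrow> x n i < z i"
      using True x[OF that] by (simp add: fill_one_def)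
    also have "\<dots> \<longleftrightarrow> of_int (y n i mod int M) < real M * z i"
      unfolding xi using M by (simp add: pos_divide_less_eq mult.commute)
    also have "\<dots> \<longleftrightarrow> y n i mod int M < \<lceil>real M * z i\<rceil>" by (simp add: less_ceiling_iff)
    also have "\<dots> \<longleftrightarrow> y n i mod int M < int (k i)"
    proof -
      have "0 \<le> real M * z i" using z[OF True] by simp
      hence "0 \<le> \<lceil>real M * z i\<rceil>" by linarith
      thus ?thesis by (simp add: k_def)
    qed
    finally show ?thesis using True by simp
  next
    case False
    \<comment> \<open>Coordinates outside \<open>u\<close> have the bound 1, and fractional parts
      are below 1, so they impose no condition.\<close>
    thus ?thesis using x[OF that] by (simp add: fill_one_def frac_lt_1)
  qed
  have "counting s I x (\<lambda>i. {0..<fill_one u z i}) = card {n \<in> I. \<forall>i\<in>u. y n i mod int M < int (k i)}"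
    unfolding counting_def using mem_iff u by (intro arg_cong[of _ _ card]) blast
  hence "of_nat (counting s I x (\<lambda>i. {0..<fill_one u z i})) =
      (\<Sum>n\<in>I. of_bool (\<forall>i\<in>u. y n i mod int M < int (k i)) :: complex)"
    using I by (simp add: sum.If_cases of_bool_def Int_def)
  also have "\<dots> = (\<Sum>n\<in>I. \<Prod>i\<in>u. of_bool (y n i mod int M < int (k i)))"
    using finu by (intro sum.cong) (auto simp: of_bool_def prod_zero_iff)
  also have "\<dots> = (\<Sum>n\<in>I. \<Prod>i\<in>u. \<Sum>h<M. interval_coeff M (k i) h * unit_char M (int h * y n i))"
    using k M by (intro sum.cong prod.cong refl) (simp only: indicator_fourier)
  also have "\<dots> = (\<Sum>n\<in>I. \<Sum>g\<in>?P. \<Prod>i\<in>u. interval_coeff M (k i) (g i) * unit_char M (int (g i) * y n i))"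
    using finu by (intro sum.cong refl prod_sum_PiE) auto
  also have "\<dots> = (\<Sum>n\<in>I. \<Sum>g\<in>?P. ?c g * unit_char M (\<Sum>i\<in>u. int (g i) * y n i))"
    by (intro sum.cong refl) (simp only: prod.distrib unit_char_sum)
  also have "\<dots> = (\<Sum>g\<in>?P. ?c g * ?S g)"
    by (subst sum.swap) (simp only: sum_distrib_left)
  also have "\<dots> = ?c ?z * ?S ?z + R"
    unfolding R_def by (rule sum.remove[OF finP z0])
  also have "?S ?z = of_nat (card I)" by simp
  also have "?c ?z = of_real (\<Prod>i\<in>u. real (k i) / real M)"
    by (simp add: interval_coeff_def prod_dividef flip: of_nat_prod)
  finally have "complex_of_real (real (counting s I x (\<lambda>i. {0..<fill_one u z i})) / real (card I) - (\<Prod>i\<in>u. real (k i) / real M))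
     = R / of_nat (card I)"
    using I by (simp add: diff_divide_eq_iff card_gt_0_iff)
  hence "\<bar>real (counting s I x (\<lambda>i. {0..<fill_one u z i})) / real (card I) - (\<Prod>i\<in>u. real (k i) / real M)\<bar>
     = norm R / real (card I)"
    by (metis norm_divide norm_of_nat norm_of_real)
  also have "\<dots> \<le> (\<Sum>g\<in>?P - {?z}. (\<Prod>i\<in>u. fourier_weight M (g i)) * norm (?S g)) / real (card I)"
    unfolding R_def
  proof (intro divide_right_mono sum_norm_le)
    fix g assume g: "g \<in> ?P - {?z}"
    have "norm (?c g) \<le> (\<Prod>i\<in>u. fourier_weight M (g i))"
      unfolding prod_norm[symmetric] using g k by (intro prod_mono) (auto intro!: norm_interval_coeff_le)
    thus "norm (?c g * ?S g) \<le> (\<Prod>i\<in>u. fourier_weight M (g i)) * norm (?S g)"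
      unfolding norm_mult by (rule mult_right_mono) simp
  qed simp
  finally have 1: "\<bar>real (counting s I x (\<lambda>i. {0..<fill_one u z i})) / real (card I) - (\<Prod>i\<in>u. real (k i) / real M)\<bar>
     \<le> (\<Sum>g\<in>?P - {?z}. (\<Prod>i\<in>u. fourier_weight M (g i)) * (norm (?S g) / real (card I)))"
    by (simp add: sum_divide_distrib)
  \<comment> \<open>Products of numbers in the unit interval differ by at most the sum of the
    differences of their factors.\<close>
  have "\<bar>(\<Prod>i\<in>u. real (k i) / real M) - (\<Prod>i\<in>u. z i)\<bar> \<le> (\<Sum>i\<in>u. \<bar>real (k i) / real M - z i\<bar>)"
    using norm_prod_diff[of u "\<lambda>i. real (k i) / real M" z] k z M by simp
  also have "\<dots> \<le> (\<Sum>i\<in>u. 1 / real M)" using k by (intro sum_mono)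
  finally have 2: "\<bar>(\<Prod>i\<in>u. real (k i) / real M) - (\<Prod>i\<in>u. z i)\<bar> \<le> real (card u) / real M" by simp
  have "(\<Prod>i=1..s. fill_one u z i) = (\<Prod>i\<in>u. z i)"
    unfolding fill_one_def using u by (subst prod.inter_restrict[symmetric]) (auto simp: Int_absorb1)
  thus ?thesis using 1 2 unfolding discrepancy_fun_def by linarith
qed

section \<open>Total mass of the Fourier weights\<close>

lemma sum_inverse_le_ln: "n \<ge> 1 \<Longrightarrow> (\<Sum>h=1..n. 1 / real h) \<le> 1 + ln (real n)"
proof (induction n rule: nat_induct_at_least)
  case (Suc n)
  have "ln (real n / real (Suc n)) \<le> real n / real (Suc n) - 1"
    using Suc by (intro ln_le_minus_one) auto
  hence "ln (real n) + 1 / real (Suc n) \<le> ln (real (Suc n))"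
    using Suc by (simp add: ln_div field_simps)
  thus ?case using Suc by simp
qed simp

text \<open>Substituting \<open>M - h\<close> for \<open>h\<close> shows that both halves of the
  weight give the same harmonic sum.\<close>

lemma sum_fourier_weight_pos_le:
  assumes "M \<ge> 1"
  shows "(\<Sum>h=1..<M. fourier_weight M h) \<le> 1 + ln (real M)"
proof (cases "M = 1")
  case False
  have M: "{1..<M} = {1..M - 1}" using assms by auto
  have "(\<Sum>h=1..<M. fourier_weight M h) = ((\<Sum>h=1..<M. 1 / real h) + (\<Sum>h=1..<M. 1 / real (M - h))) / 2"
    by (simp add: fourier_weight_def sum_divide_distrib flip: sum.distrib)
  also have "(\<Sum>h=1..<M. 1 / real (M - h)) = (\<Sum>h=1..<M. 1 / real h)"
    by (rule sum.reindex_bij_witness[of _ "\<lambda>h. M - h" "\<lambda>h. M - h"]) auto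
  also have "((\<Sum>h=1..<M. 1 / real h) + (\<Sum>h=1..<M. 1 / real h)) / 2 = (\<Sum>h=1..M-1. 1 / real h)"
    unfolding M by simp
  also have "\<dots> \<le> 1 + ln (real (M - 1))" using assms False by (intro sum_inverse_le_ln) simp
  also have "\<dots> \<le> 1 + ln (real M)" using assms False by (intro add_left_mono ln_mono) auto
  finally show ?thesis .
qed simp

lemma sum_fourier_weight:
  assumes "M \<ge> 1"
  shows "(\<Sum>h<M. fourier_weight M h) = 1 + (\<Sum>h=1..<M. fourier_weight M h)"
proof -
  have "{..<M} = insert 0 {1..<M}" using assms by auto
  thus ?thesis by (simp add: fourier_weight_def)
qed

lemma sum_PiE_fourier_weight_le:
  assumes "M \<ge> 1" "finite u"
  shows "(\<Sum>g\<in>PiE u (\<lambda>_. {..<M}). \<Prod>i\<in>u. fourier_weight M (g i)) \<le> (2 + ln (real M)) ^ card u"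
proof -
  have "(\<Sum>g\<in>PiE u (\<lambda>_. {..<M}). \<Prod>i\<in>u. fourier_weight M (g i)) = (\<Prod>i\<in>u. \<Sum>h<M. fourier_weight M h)"
    using assms by (intro prod_sum_PiE[symmetric]) auto
  also have "\<dots> = (\<Sum>h<M. fourier_weight M h) ^ card u" by simp
  also have "\<dots> \<le> (2 + ln (real M)) ^ card u"
    using sum_fourier_weight_pos_le[OF assms(1)] sum_fourier_weight[OF assms(1)]
    by (intro power_mono sum_nonneg fourier_weight_nonneg) auto
  finally show ?thesis .
qed

lemma discrepancy_fun_le_uniform:
  fixes y :: "'i \<Rightarrow> nat \<Rightarrow> int" and M s :: nat
  assumes M: "M > 0" and I: "finite I" "I \<noteq> {}" and u: "u \<subseteq> {1..s}"
    and z: "\<And>i. i \<in> u \<Longrightarrow> 0 \<le> z i \<and> z i \<le> 1"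
    and x: "\<And>n i. n \<in> I \<Longrightarrow> i \<in> {1..s} \<Longrightarrow> x n i = frac (of_int (y n i) / real M)"
    and E: "E \<ge> 0" "\<And>g. g \<in> PiE u (\<lambda>_. {..<M}) \<Longrightarrow> \<exists>i\<in>u. g i \<noteq> 0 \<Longrightarrow>
      norm (\<Sum>n\<in>I. unit_char M (\<Sum>i\<in>u. int (g i) * y n i)) / real (card I) \<le> E"
  shows "\<bar>discrepancy_fun s I x (fill_one u z)\<bar> \<le> real (card u) / real M + E * (2 + ln (real M)) ^ card u"
proof -
  have finu: "finite u" using u finite_subset by blast
  let ?P = "PiE u (\<lambda>_. {..<M})"
  let ?w = "\<lambda>g. \<Prod>i\<in>u. fourier_weight M (g i)"
  have finP: "finite ?P" using finu by (intro finite_PiE) auto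
  have "(\<Sum>g\<in>?P - {\<lambda>i\<in>u. 0}. ?w g * (norm (\<Sum>n\<in>I. unit_char M (\<Sum>i\<in>u. int (g i) * y n i)) / real (card I)))
     \<le> (\<Sum>g\<in>?P - {\<lambda>i\<in>u. 0}. ?w g * E)"
  proof (intro sum_mono mult_left_mono E(2) prod_nonneg fourier_weight_nonneg ballI)
    fix g assume g: "g \<in> ?P - {\<lambda>i\<in>u. 0}"
    thus "g \<in> ?P" by simp
    show "\<exists>i\<in>u. g i \<noteq> 0"
    proof (rule ccontr)
      assume "\<not> (\<exists>i\<in>u. g i \<noteq> 0)"
      hence "g i = (\<lambda>i\<in>u. 0) i" for i
        using g by (cases "i \<in> u") (simp_all add: PiE_def extensional_def)
      hence "g = (\<lambda>i\<in>u. 0)" by (rule ext)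
      thus False using g by blast
    qed
  qed
  also have "\<dots> \<le> (\<Sum>g\<in>?P. ?w g * E)"
    using finP E(1) by (intro sum_mono2 mult_nonneg_nonneg prod_nonneg) (auto simp: fourier_weight_nonneg)
  also have "\<dots> = E * (\<Sum>g\<in>?P. ?w g)" by (simp add: sum_distrib_left mult.commute)
  also have "\<dots> \<le> E * (2 + ln (real M)) ^ card u"
    using sum_PiE_fourier_weight_le[OF _ finu, of M] M E(1) by (intro mult_left_mono) auto
  finally have *: "(\<Sum>g\<in>?P - {\<lambda>i\<in>u. 0}. ?w g *
      (norm (\<Sum>n\<in>I. unit_char M (\<Sum>i\<in>u. int (g i) * y n i)) / real (card I))) \<le> E * (2 + ln (real M)) ^ card u" .
  have "\<bar>discrepancy_fun s I x (fill_one u z)\<bar> \<le> real (card u) / real M + (\<Sum>g\<in>?P - {\<lambda>i\<in>u. 0}. ?w g *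
      (norm (\<Sum>n\<in>I. unit_char M (\<Sum>i\<in>u. int (g i) * y n i)) / real (card I)))"
    by (intro discrepancy_fun_le_fourier M I u z x)
  thus ?thesis using * by linarith
qed

lemma abs_discrepancy_fun_le_1:
  assumes "finite I" "u \<subseteq> {1..s}" "\<And>i. i \<in> u \<Longrightarrow> 0 \<le> z i \<and> z i \<le> 1"
  shows "\<bar>discrepancy_fun s I x (fill_one u z)\<bar> \<le> 1"
proof -
  have "counting s I x (\<lambda>i. {0..<fill_one u z i}) \<le> card I"
    unfolding counting_def using assms by (intro card_mono) auto
  hence "0 \<le> real (counting s I x (\<lambda>i. {0..<fill_one u z i})) / real (card I)"
    "real (counting s I x (\<lambda>i. {0..<fill_one u z i})) / real (card I) \<le> 1"
    by (auto intro: divide_le_eq_1[THEN iffD2])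
  moreover have "0 \<le> (\<Prod>i=1..s. fill_one u z i)" "(\<Prod>i=1..s. fill_one u z i) \<le> 1"
    using assms by (auto simp: fill_one_def intro!: prod_nonneg prod_le_1)
  ultimately show ?thesis unfolding discrepancy_fun_def by linarith
qed

text \<open>Lagrange's argument on integer polynomials: when a root modulo \<open>p\<close> is split
  off by synthetic division, the quotient still has a coefficient prime to \<open>p\<close>, and
  primality makes every other root a root of the quotient.\<close>

lemma card_roots_mod_prime_le:
  fixes f :: "int poly"
  assumes p: "prime p" and "degree f \<le> D" "\<not> (\<forall>i. int p dvd coeff f i)"
  shows "card {a \<in> {0..<p}. int p dvd poly f (int a)} \<le> D"
  using assms(2,3)
proof (induction D arbitrary: f)
  case 0
  have "poly f x = coeff f 0" for x using 0 by (simp add: poly_altdef)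
  moreover have "\<not> int p dvd coeff f 0" using 0 by (metis bot_nat_0.extremum_uniqueI coeff_eq_0 dvd_0_right neq0_conv)
  ultimately have "{a \<in> {0..<p}. int p dvd poly f (int a)} = {}" by auto
  thus ?case by simp
next
  case (Suc D)
  show ?case
  proof (cases "\<exists>a\<in>{0..<p}. int p dvd poly f (int a)")
    case False
    hence "{a \<in> {0..<p}. int p dvd poly f (int a)} = {}" by auto
    thus ?thesis by (metis card.empty le0)
  next
    case True
    then obtain a0 where a0: "a0 < p" "int p dvd poly f (int a0)" by auto
    define q where "q = synthetic_div f (int a0)"
    define r where "r = poly f (int a0)"
    have f_eq: "[:- int a0, 1:] * q + [:r:] = f"
      unfolding q_def r_def by (rule synthetic_div_correct')
    have r: "int p dvd r" using a0 by (simp add: r_def)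
    have "\<not> (\<forall>i. int p dvd coeff q i)"
    proof
      assume q: "\<forall>i. int p dvd coeff q i"
      have "int p dvd coeff f i" for i
      proof -
        have "coeff f i = coeff (pCons 0 q) i - int a0 * coeff q i + coeff [:r:] i"
          by (subst f_eq[symmetric]) simp
        moreover have "int p dvd coeff (pCons 0 q) i" "int p dvd coeff [:r:] i"
          using q r by (auto simp: coeff_pCons split: nat.splits)
        ultimately show ?thesis using q by (auto intro!: dvd_add dvd_diff dvd_mult)
      qed
      thus False using Suc.prems by blast
    qed
    moreover have "degree q \<le> D" using Suc.prems by (simp add: q_def degree_synthetic_div)
    ultimately have IH: "card {a \<in> {0..<p}. int p dvd poly q (int a)} \<le> D" by (intro Suc.IH)
    have "{a \<in> {0..<p}. int p dvd poly f (int a)} \<subseteq> insert a0 {a \<in> {0..<p}. int p dvd poly q (int a)}"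
    proof
      fix a assume a: "a \<in> {a \<in> {0..<p}. int p dvd poly f (int a)}"
      have "poly f (int a) = (int a - int a0) * poly q (int a) + r"
        by (subst f_eq[symmetric]) (simp add: algebra_simps)
      hence "(int a - int a0) * poly q (int a) = poly f (int a) - r" by simp
      hence "int p dvd (int a - int a0) * poly q (int a)" using a r by (simp add: dvd_diff)
      hence "int p dvd int a - int a0 \<or> int p dvd poly q (int a)"
        using p prime_dvd_mult_iff[of "int p"] by simp
      moreover have "a = a0" if "int p dvd int a - int a0"
      proof -
        have "int a mod int p = int a0 mod int p" using that by (simp add: mod_eq_dvd_iff)
        thus ?thesis using a a0 by simp
      qed
      ultimately show "a \<in> insert a0 {a \<in> {0..<p}. int p dvd poly q (int a)}" using a by auto
    qed
    hence "card {a \<in> {0..<p}. int p dvd poly f (int a)} \<le> card (insert a0 {a \<in> {0..<p}. int p dvd poly q (int a)})"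
      by (intro card_mono) auto
    also have "\<dots> \<le> Suc D" using IH by (intro card_insert_le_m1[THEN order.trans]) (auto simp: card_insert_if)
    finally show ?thesis .
  qed
qed

lemma poly_add_taylor1:
  fixes f :: "'a::idom poly"
  shows "\<exists>k. poly f (a + h) = poly f a + h * poly (pderiv f) a + h\<^sup>2 * k"
proof (induction f)
  case (pCons c q)
  then obtain k where k: "poly q (a + h) = poly q a + h * poly (pderiv q) a + h\<^sup>2 * k" by blast
  show ?case
    by (rule exI[of _ "poly (pderiv q) a + (a + h) * k"])
       (simp add: k pderiv_pCons algebra_simps power2_eq_square)
qed simp

section \<open>The three point sets\<close>

text \<open>The phase of the exponential sum at frequency \<open>g\<close>. The shift
  \<open>c\<close> is 0 for the first two point sets and 1 for the third, whose \<open>i\<close>-th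
  coordinate carries the exponent \<open>i - 1\<close>.\<close>

definition freq_poly :: "nat \<Rightarrow> nat set \<Rightarrow> (nat \<Rightarrow> nat) \<Rightarrow> int poly" where
  "freq_poly c u g = (\<Sum>i\<in>u. monom (int (g i)) (i - c))"

lemma poly_freq_poly: "poly (freq_poly c u g) x = (\<Sum>i\<in>u. int (g i) * x ^ (i - c))"
  by (simp add: freq_poly_def poly_sum poly_monom)

lemma coeff_freq_poly:
  assumes "finite u" "\<And>i. i \<in> u \<Longrightarrow> c \<le> i"
  shows "coeff (freq_poly c u g) j = (if j + c \<in> u then int (g (j + c)) else 0)"
proof -
  have "coeff (freq_poly c u g) j = (\<Sum>i\<in>u. if i = j + c then int (g i) else 0)"
    unfolding freq_poly_def coeff_sum coeff_monom using assms(2)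
    by (intro sum.cong refl) (metis add_diff_cancel_right' le_add_diff_inverse2)
  thus ?thesis using assms(1) by simp
qed

lemma degree_freq_poly_le:
  assumes "finite u" "\<And>i. i \<in> u \<Longrightarrow> c \<le> i"
  shows "degree (freq_poly c u g) \<le> Max u - c"
proof (rule degree_le, intro allI impI)
  fix j assume "Max u - c < j"
  hence "j + c \<notin> u" using Max_ge[OF assms(1)] by fastforce
  thus "coeff (freq_poly c u g) j = 0" using coeff_freq_poly[OF assms] by simp
qed

lemma nonempty_subsetsD:
  assumes "u \<in> nonempty_subsets s"
  shows "finite u" "u \<noteq> {}" "u \<subseteq> {1..s}" "Max u \<ge> 1" "\<And>i. i \<in> u \<Longrightarrow> 1 \<le> i \<and> i \<le> Max u" "card u \<ge> 1"
proof -
  show u: "u \<noteq> {}" "u \<subseteq> {1..s}" using assms by (auto simp: nonempty_subsets_def)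
  show fin: "finite u" using u finite_subset by blast
  show "1 \<le> i \<and> i \<le> Max u" if "i \<in> u" for i using that u fin by auto
  thus "Max u \<ge> 1" using Max_in[OF fin u(1)] by blast
  show "card u \<ge> 1" using fin u by (simp add: Suc_le_eq card_gt_0_iff)
qed

lemma discrepancy_P_le:
  assumes p: "prime p" and u: "u \<in> nonempty_subsets s" and d: "Max u < p"
    and z: "\<And>i. i \<in> u \<Longrightarrow> 0 \<le> z i \<and> z i \<le> 1"
  shows "\<bar>discrepancy_fun s {0..<p} (P_point p) (fill_one u z)\<bar> \<le>
    real (card u) / real p + real (Max u - 1) / sqrt (real p) * (2 + ln (real p)) ^ card u"
proof (rule discrepancy_fun_le_uniform)
  note u' = nonempty_subsetsD[OF u]
  show "p > 0" using p prime_gt_0_nat by blast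
  show "{0..<p} \<noteq> {}" using \<open>p > 0\<close> by auto
  show "P_point p n i = frac (of_int (int (n ^ i)) / real p)" for n i by (simp add: P_point_def)
  fix g assume g: "g \<in> PiE u (\<lambda>_. {..<p})" "\<exists>i\<in>u. g i \<noteq> 0"
  define f where "f = freq_poly 0 u g"
  have cf: "coeff f j = (if j \<in> u then int (g j) else 0)" for j
    unfolding f_def using coeff_freq_poly[OF u'(1), of 0] by simp
  have degf: "degree f \<le> Max u" unfolding f_def using degree_freq_poly_le[OF u'(1), of 0] by simp
  obtain i where i: "i \<in> u" "g i \<noteq> 0" using g by blast
  hence "i \<le> degree f" by (intro le_degree) (simp add: cf)
  hence deg1: "1 \<le> degree f" using u'(5)[OF i(1)] by simp
  hence "lead_coeff f \<noteq> 0" by auto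
  hence "degree f \<in> u" "g (degree f) \<noteq> 0" by (auto simp: cf split: if_splits)
  \<comment> \<open>Frequencies are below \<open>p\<close>, so a nonzero one is prime to
    \<open>p\<close> and the degree does not drop modulo \<open>p\<close>.\<close>
  hence "\<not> p dvd g (degree f)" using PiE_mem[OF g(1), of "degree f"] by (auto dest!: dvd_imp_le)
  hence "\<not> int p dvd lead_coeff f" using \<open>degree f \<in> u\<close> by (simp add: cf)
  hence "norm (\<Sum>n<p. unit_char p (poly f (int n))) \<le> real (degree f - 1) * sqrt (real p)"
    using weil_bound_prime[OF p] deg1 degf d unfolding weil_bound_at_def unit_char_def by auto
  also have "\<dots> \<le> real (Max u - 1) * sqrt (real p)" using degf by (intro mult_right_mono) auto
  finally have "norm (\<Sum>n<p. unit_char p (poly f (int n))) / real p \<le> real (Max u - 1) * sqrt (real p) / real p"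
    by (rule divide_right_mono) simp
  also have "\<dots> = real (Max u - 1) / sqrt (real p)"
    using \<open>p > 0\<close> by (simp add: real_div_sqrt field_simps)
  finally show "norm (\<Sum>n\<in>{0..<p}. unit_char p (\<Sum>i\<in>u. int (g i) * int (n ^ i))) / real (card {0..<p})
      \<le> real (Max u - 1) / sqrt (real p)"
    by (simp add: f_def poly_freq_poly lessThan_atLeast0)
qed (use nonempty_subsetsD[OF u] z in auto)

text \<open>Summing over \<open>k\<close> first leaves \<open>p\<close> for each root
  \<open>a\<close> of the frequency polynomial modulo \<open>p\<close> and 0 for the other
  \<open>a\<close>; the root count is then divided by \<open>p\<close>.\<close>

lemma discrepancy_R_le:
  assumes p: "prime p" and u: "u \<in> nonempty_subsets s"
    and z: "\<And>i. i \<in> u \<Longrightarrow> 0 \<le> z i \<and> z i \<le> 1"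
  shows "\<bar>discrepancy_fun s ({0..<p} \<times> {0..<p}) (R_point p) (fill_one u z)\<bar> \<le>
    real (card u) / real p + real (Max u - 1) / real p * (2 + ln (real p)) ^ card u"
proof (rule discrepancy_fun_le_uniform[where y = "\<lambda>(a, k) i. int (a ^ (i - 1) * k)"])
  note u' = nonempty_subsetsD[OF u]
  show p0: "p > 0" using p prime_gt_0_nat by blast
  show "{0..<p} \<times> {0..<p} \<noteq> {}" using \<open>p > 0\<close> by auto
  show "R_point p n i = frac (of_int ((case n of (a, k) \<Rightarrow> \<lambda>i. int (a ^ (i - 1) * k)) i) / real p)" for n i
    by (cases n) (simp add: R_point_def)
  fix g assume g: "g \<in> PiE u (\<lambda>_. {..<p})" "\<exists>i\<in>u. g i \<noteq> 0"
  define f where "f = freq_poly 1 u g"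
  have cf: "coeff f j = (if j + 1 \<in> u then int (g (j + 1)) else 0)" for j
    unfolding f_def using u'(5) by (intro coeff_freq_poly u'(1)) auto
  have degf: "degree f \<le> Max u - 1" unfolding f_def using u'(5) by (intro degree_freq_poly_le u'(1)) auto
  obtain i where i: "i \<in> u" "g i \<noteq> 0" using g by blast
  hence "\<not> p dvd g i" using PiE_mem[OF g(1), of i] by (auto dest!: dvd_imp_le)
  hence "\<not> int p dvd coeff f (i - 1)" using i u'(5)[OF i(1)] by (simp add: cf)
  hence roots: "card {a \<in> {0..<p}. int p dvd poly f (int a)} \<le> Max u - 1"
    using degf by (intro card_roots_mod_prime_le[OF p]) auto
  have "(\<Sum>n\<in>{0..<p} \<times> {0..<p}. unit_char p (\<Sum>i\<in>u. int (g i) * (case n of (a, k) \<Rightarrow> \<lambda>i. int (a ^ (i - 1) * k)) i))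
     = (\<Sum>a\<in>{0..<p}. \<Sum>k\<in>{0..<p}. unit_char p (poly f (int a) * int k))"
    unfolding sum.cartesian_product f_def poly_freq_poly
    by (intro sum.cong refl) (auto simp: sum_distrib_right mult.assoc)
  also have "\<dots> = (\<Sum>a\<in>{0..<p}. if int p dvd poly f (int a) then of_nat p else 0)"
    using sum_unit_char[OF p0] by (simp add: lessThan_atLeast0)
  also have "\<dots> = of_nat (card {a \<in> {0..<p}. int p dvd poly f (int a)} * p)"
    by (simp add: sum.If_cases Int_def)
  finally have "norm (\<Sum>n\<in>{0..<p} \<times> {0..<p}. unit_char p (\<Sum>i\<in>u. int (g i) * (case n of (a, k) \<Rightarrow> \<lambda>i. int (a ^ (i - 1) * k)) i))
     = real (card {a \<in> {0..<p}. int p dvd poly f (int a)}) * real p"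
    by (simp only: norm_of_nat of_nat_mult norm_mult)
  also have "\<dots> \<le> real (Max u - 1) * real p" using roots by (intro mult_right_mono) auto
  finally show "norm (\<Sum>n\<in>{0..<p} \<times> {0..<p}. unit_char p (\<Sum>i\<in>u. int (g i) * (case n of (a, k) \<Rightarrow> \<lambda>i. int (a ^ (i - 1) * k)) i))
      / real (card ({0..<p} \<times> {0..<p})) \<le> real (Max u - 1) / real p"
    using p0 by (simp add: field_simps)
qed (use nonempty_subsetsD[OF u] z in auto)

text \<open>For \<open>n = a + p * b\<close>, Taylor expansion modulo \<open>p^2\<close> gives
  \<open>f(a) + p * b * f'(a)\<close>, and the sum over \<open>b\<close> vanishes unless
  \<open>p\<close> divides \<open>f'(a)\<close>.\<close>

lemma sum_unit_char_square:
  fixes f :: "int poly"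
  assumes p: "p > 0"
  shows "norm (\<Sum>n<p\<^sup>2. unit_char (p\<^sup>2) (poly f (int n)))
    \<le> real p * real (card {a \<in> {0..<p}. int p dvd poly (pderiv f) (int a)})"
proof -
  have split: "unit_char (p\<^sup>2) (poly f (int (a + p * b))) =
      unit_char (p\<^sup>2) (poly f (int a)) * unit_char p (poly (pderiv f) (int a) * int b)" for a b
  proof -
    obtain k where "poly f (int a + int p * int b) =
        poly f (int a) + int p * int b * poly (pderiv f) (int a) + (int p * int b)\<^sup>2 * k"
      using poly_add_taylor1 by blast
    hence eq: "poly f (int (a + p * b)) =
        poly f (int a) + (int p * (poly (pderiv f) (int a) * int b) + int (p\<^sup>2) * ((int b)\<^sup>2 * k))"
      by (simp add: power_mult_distrib mult_ac)
    have "unit_char (p\<^sup>2) (int p * c) = unit_char p c" for c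
      using p by (simp add: unit_char_def power2_eq_square field_simps)
    moreover have "unit_char (p\<^sup>2) (int (p\<^sup>2) * c) = 1" for c
      using p by (subst unit_char_eq_1_iff) auto
    ultimately show ?thesis unfolding eq unit_char_add by simp
  qed
  have "(\<Sum>n<p\<^sup>2. unit_char (p\<^sup>2) (poly f (int n))) =
      (\<Sum>(a, b)\<in>{0..<p} \<times> {..<p}. unit_char (p\<^sup>2) (poly f (int (a + p * b))))"
  proof (rule sum.reindex_bij_witness[of _ "\<lambda>(a, b). a + p * b" "\<lambda>n. (n mod p, n div p)"])
    fix ab assume "ab \<in> {0..<p} \<times> {..<p}"
    then obtain a b where ab: "ab = (a, b)" "a < p" "b < p" by auto
    have "a + p * b < p * Suc b" using ab by simp
    also have "\<dots> \<le> p * p" using ab by (intro mult_le_mono2) simp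
    finally show "(case ab of (a, b) \<Rightarrow> a + p * b) \<in> {..<p\<^sup>2}" by (simp add: ab power2_eq_square)
  qed (use p in \<open>auto simp: power2_eq_square less_mult_imp_div_less simp del: of_nat_add of_nat_mult\<close>)
  also have "\<dots> = (\<Sum>a\<in>{0..<p}. unit_char (p\<^sup>2) (poly f (int a)) *
      (\<Sum>b<p. unit_char p (poly (pderiv f) (int a) * int b)))"
    unfolding split sum.cartesian_product[symmetric] sum_distrib_left ..
  also have "norm \<dots> \<le> (\<Sum>a\<in>{0..<p}. if int p dvd poly (pderiv f) (int a) then real p else 0)"
    unfolding sum_unit_char[OF p] by (rule sum_norm_le) (simp add: norm_mult)
  also have "\<dots> = real p * real (card {a \<in> {0..<p}. int p dvd poly (pderiv f) (int a)})"
    by (simp add: sum.If_cases Int_def)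
  finally show ?thesis .
qed

text \<open>The weight for modulus \<open>p^2\<close> at \<open>p * h\<close> with
  \<open>0 < h < p\<close> is the weight for modulus \<open>p\<close> at \<open>h\<close>, divided
  by \<open>p\<close>. This gain compensates the trivial estimate at these frequencies.\<close>

lemma sum_fourier_weight_multiples:
  assumes "p > 0"
  shows "(\<Sum>h\<in>{h\<in>{..<p\<^sup>2}. p dvd h}. fourier_weight (p\<^sup>2) h) = 1 + (\<Sum>h=1..<p. fourier_weight p h) / real p"
proof -
  have "(\<Sum>h\<in>{h\<in>{..<p\<^sup>2}. p dvd h}. fourier_weight (p\<^sup>2) h) = (\<Sum>h<p. fourier_weight (p\<^sup>2) (p * h))"
    by (rule sum.reindex_bij_witness[of _ "\<lambda>h. p * h" "\<lambda>h. h div p"])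
       (use assms in \<open>auto simp: power2_eq_square less_mult_imp_div_less\<close>)
  also have "{..<p} = insert 0 {1..<p}" using assms by auto
  also have "(\<Sum>h\<in>insert 0 {1..<p}. fourier_weight (p\<^sup>2) (p * h)) = 1 + (\<Sum>h=1..<p. fourier_weight (p\<^sup>2) (p * h))"
    by (simp add: fourier_weight_def)
  also have "(\<Sum>h=1..<p. fourier_weight (p\<^sup>2) (p * h)) = (\<Sum>h=1..<p. fourier_weight p h / real p)"
  proof (rule sum.cong[OF refl])
    fix h assume h: "h \<in> {1..<p}"
    have "p\<^sup>2 - p * h = p * (p - h)" by (simp add: power2_eq_square diff_mult_distrib2)
    thus "fourier_weight (p\<^sup>2) (p * h) = fourier_weight p h / real p"
      using h assms by (simp add: fourier_weight_def field_simps)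
  qed
  finally show ?thesis by (simp add: sum_divide_distrib)
qed

text \<open>In the binomial expansion every term of the left side carries at least one factor
  \<open>1 / q\<close>.\<close>

lemma power_one_plus_divide_le:
  fixes t q :: real
  assumes "t \<ge> 0" "q \<ge> 1"
  shows "(1 + t / q) ^ n - 1 \<le> ((1 + t) ^ n - 1) / q"
proof (induction n)
  case (Suc n)
  define A where "A = ((1 + t) ^ n - 1) / q"
  have A: "A \<ge> 0" using assms by (simp add: A_def)
  have pw: "(1 + t) ^ n = q * A + 1" using assms by (simp add: A_def)
  have "A * t / q \<le> A * t / 1" using A assms by (intro divide_left_mono) auto
  have "(1 + t / q) ^ Suc n \<le> (1 + A) * (1 + t / q)"
    using Suc assms unfolding power_Suc2 by (intro mult_right_mono) (auto simp: A_def)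
  also have "\<dots> = 1 + A + t / q + A * t / q" by (simp add: algebra_simps add_divide_distrib)
  also have "\<dots> \<le> 1 + A + t / q + A * t" using \<open>A * t / q \<le> A * t / 1\<close> by simp
  also have "\<dots> = 1 + ((1 + t) ^ Suc n - 1) / q"
    using assms unfolding power_Suc2 pw by (simp add: field_simps)
  finally show ?case by simp
qed simp

lemma discrepancy_Q_le:
  assumes p: "prime p" and u: "u \<in> nonempty_subsets s" and d: "Max u < p"
    and z: "\<And>i. i \<in> u \<Longrightarrow> 0 \<le> z i \<and> z i \<le> 1"
  shows "\<bar>discrepancy_fun s {0..<p\<^sup>2} (Q_point p) (fill_one u z)\<bar> \<le> real (card u) / (real p)\<^sup>2 +
    real (Max u - 1) / real p * (2 + 2 * ln (real p)) ^ card u + ((2 + ln (real p)) ^ card u - 1) / real p"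
proof -
  note u' = nonempty_subsetsD[OF u]
  have p0: "p > 0" using p prime_gt_0_nat by blast
  let ?M = "p\<^sup>2"
  let ?P = "PiE u (\<lambda>_. {..<?M})"
  let ?w = "\<lambda>g. \<Prod>i\<in>u. fourier_weight ?M (g i)"
  let ?z = "\<lambda>i\<in>u. 0 :: nat"
  \<comment> \<open>If \<open>p\<close> divides all frequencies, the derivative vanishes modulo
    \<open>p\<close> and counting its roots says nothing. These frequencies are split off.\<close>
  let ?D = "PiE u (\<lambda>_. {h\<in>{..<?M}. p dvd h})"
  define nS where "nS g = norm (\<Sum>n\<in>{0..<?M}. unit_char ?M (\<Sum>i\<in>u. int (g i) * int (n ^ i))) / real (card {0..<?M})" for g
  define E where "E = real (Max u - 1) / real p"
  have E0: "E \<ge> 0" by (simp add: E_def)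
  have w0: "?w g \<ge> 0" for g by (intro prod_nonneg) (simp add: fourier_weight_nonneg)
  have finP: "finite ?P" using u' by (intro finite_PiE) auto
  have DP: "?D \<subseteq> ?P" by (intro PiE_mono) auto
  have z0: "?z \<in> ?D" using p0 by auto
  have nS_le_1: "nS g \<le> 1" for g
  proof -
    have "norm (\<Sum>n\<in>{0..<?M}. unit_char ?M (\<Sum>i\<in>u. int (g i) * int (n ^ i))) \<le> (\<Sum>n\<in>{0..<?M}. 1)"
      by (rule sum_norm_le) simp
    thus ?thesis using p0 by (simp add: nS_def)
  qed
  have nS_le: "nS g \<le> E" if g: "g \<in> ?P - ?D" for g
  proof -
    define f where "f = freq_poly 0 u g"
    have cf: "coeff f j = (if j \<in> u then int (g j) else 0)" for j
      unfolding f_def using coeff_freq_poly[OF u'(1), of 0] by simp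
    have "degree f \<le> Max u" unfolding f_def using degree_freq_poly_le[OF u'(1), of 0] by simp
    hence deg: "degree (pderiv f) \<le> Max u - 1" by (simp add: degree_pderiv)
    have "\<exists>i\<in>u. \<not> p dvd g i" using g by (auto simp: PiE_iff)
    then obtain i where i: "i \<in> u" "\<not> p dvd g i" by blast
    have i1: "1 \<le> i" "i < p" using u'(5)[OF i(1)] d by auto
    \<comment> \<open>Differentiation brings in the factor \<open>i\<close>, a unit modulo
      \<open>p\<close> because \<open>i <= Max u < p\<close>.\<close>
    have "\<not> p dvd i" using i1 by (auto dest: dvd_imp_le)
    hence "\<not> p dvd i * g i" using i p by (simp add: prime_dvd_mult_iff)
    hence "\<not> int p dvd coeff (pderiv f) (i - 1)"
      using i i1 unfolding coeff_pderiv cf by (simp flip: of_nat_mult of_nat_Suc)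
    hence "card {a \<in> {0..<p}. int p dvd poly (pderiv f) (int a)} \<le> Max u - 1"
      using deg by (intro card_roots_mod_prime_le[OF p]) auto
    hence "real p * real (card {a \<in> {0..<p}. int p dvd poly (pderiv f) (int a)}) \<le> real p * real (Max u - 1)"
      by (intro mult_left_mono) auto
    hence "norm (\<Sum>n<?M. unit_char ?M (poly f (int n))) \<le> real p * real (Max u - 1)"
      using sum_unit_char_square[OF p0, of f] by linarith
    hence "norm (\<Sum>n<?M. unit_char ?M (poly f (int n))) / real ?M \<le> real p * real (Max u - 1) / real ?M"
      by (rule divide_right_mono) simp
    thus ?thesis using p0 by (simp add: nS_def E_def f_def poly_freq_poly lessThan_atLeast0 power2_eq_square)
  qed
  have split: "(\<Sum>g\<in>?P - {?z}. ?w g * nS g) = (\<Sum>g\<in>?P - ?D. ?w g * nS g) + (\<Sum>g\<in>?D - {?z}. ?w g * nS g)"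
  proof -
    have "?P - {?z} = (?P - ?D) \<union> (?D - {?z})" using DP z0 by blast
    thus ?thesis using finP DP by (simp only:) (intro sum.union_disjoint; auto intro: finite_subset)
  qed
  have "(\<Sum>g\<in>?P - ?D. ?w g * nS g) \<le> (\<Sum>g\<in>?P - ?D. ?w g * E)"
    using nS_le w0 by (intro sum_mono mult_left_mono) auto
  also have "\<dots> \<le> (\<Sum>g\<in>?P. ?w g * E)"
    by (intro sum_mono2 finP Diff_subset mult_nonneg_nonneg w0 E0)
  also have "\<dots> = E * (\<Sum>g\<in>?P. ?w g)" by (simp add: sum_distrib_left mult.commute)
  also have "\<dots> \<le> E * (2 + ln (real ?M)) ^ card u"
    using p0 by (intro mult_left_mono sum_PiE_fourier_weight_le u'(1) E0) simp
  also have "ln (real ?M) = 2 * ln (real p)" using p0 by (simp add: ln_realpow)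
  finally have 1: "(\<Sum>g\<in>?P - ?D. ?w g * nS g) \<le> E * (2 + 2 * ln (real p)) ^ card u" .
  have "(\<Sum>g\<in>?D - {?z}. ?w g * nS g) \<le> (\<Sum>g\<in>?D - {?z}. ?w g * 1)"
    by (intro sum_mono mult_left_mono nS_le_1 w0)
  also have "\<dots> = (\<Sum>g\<in>?D. ?w g) - ?w ?z"
    using sum.remove[OF finite_subset[OF DP finP] z0, of ?w] by simp
  also have "?w ?z = 1" by (simp add: fourier_weight_def)
  finally have 2: "(\<Sum>g\<in>?D - {?z}. ?w g * nS g) \<le> (\<Sum>g\<in>?D. ?w g) - 1" .
  have "(\<Sum>g\<in>?D. ?w g) = (\<Prod>i\<in>u. \<Sum>h\<in>{h\<in>{..<?M}. p dvd h}. fourier_weight ?M h)"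
    using u' by (intro prod_sum_PiE[symmetric]) auto
  also have "\<dots> = (1 + (\<Sum>h=1..<p. fourier_weight p h) / real p) ^ card u"
    unfolding sum_fourier_weight_multiples[OF p0] by simp
  also have "\<dots> \<le> (1 + (1 + ln (real p)) / real p) ^ card u"
    using sum_fourier_weight_pos_le[of p] p0
    by (intro power_mono add_left_mono divide_right_mono add_nonneg_nonneg divide_nonneg_nonneg
        sum_nonneg fourier_weight_nonneg) auto
  finally have 3: "(\<Sum>g\<in>?D. ?w g) \<le> (1 + (1 + ln (real p)) / real p) ^ card u" .
  have "(1 + (1 + ln (real p)) / real p) ^ card u - 1 \<le> ((1 + (1 + ln (real p))) ^ card u - 1) / real p"
    using p0 by (intro power_one_plus_divide_le) auto
  also have "1 + (1 + ln (real p)) = 2 + ln (real p)" by simp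
  finally have *: "(\<Sum>g\<in>?P - {?z}. ?w g * nS g) \<le>
      E * (2 + 2 * ln (real p)) ^ card u + ((2 + ln (real p)) ^ card u - 1) / real p"
    using split 1 2 3 by linarith
  have "\<bar>discrepancy_fun s {0..<?M} (Q_point p) (fill_one u z)\<bar> \<le> real (card u) / real ?M + (\<Sum>g\<in>?P - {?z}. ?w g * nS g)"
    unfolding nS_def using p0 u' z by (intro discrepancy_fun_le_fourier) (auto simp: Q_point_def)
  thus ?thesis using * by (simp add: E_def)
qed

section \<open>From the discrepancy function to the weighted bounds\<close>

lemma weighted_star_discrepancy_le:
  assumes s: "s \<ge> 1" and \<gamma>: "\<And>u. u \<in> nonempty_subsets s \<Longrightarrow> \<gamma> u \<ge> 0" and C: "C \<ge> 0"
    and bound: "\<And>u z. u \<in> nonempty_subsets s \<Longrightarrow> (\<And>i. i \<in> u \<Longrightarrow> 0 \<le> z i \<and> z i \<le> 1) \<Longrightarrow>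
       \<bar>discrepancy_fun s I x (fill_one u z)\<bar> \<le> C * (real (Max u) * b u)"
  shows "weighted_star_discrepancy s \<gamma> I x \<le> C * (MAX u \<in> nonempty_subsets s. \<gamma> u * real (Max u) * b u)"
proof -
  let ?U = "nonempty_subsets s"
  have U: "finite ?U" "?U \<noteq> {}"
  proof -
    have "?U \<subseteq> Pow {1..s}" by (auto simp: nonempty_subsets_def)
    thus "finite ?U" by (rule finite_subset) simp
    have "{1} \<in> ?U" using s by (simp add: nonempty_subsets_def)
    thus "?U \<noteq> {}" by blast
  qed
  show ?thesis
    unfolding weighted_star_discrepancy_def
  proof (rule cSUP_least)
    have "(\<lambda>i\<in>{1..s}. 0) \<in> {1..s} \<rightarrow>\<^sub>E {0..1::real}" by auto
    thus "{1..s} \<rightarrow>\<^sub>E {0..1::real} \<noteq> {}" by blast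
    fix z :: "nat \<Rightarrow> real" assume z: "z \<in> {1..s} \<rightarrow>\<^sub>E {0..1}"
    have "\<gamma> u * \<bar>discrepancy_fun s I x (fill_one u z)\<bar> \<le> C * (MAX u \<in> ?U. \<gamma> u * real (Max u) * b u)"
      if u: "u \<in> ?U" for u
    proof -
      have "0 \<le> z i \<and> z i \<le> 1" if "i \<in> u" for i
        using z u that by (auto simp: nonempty_subsets_def PiE_iff)
      hence "\<gamma> u * \<bar>discrepancy_fun s I x (fill_one u z)\<bar> \<le> \<gamma> u * (C * (real (Max u) * b u))"
        using \<gamma>[OF u] bound[OF u] by (intro mult_left_mono) auto
      also have "\<dots> = C * (\<gamma> u * real (Max u) * b u)" by simp
      also have "\<dots> \<le> C * (MAX u \<in> ?U. \<gamma> u * real (Max u) * b u)"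
        using U u C by (intro mult_left_mono Max_ge) auto
      finally show ?thesis .
    qed
    thus "(MAX u \<in> ?U. \<gamma> u * \<bar>discrepancy_fun s I x (fill_one u z)\<bar>) \<le> C * (MAX u \<in> ?U. \<gamma> u * real (Max u) * b u)"
      using U by (subst Max_le_iff) auto
  qed
qed

text \<open>For \<open>L = ln p\<close>, \<open>2 + L <= 4 * L\<close> means
  \<open>L >= 2/3\<close>, which holds from \<open>p = 2\<close> on. The last bound, applied with
  \<open>c = 4\<close>, has base \<open>6 * L\<close> and rests on \<open>L >= 1/2\<close>.\<close>

lemma log_power_bounds:
  assumes "prime p" and c: "c \<ge> (4 :: real)"
  shows "real n \<le> (c * ln (real p)) ^ n" "1 \<le> (c * ln (real p)) ^ n"
    "(2 + ln (real p)) ^ n \<le> (c * ln (real p)) ^ n"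
    "(2 + 2 * ln (real p)) ^ n \<le> ((c + 2) * ln (real p)) ^ n"
proof -
  have p2: "p \<ge> 2" using assms prime_ge_2_nat by blast
  hence "ln (2::real) \<le> ln (real p)" by (intro ln_mono) auto
  hence L: "ln (real p) \<ge> 2 / 3" using ln2_ge_two_thirds by linarith
  have cL: "c * ln (real p) \<ge> 4 * ln (real p)" using c L by (intro mult_right_mono) auto
  have c2L: "(c + 2) * ln (real p) \<ge> 6 * ln (real p)" using c L by (intro mult_right_mono) auto
  have "real n \<le> 2 ^ n" using of_nat_less_two_power[of n] by (metis less_imp_le of_nat_less_two_power)
  also have "\<dots> \<le> (c * ln (real p)) ^ n" using cL L by (intro power_mono) linarith+
  finally show "real n \<le> (c * ln (real p)) ^ n" .
  show "1 \<le> (c * ln (real p)) ^ n" using cL L by (intro one_le_power) linarith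
  show "(2 + ln (real p)) ^ n \<le> (c * ln (real p)) ^ n" using cL L by (intro power_mono) linarith+
  show "(2 + 2 * ln (real p)) ^ n \<le> ((c + 2) * ln (real p)) ^ n" using c2L L by (intro power_mono) linarith+
qed

theorem theorem4:
  fixes p s :: nat and \<gamma> :: "nat set \<Rightarrow> real"
  assumes "prime p" and "s \<ge> 1"
    and "\<And>u. u \<in> nonempty_subsets s \<Longrightarrow> \<gamma> u \<ge> 0"
  shows
    "weighted_star_discrepancy s \<gamma> {0..<p} (P_point p)
       \<le> 2 / sqrt (real p) *
         (MAX u \<in> nonempty_subsets s. \<gamma> u * real (Max u) * (4 * ln (real p)) ^ card u)
     \<and> weighted_star_discrepancy s \<gamma> {0..<p ^ 2} (Q_point p)
       \<le> 3 / real p *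
         (MAX u \<in> nonempty_subsets s. \<gamma> u * real (Max u) * (6 * ln (real p)) ^ card u)
     \<and> weighted_star_discrepancy s \<gamma> ({0..<p} \<times> {0..<p}) (R_point p)
       \<le> 2 / real p *
         (MAX u \<in> nonempty_subsets s. \<gamma> u * real (Max u) * (4 * ln (real p)) ^ card u)"
proof (intro conjI)
  note p = assms(1)
  have p1: "real p \<ge> 1" using prime_ge_1_nat[OF p] by simp
  have sq: "sqrt (real p) \<ge> 1" "sqrt (real p) \<le> real p" "sqrt (real p) * sqrt (real p) = real p"
    using p1 real_sqrt_ge_1_iff[of "real p"] mult_left_mono[of 1 "sqrt (real p)" "sqrt (real p)"] by auto
  show "weighted_star_discrepancy s \<gamma> {0..<p} (P_point p)
       \<le> 2 / sqrt (real p) * (MAX u \<in> nonempty_subsets s. \<gamma> u * real (Max u) * (4 * ln (real p)) ^ card u)"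
  proof (rule weighted_star_discrepancy_le[OF assms(2,3)])
    fix u z assume u: "u \<in> nonempty_subsets s" and z: "\<And>i. i \<in> u \<Longrightarrow> 0 \<le> z i \<and> z i \<le> (1::real)"
    note u' = nonempty_subsetsD[OF u]
    define D where "D = real (Max u)"
    define Y where "Y = (4 * ln (real p)) ^ card u"
    have D1: "D \<ge> 1" using u'(4) by (simp add: D_def)
    note Y = log_power_bounds(1-3)[OF p order.refl, of "card u", folded Y_def]
    show "\<bar>discrepancy_fun s {0..<p} (P_point p) (fill_one u z)\<bar> \<le> 2 / sqrt (real p) * (D * Y)"
    proof (cases "Max u < p")
      case True
      have "\<bar>discrepancy_fun s {0..<p} (P_point p) (fill_one u z)\<bar> \<le>
          real (card u) / real p + (D - 1) / sqrt (real p) * (2 + ln (real p)) ^ card u"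
        using discrepancy_P_le[OF p u True z] u'(4) by (simp add: D_def of_nat_diff)
      \<comment> \<open>The factor \<open>D - 1\<close> from Weil's bound leaves room for one
        \<open>Y / sqrt p\<close>, which absorbs the rounding error
        \<open>card u / p\<close>.\<close>
      also have "\<dots> \<le> Y / sqrt (real p) + (D - 1) / sqrt (real p) * Y"
        using Y D1 sq p1 by (intro add_mono frac_le mult_left_mono) auto
      also have "\<dots> = D * Y / sqrt (real p)" using sq by (simp add: field_simps)
      also have "\<dots> \<le> 2 / sqrt (real p) * (D * Y)" using sq D1 Y by (simp add: divide_right_mono)
      finally show ?thesis .
    next
      case False
      hence "real p \<le> D" by (simp add: D_def)
      hence "sqrt (real p) * 1 \<le> D * Y" using sq Y by (intro mult_mono) auto
      hence "sqrt (real p) \<le> 2 * (D * Y)" using sq(1) by linarith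
      hence "1 \<le> 2 / sqrt (real p) * (D * Y)" using sq(1) by (simp add: field_simps)
      moreover have "\<bar>discrepancy_fun s {0..<p} (P_point p) (fill_one u z)\<bar> \<le> 1"
        by (intro abs_discrepancy_fun_le_1 u'(3) z) simp
      ultimately show ?thesis by linarith
    qed
  qed (simp_all add: divide_nonneg_nonneg)
  show "weighted_star_discrepancy s \<gamma> {0..<p ^ 2} (Q_point p)
       \<le> 3 / real p * (MAX u \<in> nonempty_subsets s. \<gamma> u * real (Max u) * (6 * ln (real p)) ^ card u)"
  proof (rule weighted_star_discrepancy_le[OF assms(2,3)])
    fix u z assume u: "u \<in> nonempty_subsets s" and z: "\<And>i. i \<in> u \<Longrightarrow> 0 \<le> z i \<and> z i \<le> (1::real)"
    note u' = nonempty_subsetsD[OF u]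
    define D where "D = real (Max u)"
    define Y where "Y = (6 * ln (real p)) ^ card u"
    have D1: "D \<ge> 1" using u'(4) by (simp add: D_def)
    have Y: "real (card u) \<le> Y" "1 \<le> Y" "(2 + ln (real p)) ^ card u \<le> Y" "(2 + 2 * ln (real p)) ^ card u \<le> Y"
      using log_power_bounds(1-3)[OF p, of 6 "card u"] log_power_bounds(4)[OF p, of 4 "card u"]
      by (simp_all add: Y_def)
    show "\<bar>discrepancy_fun s {0..<p\<^sup>2} (Q_point p) (fill_one u z)\<bar> \<le> 3 / real p * (D * Y)"
    proof (cases "Max u < p")
      case True
      have "\<bar>discrepancy_fun s {0..<p\<^sup>2} (Q_point p) (fill_one u z)\<bar> \<le> real (card u) / (real p)\<^sup>2 +
          (D - 1) / real p * (2 + 2 * ln (real p)) ^ card u + ((2 + ln (real p)) ^ card u - 1) / real p"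
        using discrepancy_Q_le[OF p u True z] u'(4) by (simp add: D_def of_nat_diff)
      \<comment> \<open>The terms are the rounding error, the frequencies not all divisible by
        \<open>p\<close>, and those divisible by \<open>p\<close>; the last adds one more
        \<open>Y / p\<close>, giving \<open>D + 1\<close> in place of \<open>D\<close>.\<close>
      also have "\<dots> \<le> Y / real p + (D - 1) / real p * Y + Y / real p"
        using Y D1 p1 self_le_power[of "real p" 2]
        by (intro add_mono frac_le mult_left_mono) auto
      also have "\<dots> = (D + 1) * Y / real p" using p1 by (simp add: field_simps)
      also have "\<dots> \<le> (3 * D) * Y / real p"
        using D1 Y p1 by (intro divide_right_mono mult_right_mono) auto
      finally show ?thesis by simp
    next
      case False
      hence "real p \<le> D" by (simp add: D_def)
      hence "real p * 1 \<le> D * Y" using Y p1 by (intro mult_mono) auto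
      hence "real p \<le> 3 * (D * Y)" using p1 by linarith
      hence "1 \<le> 3 / real p * (D * Y)" using p1 by (simp add: field_simps)
      moreover have "\<bar>discrepancy_fun s {0..<p\<^sup>2} (Q_point p) (fill_one u z)\<bar> \<le> 1"
        by (intro abs_discrepancy_fun_le_1 u'(3) z) simp
      ultimately show ?thesis by linarith
    qed
  qed (simp_all add: divide_nonneg_nonneg)
  show "weighted_star_discrepancy s \<gamma> ({0..<p} \<times> {0..<p}) (R_point p)
       \<le> 2 / real p * (MAX u \<in> nonempty_subsets s. \<gamma> u * real (Max u) * (4 * ln (real p)) ^ card u)"
  proof (rule weighted_star_discrepancy_le[OF assms(2,3)])
    fix u z assume u: "u \<in> nonempty_subsets s" and z: "\<And>i. i \<in> u \<Longrightarrow> 0 \<le> z i \<and> z i \<le> (1::real)"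
    note u' = nonempty_subsetsD[OF u]
    define D where "D = real (Max u)"
    define Y where "Y = (4 * ln (real p)) ^ card u"
    have D1: "D \<ge> 1" using u'(4) by (simp add: D_def)
    note Y = log_power_bounds(1-3)[OF p order.refl, of "card u", folded Y_def]
    \<comment> \<open>There is no case distinction on \<open>Max u\<close> here: the root count
      modulo \<open>p\<close> is valid for every degree.\<close>
    have "\<bar>discrepancy_fun s ({0..<p} \<times> {0..<p}) (R_point p) (fill_one u z)\<bar> \<le>
        real (card u) / real p + (D - 1) / real p * (2 + ln (real p)) ^ card u"
      using discrepancy_R_le[OF p u z] u'(4) by (simp add: D_def of_nat_diff)
    also have "\<dots> \<le> Y / real p + (D - 1) / real p * Y"
      using Y D1 p1 by (intro add_mono frac_le mult_left_mono) auto
    also have "\<dots> = D * Y / real p" using p1 by (simp add: field_simps)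
    also have "\<dots> \<le> 2 / real p * (D * Y)" using p1 D1 Y by (simp add: divide_right_mono)
    finally show "\<bar>discrepancy_fun s ({0..<p} \<times> {0..<p}) (R_point p) (fill_one u z)\<bar> \<le> 2 / real p * (D * Y)" .
  qed (simp_all add: divide_nonneg_nonneg)
qed

end
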